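(* Let $\Lambda$ be an integer lattice with form $(\cdot|\cdot)$, let $\Pi$ be a $\mathbb Z$-basis of $\Lambda$, and let $V_\Lambda$ be the lattice vertex algebra constructed with a cocycle $\varepsilon$ such that $\varepsilon(a,a)=1$ for every $a\in\Pi$. Then $V_\Lambda$ is presented by the generators $\{v_a: a\in\pm\Pi\}$ with locality bound given by $N(v_a,v_b)=-(a|b)$ for $a,b\in\pm\Pi$ and relations $$v_{a\,((a|a)-1)}v_{-a}=\mathbf 1,\qquad a\in\Pi .$$
   Context: All spaces are over a field $\Bbbk$ of characteristic $0$. A vertex algebra is a superspace $A=A_{\bar0}\oplus A_{\bar1}$ with even bilinear products $(a,b)\mapsto a_{(n)}b$, $n\in\mathbb Z$, and a distinguished even element $\mathbf 1$. Put $Da=a_{(-2)}\mathbf 1$, $D^{(k)}=\frac1{k!}D^k$, $Y(a)(z)=\sum_{n\in\mathbb Z}a_{(n)}z^{-n-1}$, where $a_{(n)}$ is viewed as an operator on $A$. Axioms: (V1) $a_{(n)}b=0$ for $n\gg0$; (V2) $\mathbf 1_{(n)}a=\delta_{n,-1}a$, $a_{(n)}\mathbf 1=0$ for $n\ge0$ and $a_{(n)}\mathbf 1=D^{(-n-1)}a$ for $n<0$; (V3) $(Da)_{(n)}b=-n\,a_{(n-1)}b$ and $a_{(n)}(Db)=n\,a_{(n-1)}b+D(a_{(n)}b)$; (V4) locality: for parity-homogeneous $a,b$ there is $M\in\mathbb Z$ such that $Y(a)(w)Y(b)(z)\,\iota_{w,z}(w-z)^M=(-1)^{p(a)p(b)}Y(b)(z)Y(a)(w)\,\iota_{z,w}(w-z)^M$,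 where $p$ is the parity and $\iota_{w,z}$ (resp. $\iota_{z,w}$) means expansion in nonnegative powers of $z$ (resp. of $w$). Homomorphisms preserve $\mathbf 1$ and all products; an ideal is a subspace $I\subset A$ with $a_{(n)}I\subset I$ and $I_{(n)}a\subset I$ for all $a\in A$, $n\in\mathbb Z$. Free vertex algebra: for a set $\mathcal B$ and a symmetric $N:\mathcal B\times\mathcal B\to\mathbb Z$, $\mathfrak F_N(\mathcal B)$ is the vertex algebra generated by $\mathcal B$, where $a\in\mathcal B$ has parity $N(a,a)\bmod 2$ and $a_{(n)}b=0$ for $a,b\in\mathcal B$, $n\ge N(a,b)$, which is universal with these properties: for any vertex algebra $A$ and any map $\iota:\mathcal B\to A$ with $\iota(a)$ of parity $N(a,a)\bmod 2$ and $\iota(a)_{(n)}\iota(b)=0$ whenever $n\ge N(a,b)$, there is a unique vertex algebra homomorphism $\mathfrak F_N(\mathcal B)\to A$ extending $\iota$. Presentation: a vertex algebra $A$ generated by $\mathcal B$ is presented by generators $\mathcal B$, locality bound $N$ and relations $\{r_i=s_i\}$ if the canonical homomorphism $\mathfrak F_N(\mathcal B)\to A$ exists, is surjective, and its kernel is the ideal generated by the elements $r_i-s_i\in\mathfrak F_N(\mathcal B)$. Lattice vertex algebra: an integer lattice is a free abelian group $\Lambda$ (any rank, possibly infinite) with a symmetric bilinear form $(\cdot|\cdot)$ with values in $\mathbb Z$ (possibly degenerate or indefinite). Let $\mathfrak h=\Lambda\otimes_{\mathbb Z}\Bbbk$ and $H=\mathfrak h\otimes\Bbbk[t,t^{-1}]\oplus\Bbbk\mathsf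 c$, $h(n)=h\otimes t^n$, with brackets $[g(m),h(n)]=\delta_{m,-n}m(g|h)\mathsf c$, $\mathsf c$ central. For $a\in\Lambda$ let $V_a$ be the Verma $H$-module generated by a vector $v_a$ with $h(n)v_a=0$ for $n>0$, $h(0)v_a=(h|a)v_a$, $\mathsf c=\mathrm{Id}$. Put $V_\Lambda=\bigoplus_{a\in\Lambda}V_a$, with $V_a$ of parity $(a|a)\bmod2$. Fix a bimultiplicative $\varepsilon:\Lambda\times\Lambda\to\{\pm1\}$ (the cocycle) with $\varepsilon(a,b)=(-1)^{(a|a)(b|b)+(a|b)}\varepsilon(b,a)$. Then $V_\Lambda$ has a unique vertex algebra structure with $\mathbf 1=v_0$, $(h(-1)v_0)_{(n)}v=h(n)v$ for $h\in\mathfrak h$, $v\in V_\Lambda$, $n\in\mathbb Z$, and $v_{a\,(n)}v_b=0$ for $n\ge-(a|b)$, $v_{a\,(-(a|b)-k-1)}v_b=\varepsilon(a,b)\frac1{k!}(D-b(-1))^kv_{a+b}$ for $k\ge0$ ($a,b\in\Lambda$). Notation: $\pm\Pi=\Pi\cup(-\Pi)$. *)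

theory Defs
  imports Complex_Main "HOL-Library.Poly_Mapping"
begin

section \<open>Vertex algebras\<close>

text \<open>
  A vector space over \<open>'k\<close> is given by a subspace \<open>carrier V\<close> of an ambient vector space, whose
  elements form the type \<open>'v\<close> and whose scalar multiplication is \<open>scale V\<close>.  \<open>part V False\<close> and
  \<open>part V True\<close> are the even and the odd part, and \<open>vprod V n a b\<close> is the product
  \<open>a\<^sub>(\<^sub>n\<^sub>)b\<close>; its values outside the carrier are irrelevant.
\<close>

record ('k, 'v) va =
  carrier :: "'v set"
  scale :: "'k \<Rightarrow> 'v \<Rightarrow> 'v"
  part :: "bool \<Rightarrow> 'v set"
  vprod :: "int \<Rightarrow> 'v \<Rightarrow> 'v \<Rightarrow> 'v"
  vone :: "'v"

definition va_D :: "('k, 'v) va \<Rightarrow> 'v \<Rightarrow> 'v" where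
  "va_D V a = vprod V (-2) a (vone V)"

definition koszul_sign :: "bool \<Rightarrow> bool \<Rightarrow> 'k::ring_1" where
  "koszul_sign p q = (if p \<and> q then -1 else 1)"

text \<open>
  Locality of order \<open>M\<close> of \<open>a\<close> and \<open>b\<close> of parities \<open>p\<close> and \<open>q\<close>, written out for the coefficients
  of \<open>w\<^bsup>-m-1\<^esup>z\<^bsup>-n-1\<^esup>\<close>, applied to \<open>c\<close>.  The expansions of \<open>(w-z)\<^bsup>M\<^esup>\<close> are
  \<open>\<Sum>\<^sub>j (-1)\<^bsup>j\<^esup> (M choose j) w\<^bsup>M-j\<^esup>z\<^bsup>j\<^esup>\<close> in nonnegative powers of \<open>z\<close> and
  \<open>(-1)\<^bsup>M\<^esup> \<Sum>\<^sub>j (-1)\<^bsup>j\<^esup> (M choose j) z\<^bsup>M-j\<^esup>w\<^bsup>j\<^esup>\<close> in nonnegative powers of \<open>w\<close>.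
  By (V1), which is imposed below, both sums have finitely many nonzero terms.
\<close>

definition mutually_local ::
    "('k::field_char_0, 'v::ab_group_add) va \<Rightarrow> bool \<Rightarrow> bool \<Rightarrow> int \<Rightarrow> 'v \<Rightarrow> 'v \<Rightarrow> bool" where
  "mutually_local V p q M a b \<longleftrightarrow>
     (\<forall>m n. \<forall>c\<in>carrier V.
        Sum_any (\<lambda>j::nat. scale V ((-1) ^ j * (of_int M gchoose j))
                   (vprod V (m + M - int j) a (vprod V (n + int j) b c))) =
        scale V (koszul_sign p q * (-1) powi M)
          (Sum_any (\<lambda>j::nat. scale V ((-1) ^ j * (of_int M gchoose j))
                   (vprod V (n + M - int j) b (vprod V (m + int j) a c)))))"

locale vertex_algebra =
  fixes V :: "('k::field_char_0, 'v::ab_group_add) va"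
  assumes ambient: "vector_space (scale V)"
    and carrier_subspace: "module.subspace (scale V) (carrier V)"
    and part_subspace: "module.subspace (scale V) (part V p)"
    and part_sum: "carrier V = {x + y | x y. x \<in> part V False \<and> y \<in> part V True}"
    and part_inter: "part V False \<inter> part V True = {0}"
    and one_even: "vone V \<in> part V False"
    and prod_even: "\<lbrakk>a \<in> part V p; b \<in> part V q\<rbrakk> \<Longrightarrow> vprod V n a b \<in> part V (p \<noteq> q)"
    and prod_add_left: "\<lbrakk>a \<in> carrier V; b \<in> carrier V; c \<in> carrier V\<rbrakk>
           \<Longrightarrow> vprod V n (a + b) c = vprod V n a c + vprod V n b c"
    and prod_add_right: "\<lbrakk>a \<in> carrier V; b \<in> carrier V; c \<in> carrier V\<rbrakk>
           \<Longrightarrow> vprod V n a (b + c) = vprod V n a b + vprod V n a c"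
    and prod_scale_left: "\<lbrakk>a \<in> carrier V; b \<in> carrier V\<rbrakk>
           \<Longrightarrow> vprod V n (scale V r a) b = scale V r (vprod V n a b)"
    and prod_scale_right: "\<lbrakk>a \<in> carrier V; b \<in> carrier V\<rbrakk>
           \<Longrightarrow> vprod V n a (scale V r b) = scale V r (vprod V n a b)"
    and V1: "\<lbrakk>a \<in> carrier V; b \<in> carrier V\<rbrakk> \<Longrightarrow> \<exists>n0. \<forall>n\<ge>n0. vprod V n a b = 0"
    and V2_left: "a \<in> carrier V \<Longrightarrow> vprod V n (vone V) a = (if n = -1 then a else 0)"
    and V2_right_nonneg: "\<lbrakk>a \<in> carrier V; n \<ge> 0\<rbrakk> \<Longrightarrow> vprod V n a (vone V) = 0"
    and V2_right_neg: "\<lbrakk>a \<in> carrier V; n < 0\<rbrakk> \<Longrightarrow> vprod V n a (vone V) =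
           scale V (1 / fact (nat (-n-1))) ((va_D V ^^ nat (-n-1)) a)"
    and V3_left: "\<lbrakk>a \<in> carrier V; b \<in> carrier V\<rbrakk> \<Longrightarrow>
           vprod V n (va_D V a) b = scale V (- of_int n) (vprod V (n - 1) a b)"
    and V3_right: "\<lbrakk>a \<in> carrier V; b \<in> carrier V\<rbrakk> \<Longrightarrow>
           vprod V n a (va_D V b) = scale V (of_int n) (vprod V (n - 1) a b) + va_D V (vprod V n a b)"
    and V4: "\<lbrakk>a \<in> part V p; b \<in> part V q\<rbrakk> \<Longrightarrow> \<exists>M. mutually_local V p q M a b"

definition va_hom ::
    "('k, 'v::ab_group_add) va \<Rightarrow> ('k, 'w::ab_group_add) va \<Rightarrow> ('v \<Rightarrow> 'w) \<Rightarrow> bool" where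
  "va_hom A B f \<longleftrightarrow>
     (\<forall>x\<in>carrier A. f x \<in> carrier B) \<and>
     (\<forall>x\<in>carrier A. \<forall>y\<in>carrier A. f (x + y) = f x + f y) \<and>
     (\<forall>r. \<forall>x\<in>carrier A. f (scale A r x) = scale B r (f x)) \<and>
     f (vone A) = vone B \<and>
     (\<forall>n. \<forall>x\<in>carrier A. \<forall>y\<in>carrier A. f (vprod A n x y) = vprod B n (f x) (f y))"

definition va_ideal :: "('k::field_char_0, 'v::ab_group_add) va \<Rightarrow> 'v set \<Rightarrow> bool" where
  "va_ideal A I \<longleftrightarrow> I \<subseteq> carrier A \<and> module.subspace (scale A) I \<and>
     (\<forall>n. \<forall>a\<in>carrier A. \<forall>x\<in>I. vprod A n a x \<in> I \<and> vprod A n x a \<in> I)"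

definition va_ideal_generated ::
    "('k::field_char_0, 'v::ab_group_add) va \<Rightarrow> 'v set \<Rightarrow> 'v set" where
  "va_ideal_generated A X = \<Inter>{I. va_ideal A I \<and> X \<subseteq> I}"

definition va_generated :: "('k::field_char_0, 'v::ab_group_add) va \<Rightarrow> 'v set \<Rightarrow> bool" where
  "va_generated A X \<longleftrightarrow> X \<subseteq> carrier A \<and>
     (\<forall>S. S \<subseteq> carrier A \<and> module.subspace (scale A) S \<and> X \<subseteq> S \<and> vone A \<in> S \<and>
          (\<forall>n. \<forall>x\<in>S. \<forall>y\<in>S. vprod A n x y \<in> S) \<longrightarrow> S = carrier A)"


section \<open>Free vertex algebras and presentations\<close>

definition locality_bounded ::
    "'b set \<Rightarrow> ('b \<Rightarrow> 'b \<Rightarrow> int) \<Rightarrow> ('k::field_char_0, 'v::ab_group_add) va \<Rightarrow> ('b \<Rightarrow> 'v) \<Rightarrow> bool" where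
  "locality_bounded B N A g \<longleftrightarrow>
     (\<forall>a\<in>B. g a \<in> part A (odd (N a a))) \<and>
     (\<forall>a\<in>B. \<forall>b\<in>B. \<forall>n\<ge>N a b. vprod A n (g a) (g b) = 0)"

text \<open>
  \<open>F\<close> with \<open>i : B \<rightarrow> F\<close> is the free vertex algebra with generators \<open>B\<close> and locality bound \<open>N\<close>.
  The universal property can only be stated for the vertex algebras \<open>A\<close> over one ambient type
  \<open>'u\<close>.  Nothing is lost if \<open>'u\<close> has room enough: since \<open>A\<close> may be replaced by its vertex
  subalgebra generated by the image of \<open>B\<close>, it suffices that every vertex algebra with \<open>|B|\<close>
  generators is isomorphic to one whose carrier is a subset of \<open>'u\<close>.  Such an algebra is spanned by
  the iterated products of its generators, so a subspace of \<open>'u\<close> of dimension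
  \<open>max |B| \<aleph>\<^sub>0\<close> is room enough (dimension 1 if \<open>B\<close> is empty).  The lattice vertex
  algebra of a lattice with basis \<open>\<Pi>\<close> has just this dimension for \<open>B = \<plusminus>\<Pi>\<close>.
\<close>

definition free_vertex_algebra ::
    "'u::ab_group_add itself \<Rightarrow> 'b set \<Rightarrow> ('b \<Rightarrow> 'b \<Rightarrow> int) \<Rightarrow>
     ('k::field_char_0, 'v::ab_group_add) va \<Rightarrow> ('b \<Rightarrow> 'v) \<Rightarrow> bool" where
  "free_vertex_algebra U B N F i \<longleftrightarrow>
     vertex_algebra F \<and> va_generated F (i ` B) \<and> locality_bounded B N F i \<and>
     (\<forall>(A :: ('k, 'u) va) g. vertex_algebra A \<and> locality_bounded B N A g \<longrightarrow>
        (\<exists>f. va_hom F A f \<and> (\<forall>b\<in>B. f (i b) = g b) \<and>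
             (\<forall>f'. va_hom F A f' \<and> (\<forall>b\<in>B. f' (i b) = g b) \<longrightarrow>
                   (\<forall>x\<in>carrier F. f' x = f x))))"

text \<open>
  \<open>F\<close>, \<open>i\<close> is the free vertex algebra on \<open>B\<close>, the generators of \<open>A\<close> are the \<open>g b\<close> for
  \<open>b \<in> B\<close>, and \<open>(r, s) \<in> R\<close> stands for the relation \<open>r = s\<close>.
\<close>

definition va_presented ::
    "('k::field_char_0, 'f::ab_group_add) va \<Rightarrow> ('b \<Rightarrow> 'f) \<Rightarrow> 'b set \<Rightarrow>
     ('k, 'v::ab_group_add) va \<Rightarrow> ('b \<Rightarrow> 'v) \<Rightarrow> ('f \<times> 'f) set \<Rightarrow> bool" where
  "va_presented F i B A g R \<longleftrightarrow>
     (\<exists>f. va_hom F A f \<and> (\<forall>b\<in>B. f (i b) = g b) \<and>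
          f ` carrier F = carrier A \<and>
          {x \<in> carrier F. f x = 0} = va_ideal_generated F {r - s | r s. (r, s) \<in> R})"


section \<open>Integer lattices\<close>

definition zmul :: "int \<Rightarrow> 'l::ab_group_add \<Rightarrow> 'l" where
  "zmul n x = (if n \<ge> 0 then ((+) x ^^ nat n) 0 else - (((+) x ^^ nat (-n)) 0))"

lemma zmul_succ: "zmul (n + 1) x = x + zmul n x"
proof (cases "n \<ge> 0")
  case True
  then have "nat (n + 1) = Suc (nat n)" by simp
  with True show ?thesis by (simp add: zmul_def)
next
  case False
  show ?thesis
  proof (cases "n = -1")
    case True
    then show ?thesis by (simp add: zmul_def)
  next
    case neq: False
    with False have "nat (-n) = Suc (nat (-(n+1)))" "\<not> n + 1 \<ge> 0" by simp_all
    with False show ?thesis by (simp add: zmul_def)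
  qed
qed

lemma zmul_zero: "zmul 0 x = 0"
  by (simp add: zmul_def)

lemma zmul_pred: "zmul (n - 1) x = zmul n x - x"
  using zmul_succ[of "n - 1" x] by simp

lemma zmul_add: "zmul (m + n) x = zmul m x + zmul n x"
proof (induction m rule: int_induct[where k = 0])
  case (step1 i)
  have "zmul (i + 1 + n) x = x + zmul (i + n) x"
    using zmul_succ[of "i + n" x] by (simp only: ac_simps)
  with step1 show ?case by (simp add: zmul_succ add.assoc)
next
  case (step2 i)
  have "zmul (i - 1 + n) x = zmul (i + n) x - x"
    using zmul_pred[of "i + n" x] by (simp add: diff_add_eq)
  with step2 show ?case by (simp add: zmul_pred)
qed (simp add: zmul_zero)

lemma zmul_add_right: "zmul m (x + y) = zmul m x + zmul m y"
  by (induction m rule: int_induct[where k = 0])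
    (simp_all add: zmul_zero zmul_succ zmul_pred)

lemma zmul_mult: "zmul m (zmul n x) = zmul (m * n) x"
proof (induction m rule: int_induct[where k = 0])
  case (step1 i)
  have "zmul ((i + 1) * n) x = zmul (i * n) x + zmul n x"
    by (simp flip: zmul_add add: distrib_right)
  with step1 show ?case by (subst zmul_succ) (simp only: add.commute)
next
  case (step2 i)
  have "zmul (i * n) x = zmul ((i - 1) * n) x + zmul n x"
    by (simp flip: zmul_add add: left_diff_distrib)
  with step2 show ?case by (simp add: zmul_pred)
qed (simp add: zmul_zero)

global_interpretation zmod: module "zmul :: int \<Rightarrow> 'l::ab_group_add \<Rightarrow> 'l"
  using zmul_succ[of 0]
  by unfold_locales (simp_all add: zmul_add zmul_add_right zmul_mult zmul_zero)

definition Z_basis :: "'l::ab_group_add set \<Rightarrow> bool" where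
  "Z_basis P \<longleftrightarrow> zmod.independent P \<and> zmod.span P = UNIV"

text \<open>
  The lattice is the whole type \<open>'l\<close>; its freeness is expressed by the existence of a basis.
\<close>

definition lattice_form :: "('l::ab_group_add \<Rightarrow> 'l \<Rightarrow> int) \<Rightarrow> bool" where
  "lattice_form bil \<longleftrightarrow>
     (\<forall>a b. bil a b = bil b a) \<and> (\<forall>a b c. bil (a + b) c = bil a c + bil b c)"

definition lattice_cocycle ::
    "('l::ab_group_add \<Rightarrow> 'l \<Rightarrow> int) \<Rightarrow> ('l \<Rightarrow> 'l \<Rightarrow> 'k::field_char_0) \<Rightarrow> bool" where
  "lattice_cocycle bil \<epsilon> \<longleftrightarrow>
     (\<forall>a b. \<epsilon> a b \<in> {1, -1}) \<and>
     (\<forall>a b c. \<epsilon> (a + b) c = \<epsilon> a c * \<epsilon> b c) \<and>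
     (\<forall>a b c. \<epsilon> a (b + c) = \<epsilon> a b * \<epsilon> a c) \<and>
     (\<forall>a b. \<epsilon> a b = (-1) powi (bil a a * bil b b + bil a b) * \<epsilon> b a)"


section \<open>The Heisenberg algebra and its Verma modules\<close>

text \<open>
  A module over the Heisenberg algebra on which the central element acts as the identity: \<open>act h n\<close>
  is the action of \<open>h(n)\<close>.  It is given for \<open>h\<close> in the lattice only; by additivity it extends
  uniquely to the vector space spanned by the lattice, and bilinearity reduces the commutation
  relations to the lattice as well.
\<close>

definition heisenberg_module ::
    "('l::ab_group_add \<Rightarrow> 'l \<Rightarrow> int) \<Rightarrow> ('k::field_char_0 \<Rightarrow> 'v \<Rightarrow> 'v) \<Rightarrow>
     ('l \<Rightarrow> int \<Rightarrow> 'v \<Rightarrow> 'v) \<Rightarrow> 'v::ab_group_add set \<Rightarrow> bool" where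
  "heisenberg_module bil s act M \<longleftrightarrow>
     module.subspace s M \<and>
     (\<forall>h n. \<forall>x\<in>M. act h n x \<in> M) \<and>
     (\<forall>h n. \<forall>x\<in>M. \<forall>y\<in>M. act h n (x + y) = act h n x + act h n y) \<and>
     (\<forall>h n r. \<forall>x\<in>M. act h n (s r x) = s r (act h n x)) \<and>
     (\<forall>g h n. \<forall>x\<in>M. act (g + h) n x = act g n x + act h n x) \<and>
     (\<forall>g h m n. \<forall>x\<in>M. act g m (act h n x) - act h n (act g m x) =
        (if m = -n then s (of_int (m * bil g h)) x else 0))"

text \<open>
  The free vector space on the words \<open>h\<^sub>1(n\<^sub>1) \<dots> h\<^sub>r(n\<^sub>r)\<close> in the symbols \<open>h(n)\<close>.
\<close>

type_synonym ('k, 'l) words = "('l \<times> int) list \<Rightarrow>\<^sub>0 'k"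

definition wscale :: "'k::field_char_0 \<Rightarrow> ('k, 'l) words \<Rightarrow> ('k, 'l) words" where
  "wscale c = Poly_Mapping.map ((*) c)"

lemma lookup_wscale:
  "Poly_Mapping.lookup (wscale c w) k = c * Poly_Mapping.lookup w k"
  by (simp add: wscale_def Poly_Mapping.map.rep_eq when_def)

global_interpretation words: vector_space "wscale :: 'k::field_char_0 \<Rightarrow> _ \<Rightarrow> ('k, 'l) words"
  by unfold_locales (rule poly_mapping_eqI; simp add: lookup_wscale lookup_add algebra_simps)+

abbreviation word :: "('l \<times> int) list \<Rightarrow> ('k::field_char_0, 'l) words" where
  "word ws \<equiv> Poly_Mapping.single ws 1"

definition eval_words ::
    "('k::field_char_0 \<Rightarrow> 'v \<Rightarrow> 'v) \<Rightarrow> ('l \<Rightarrow> int \<Rightarrow> 'v \<Rightarrow> 'v) \<Rightarrow> 'v \<Rightarrow>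
     ('k, 'l) words \<Rightarrow> 'v::ab_group_add" where
  "eval_words s act v w =
     (\<Sum>ws\<in>Poly_Mapping.keys w. s (Poly_Mapping.lookup w ws) (foldr (\<lambda>(h, n). act h n) ws v))"

text \<open>
  The relations between the words, applied to a highest weight vector of weight \<open>a\<close>, that follow
  from the defining relations of the Heisenberg algebra, from \<open>c = Id\<close>, and from the highest
  weight conditions.  In terms of the enveloping algebra, the words modulo the first two families
  form \<open>U(H)/(c - 1)\<close>, and the last two families generate the left ideal annihilating the
  highest weight vector of the Verma module.
\<close>

definition verma_relations ::
    "('l::ab_group_add \<Rightarrow> 'l \<Rightarrow> int) \<Rightarrow> 'l \<Rightarrow> ('k::field_char_0, 'l) words set" where
  "verma_relations bil a = words.span (
     {word (us @ (g + h, n) # ws) - word (us @ (g, n) # ws) - word (us @ (h, n) # ws)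
       | us g h n ws. True} \<union>
     {word (us @ (g, m) # (h, n) # ws) - word (us @ (h, n) # (g, m) # ws)
         - wscale (if m = -n then of_int (m * bil g h) else 0) (word (us @ ws))
       | us g m h n ws. True} \<union>
     {word (us @ [(h, n)]) | us h n. n > 0} \<union>
     {word (us @ [(h, 0)]) - wscale (of_int (bil h a)) (word us) | us h. True})"

text \<open>
  \<open>M\<close> is the Verma module generated by \<open>v\<close> of weight \<open>a\<close>: it is generated by \<open>v\<close>, which
  satisfies the highest weight conditions, and all relations are consequences of these.
\<close>

definition verma_module ::
    "('l::ab_group_add \<Rightarrow> 'l \<Rightarrow> int) \<Rightarrow> ('k::field_char_0 \<Rightarrow> 'v \<Rightarrow> 'v) \<Rightarrow>
     ('l \<Rightarrow> int \<Rightarrow> 'v \<Rightarrow> 'v) \<Rightarrow> 'l \<Rightarrow> 'v \<Rightarrow> 'v::ab_group_add set \<Rightarrow> bool" where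
  "verma_module bil s act a v M \<longleftrightarrow>
     heisenberg_module bil s act M \<and>
     v \<in> M \<and>
     (\<forall>h n. n > 0 \<longrightarrow> act h n v = 0) \<and>
     (\<forall>h. act h 0 v = s (of_int (bil h a)) v) \<and>
     M = range (eval_words s act v) \<and>
     (\<forall>w. eval_words s act v w = 0 \<longrightarrow> w \<in> verma_relations bil a)"


section \<open>Lattice vertex algebras\<close>

definition internal_direct_sum ::
    "('k::field_char_0 \<Rightarrow> 'v \<Rightarrow> 'v) \<Rightarrow> ('l \<Rightarrow> 'v set) \<Rightarrow> 'v::ab_group_add set \<Rightarrow> bool" where
  "internal_direct_sum s M C \<longleftrightarrow>
     (\<forall>a. module.subspace s (M a)) \<and>
     C = module.span s (\<Union>a. M a) \<and>
     (\<forall>S u. finite S \<and> (\<forall>a\<in>S. u a \<in> M a) \<and> (\<Sum>a\<in>S. u a) = 0 \<longrightarrow> (\<forall>a\<in>S. u a = 0))"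

text \<open>
  \<open>V\<close> is the lattice vertex algebra with cocycle \<open>\<epsilon>\<close>, where \<open>act h n\<close> is the action of
  \<open>h(n)\<close> and \<open>v a\<close> is the highest weight vector of the summand with index \<open>a\<close>.  These conditions
  determine \<open>(V, act, v)\<close> up to a unique isomorphism.
\<close>

definition lattice_vertex_algebra ::
    "('l::ab_group_add \<Rightarrow> 'l \<Rightarrow> int) \<Rightarrow> ('l \<Rightarrow> 'l \<Rightarrow> 'k::field_char_0) \<Rightarrow>
     ('l \<Rightarrow> int \<Rightarrow> 'v \<Rightarrow> 'v) \<Rightarrow> ('l \<Rightarrow> 'v) \<Rightarrow> ('k, 'v::ab_group_add) va \<Rightarrow> bool" where
  "lattice_vertex_algebra bil \<epsilon> act v V \<longleftrightarrow>
     vertex_algebra V \<and>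
     heisenberg_module bil (scale V) act (carrier V) \<and>
     (\<exists>M. (\<forall>a. verma_module bil (scale V) act a (v a) (M a)) \<and>
          internal_direct_sum (scale V) M (carrier V) \<and>
          (\<forall>p. part V p = module.span (scale V) (\<Union>a\<in>{a. odd (bil a a) = p}. M a))) \<and>
     vone V = v 0 \<and>
     (\<forall>h n. \<forall>x\<in>carrier V. vprod V n (act h (-1) (v 0)) x = act h n x) \<and>
     (\<forall>a b n. n \<ge> - bil a b \<longrightarrow> vprod V n (v a) (v b) = 0) \<and>
     (\<forall>a b k. vprod V (- bil a b - int k - 1) (v a) (v b) =
        scale V (\<epsilon> a b * (1 / fact k))
          (((\<lambda>x. va_D V x - act b (-1) x) ^^ k) (v (a + b))))"

end

theory Submission
  imports Defs
begin

text \<open>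
  Let \<open>F\<close> be the free vertex algebra, \<open>K\<close> the ideal generated by the relations and \<open>Q = F/K\<close>, with
  generators \<open>u\<^sub>a\<close> for \<open>a \<in> \<plusminus>\<Pi>\<close>.  The canonical map \<open>F \<rightarrow> V\<^sub>\<Lambda>\<close> kills \<open>K\<close>, because
  \<open>\<epsilon>(a,a) = 1\<close> forces \<open>\<epsilon>(a,-a) = 1\<close>, so it remains to see that \<open>Q \<rightarrow> V\<^sub>\<Lambda>\<close> is bijective.

  Everything in \<open>Q\<close> comes out of the Borcherds identity (\<open>borcherds\<close>), whose three exponents can be
  chosen so that nearly all terms vanish by the locality bound.  Put
  \<open>h\<^sub>a = u\<^sub>a (\<^sub>N\<^sub>-\<^sub>2\<^sub>) u\<^sub>-\<^sub>a\<close> with \<open>N = (a|a)\<close>, one step below the product that the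
  relation makes equal to \<open>1\<close>.  Then \<open>h\<^sub>a(n)u\<^sub>b = \<delta>\<^sub>n\<^sub>,\<^sub>0 (a|b) u\<^sub>b\<close> for \<open>n \<ge> 0\<close>
  (\<open>heis_u\<close>), hence the \<open>h\<^sub>a\<close> span a Heisenberg algebra acting on \<open>Q\<close> (\<open>act_heisenberg\<close>), and
  \<open>D u\<^sub>a = h\<^sub>a(-1)u\<^sub>a\<close> (\<open>D_u\<close>).

  The last equation is a differential equation for the field \<open>u\<^sub>a(z)\<close>.  Applied to a highest weight
  vector \<open>x\<close> of weight \<open>\<lambda>\<close> with \<open>D x = \<lambda>(-1)x\<close>, it shows that \<open>u\<^sub>a(z)x\<close> starts at
  \<open>z\<^bsup>(a|\<lambda>)\<^esup>\<close>, that its leading coefficient is again such a vector, of weight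
  \<open>\<lambda> + a\<close>, and that all other coefficients lie in the Heisenberg module which the leading one generates
  (\<open>u_vanish\<close>, \<open>hw_raise\<close>, \<open>u_in_span\<close>).  Starting from the vacuum, each word in \<open>\<plusminus>\<Pi>\<close> thus gives a
  highest weight vector.  Locality permits transposing adjacent letters up to sign (\<open>raise_swap\<close>) and the
  relation cancels \<open>a\<close> against \<open>-a\<close> (\<open>raise_cancel\<close>), so up to sign this vector depends only on the sum
  of the word (\<open>tower_unique\<close>).  Hence \<open>Q\<close> is the sum of Heisenberg modules generated by one vector for
  each \<open>\<lambda> \<in> \<Lambda>\<close> (\<open>span_monomials\<close>).  That vector is mapped to a nonzero multiple of \<open>v\<^sub>\<lambda>\<close>.  In
  \<open>V\<^sub>\<Lambda>\<close> these modules are Verma modules and their sum is direct, so a combination of Heisenberg words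
  that vanishes in \<open>V\<^sub>\<Lambda>\<close> is a consequence of relations that hold in \<open>Q\<close> too (\<open>hom_inj\<close>).
\<close>

section \<open>Linear algebra inside the carrier\<close>

lemma Sum_any_lessThan:
  assumes "\<And>j. j \<ge> N \<Longrightarrow> f j = 0"
  shows "Sum_any f = sum f {..<N::nat}"
  using assms by (intro Sum_any.expand_superset) (auto simp: not_le[symmetric])

lemma koszul_xor: "koszul_sign (p \<noteq> q) r = (koszul_sign p r * koszul_sign q r :: 'k::field_char_0)"
  by (auto simp: koszul_sign_def)

text \<open>
  A doubly indexed family stands for the series \<open>\<Sum> f m n w\<^bsup>-m-1\<^esup>z\<^bsup>-n-1\<^esup>\<close>, and \<open>sdiff\<close> is
  multiplication by \<open>w - z\<close>.  In families with three indices the variables are \<open>w\<close>, \<open>z\<close>, \<open>y\<close>, and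
  \<open>diff_wy\<close>, \<open>diff_zy\<close> are the multiplications by \<open>w - y\<close> and \<open>z - y\<close>.
\<close>

definition sdiff :: "(int \<Rightarrow> int \<Rightarrow> 'v::ab_group_add) \<Rightarrow> int \<Rightarrow> int \<Rightarrow> 'v" where
  "sdiff f p q = f (p + 1) q - f p (q + 1)"

definition diff_wy :: "(int \<Rightarrow> int \<Rightarrow> int \<Rightarrow> 'v::ab_group_add) \<Rightarrow> int \<Rightarrow> int \<Rightarrow> int \<Rightarrow> 'v" where
  "diff_wy f p q t = f (p + 1) q t - f p q (t + 1)"

definition diff_zy :: "(int \<Rightarrow> int \<Rightarrow> int \<Rightarrow> 'v::ab_group_add) \<Rightarrow> int \<Rightarrow> int \<Rightarrow> int \<Rightarrow> 'v" where
  "diff_zy f p q t = f p (q + 1) t - f p q (t + 1)"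

lemma sdiff_pow_Suc:
  "(sdiff ^^ Suc n) f p q = (sdiff ^^ n) f (p + 1) q - (sdiff ^^ n) f p (q + 1)"
  by (simp add: sdiff_def)

context vertex_algebra
begin

sublocale sc: vector_space "scale V"
  by (fact ambient)

lemma carrier_zero [simp]: "0 \<in> carrier V"
  and carrier_add [simp]: "x \<in> carrier V \<Longrightarrow> y \<in> carrier V \<Longrightarrow> x + y \<in> carrier V"
  and carrier_diff [simp]: "x \<in> carrier V \<Longrightarrow> y \<in> carrier V \<Longrightarrow> x - y \<in> carrier V"
  and carrier_neg [simp]: "x \<in> carrier V \<Longrightarrow> - x \<in> carrier V"
  and carrier_scale [simp]: "x \<in> carrier V \<Longrightarrow> scale V r x \<in> carrier V"
  and carrier_sum: "(\<And>j. j \<in> J \<Longrightarrow> f j \<in> carrier V) \<Longrightarrow> sum f J \<in> carrier V"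
  using carrier_subspace
  by (auto intro: sc.subspace_0 sc.subspace_add sc.subspace_diff sc.subspace_neg
      sc.subspace_scale sc.subspace_sum)

lemma carrier_Sum_any:
  assumes "\<And>j. f j \<in> carrier V"
  shows "Sum_any f \<in> carrier V"
  by (simp add: Sum_any.expand_set carrier_sum assms)

lemma part_carrier: "x \<in> part V p \<Longrightarrow> x \<in> carrier V"
  using sc.subspace_0[OF part_subspace]
  by (cases p) (force simp: part_sum intro: exI[of _ 0])+

lemma carrier_parts:
  assumes "x \<in> carrier V"
  obtains y z where "x = y + z" "y \<in> part V False" "z \<in> part V True"
  using assms part_sum by auto

lemma one_carrier [simp]: "vone V \<in> carrier V"
  using one_even by (rule part_carrier)

lemma prod_carrier [simp]:
  assumes "a \<in> carrier V" "b \<in> carrier V"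
  shows "vprod V n a b \<in> carrier V"
proof -
  obtain a0 a1 where a: "a = a0 + a1" "a0 \<in> part V False" "a1 \<in> part V True"
    using assms(1) by (rule carrier_parts)
  obtain b0 b1 where b: "b = b0 + b1" "b0 \<in> part V False" "b1 \<in> part V True"
    using assms(2) by (rule carrier_parts)
  have "vprod V n x y \<in> carrier V" if "x \<in> {a0, a1}" "y \<in> {b0, b1}" for x y
    using that a b prod_even part_carrier by blast
  with a b show ?thesis
    by (simp add: prod_add_left prod_add_right part_carrier)
qed

lemma va_D_carrier [simp]: "a \<in> carrier V \<Longrightarrow> va_D V a \<in> carrier V"
  by (simp add: va_D_def)

lemma prod_zero_left [simp]: "b \<in> carrier V \<Longrightarrow> vprod V n 0 b = 0"
  using prod_scale_left[of 0 b n 0] by simp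

lemma prod_zero_right [simp]: "a \<in> carrier V \<Longrightarrow> vprod V n a 0 = 0"
  using prod_scale_right[of a 0 n 0] by simp

lemma prod_neg_left: "a \<in> carrier V \<Longrightarrow> b \<in> carrier V \<Longrightarrow> vprod V n (- a) b = - vprod V n a b"
  using prod_scale_left[of a b n "-1"] by simp

lemma prod_neg_right: "a \<in> carrier V \<Longrightarrow> b \<in> carrier V \<Longrightarrow> vprod V n a (- b) = - vprod V n a b"
  using prod_scale_right[of a b n "-1"] by simp

lemma prod_diff_left: "\<lbrakk>a \<in> carrier V; b \<in> carrier V; c \<in> carrier V\<rbrakk>
    \<Longrightarrow> vprod V n (a - b) c = vprod V n a c - vprod V n b c"
  using prod_add_left[of a "- b" c n] by (simp add: prod_neg_left)

lemma prod_diff_right: "\<lbrakk>a \<in> carrier V; b \<in> carrier V; c \<in> carrier V\<rbrakk>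
    \<Longrightarrow> vprod V n a (b - c) = vprod V n a b - vprod V n a c"
  using prod_add_right[of a b "- c" n] by (simp add: prod_neg_right)

lemma prod_sum_left: "b \<in> carrier V \<Longrightarrow> (\<And>j. j \<in> J \<Longrightarrow> f j \<in> carrier V) \<Longrightarrow>
    vprod V n (sum f J) b = (\<Sum>j\<in>J. vprod V n (f j) b)"
  by (induction J rule: infinite_finite_induct) (simp_all add: prod_add_left carrier_sum)

lemma prod_sum_right: "a \<in> carrier V \<Longrightarrow> (\<And>j. j \<in> J \<Longrightarrow> f j \<in> carrier V) \<Longrightarrow>
    vprod V n a (sum f J) = (\<Sum>j\<in>J. vprod V n a (f j))"
  by (induction J rule: infinite_finite_induct) (simp_all add: prod_add_right carrier_sum)

section \<open>Expansions of powers of a difference of two variables\<close>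

text \<open>
  \<open>binsum r f\<close> consists of the coefficients of the product of the series of \<open>f\<close> with \<open>(w - z)\<^sup>r\<close>,
  expanded in nonnegative powers of \<open>z\<close>.  The product exists if \<open>f\<close> is \<open>vanishing\<close>.
\<close>

definition vanishing :: "(int \<Rightarrow> int \<Rightarrow> 'v) \<Rightarrow> bool" where
  "vanishing f \<longleftrightarrow> (\<exists>Q. \<forall>p. \<forall>q\<ge>Q. f p q = 0)"

definition binsum :: "int \<Rightarrow> (int \<Rightarrow> int \<Rightarrow> 'v) \<Rightarrow> int \<Rightarrow> int \<Rightarrow> 'v" where
  "binsum r f p q =
     Sum_any (\<lambda>j::nat. scale V ((-1) ^ j * (of_int r gchoose j)) (f (p + r - int j) (q + int j)))"

lemma vanishingI: "(\<And>p q. q \<ge> Q \<Longrightarrow> f p q = 0) \<Longrightarrow> vanishing f"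
  by (auto simp: vanishing_def)

lemma binsum_lessThan:
  assumes "\<And>p' q'. q' \<ge> q + int N \<Longrightarrow> f p' q' = 0"
  shows "binsum r f p q =
    (\<Sum>j<N. scale V ((-1) ^ j * (of_int r gchoose j)) (f (p + r - int j) (q + int j)))"
  unfolding binsum_def by (rule Sum_any_lessThan) (simp add: assms)

lemma vanishing_bound:
  assumes "vanishing f"
  obtains N where "\<And>p' q'. q' \<ge> q + int N \<Longrightarrow> f p' q' = 0"
proof -
  obtain Q where Q: "\<And>p q. q \<ge> Q \<Longrightarrow> f p q = 0"
    using assms by (auto simp: vanishing_def)
  show ?thesis
    by (rule that[of "nat (Q - q)"], rule Q) linarith
qed

lemma binsum_0: "binsum 0 f p q = f p q"
proof -
  have "binsum 0 f p q = (\<Sum>j<Suc 0. scale V ((-1) ^ j * (of_int 0 gchoose j)) (f (p + 0 - int j) (q + int j)))"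
    unfolding binsum_def by (rule Sum_any_lessThan) (simp add: gbinomial_0_left)
  then show ?thesis by simp
qed

text \<open>
  Pascal's rule: raising the exponent of \<open>w - z\<close> by one amounts to multiplication by \<open>w - z\<close>.
\<close>

lemma binsum_succ:
  assumes "vanishing f"
  shows "binsum (r + 1) f p q = binsum r f (p + 1) q - binsum r f p (q + 1)"
proof -
  obtain N where N: "\<And>p' q'. q' \<ge> q + int N \<Longrightarrow> f p' q' = 0"
    using vanishing_bound[OF assms] by metis
  let ?c = "\<lambda>r j. (-1) ^ j * (of_int r gchoose j) :: 'k"
  let ?f = "\<lambda>j. f (p + 1 + r - int j) (q + int j)"
  have 1: "binsum (r + 1) f p q = (\<Sum>j<Suc N. scale V (?c (r + 1) j) (?f j))"
    by (subst binsum_lessThan[where N = "Suc N"]) (auto intro!: N simp: algebra_simps)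
  have 2: "binsum r f (p + 1) q = (\<Sum>j<Suc N. scale V (?c r j) (?f j))"
    by (subst binsum_lessThan[where N = "Suc N"]) (auto intro!: N)
  have 3: "binsum r f p (q + 1) = (\<Sum>j<N. scale V (?c r j) (?f (Suc j)))"
    by (subst binsum_lessThan[where N = N]) (auto intro!: N simp: algebra_simps)
  have c: "?c (r + 1) (Suc j) = ?c r (Suc j) - ?c r j" for j
    using gbinomial_Suc_Suc[of "of_int r :: 'k" j] by (simp add: algebra_simps)
  show ?thesis
    unfolding 1 2 3 sum.lessThan_Suc_shift c sc.scale_left_diff_distrib
    by (simp add: sum_subtractf)
qed

lemma binsum_diff:
  assumes "vanishing f" "vanishing g"
  shows "binsum r (\<lambda>p q. f p q - g p q) p q = binsum r f p q - binsum r g p q"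
proof -
  obtain N where N: "\<And>p' q'. q' \<ge> q + int N \<Longrightarrow> f p' q' = 0"
    using vanishing_bound[OF assms(1)] by metis
  obtain M where M: "\<And>p' q'. q' \<ge> q + int M \<Longrightarrow> g p' q' = 0"
    using vanishing_bound[OF assms(2)] by metis
  show ?thesis
    by (simp add: binsum_lessThan[where N = "max N M"] N M sc.scale_right_diff_distrib sum_subtractf)
qed

lemma binsum_zero [simp]: "binsum r (\<lambda>p q. 0) p q = 0"
  by (simp add: binsum_lessThan[where N = 0])

lemma prod_binsum:
  assumes "vanishing f" "a \<in> carrier V" "\<And>p q. f p q \<in> carrier V"
  shows "vprod V n a (binsum r f p q) = binsum r (\<lambda>p q. vprod V n a (f p q)) p q"
proof -
  obtain N where N: "\<And>p' q'. q' \<ge> q + int N \<Longrightarrow> f p' q' = 0"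
    using vanishing_bound[OF assms(1)] by metis
  show ?thesis
    by (simp add: binsum_lessThan[where N = N] N assms prod_sum_right prod_scale_right)
qed

lemma scale_binsum:
  assumes "vanishing f"
  shows "scale V c (binsum r f p q) = binsum r (\<lambda>p q. scale V c (f p q)) p q"
proof -
  obtain N where N: "\<And>p' q'. q' \<ge> q + int N \<Longrightarrow> f p' q' = 0"
    using vanishing_bound[OF assms(1)] by metis
  show ?thesis
    by (simp add: binsum_lessThan[where N = N] N sc.scale_sum_right mult.commute)
qed

lemma binsum_carrier: "(\<And>p q. f p q \<in> carrier V) \<Longrightarrow> binsum r f p q \<in> carrier V"
  unfolding binsum_def by (rule carrier_Sum_any) simp

section \<open>The three expansions in the Borcherds identity\<close>

text \<open>
  The Borcherds identity equates the residues of \<open>w\<^sup>p z\<^sup>q (w-z)\<^sup>r\<close> against the three expansions of the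
  correlation of \<open>a\<close>, \<open>b\<close> and \<open>c\<close>: \<open>commsum\<close> is the difference of the expansions in \<open>|w| > |z|\<close> and
  \<open>|z| > |w|\<close>, and \<open>itersum\<close> is the expansion in \<open>|z| > |w-z|\<close>.  The sign \<open>s\<close> is the Koszul sign of
  \<open>a\<close> and \<open>b\<close>.  All three obey the recursion in \<open>r\<close> that expresses
  \<open>(w-z)\<^bsup>r+1\<^esup> = (w-z)\<^sup>r w - (w-z)\<^sup>r z\<close>.
\<close>

definition ordered :: "'v \<Rightarrow> 'v \<Rightarrow> 'v \<Rightarrow> int \<Rightarrow> int \<Rightarrow> 'v" where
  "ordered a b c m n = vprod V m a (vprod V n b c)"

definition commsum :: "'k \<Rightarrow> 'v \<Rightarrow> 'v \<Rightarrow> 'v \<Rightarrow> int \<Rightarrow> int \<Rightarrow> int \<Rightarrow> 'v" where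
  "commsum s a b c p q r =
     binsum r (ordered a b c) p q - scale V (s * (-1) powi r) (binsum r (ordered b a c) q p)"

definition itersum :: "'v \<Rightarrow> 'v \<Rightarrow> 'v \<Rightarrow> int \<Rightarrow> int \<Rightarrow> int \<Rightarrow> 'v" where
  "itersum a b c p q r =
     Sum_any (\<lambda>j::nat. scale V (of_int p gchoose j) (vprod V (p + q - int j) (vprod V (r + int j) a b) c))"

lemma ordered_vanishing:
  assumes "a \<in> carrier V" "b \<in> carrier V" "c \<in> carrier V"
  shows "vanishing (ordered a b c)"
proof -
  obtain n0 where "\<forall>n\<ge>n0. vprod V n b c = 0"
    using V1[OF assms(2,3)] by blast
  then show ?thesis
    using assms by (intro vanishingI[of n0]) (simp add: ordered_def)
qed

lemma ordered_carrier: "a \<in> carrier V \<Longrightarrow> b \<in> carrier V \<Longrightarrow> c \<in> carrier V \<Longrightarrow> ordered a b c m n \<in> carrier V"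
  by (simp add: ordered_def)

lemma commsum_succ:
  assumes "a \<in> carrier V" "b \<in> carrier V" "c \<in> carrier V"
  shows "commsum s a b c p q (r + 1) = commsum s a b c (p + 1) q r - commsum s a b c p (q + 1) r"
proof -
  have "s * (-1) powi (r + 1) = - (s * (-1) powi r :: 'k)"
    by (simp add: power_int_add_1)
  then show ?thesis
    using assms by (simp add: commsum_def binsum_succ ordered_vanishing sc.scale_right_diff_distrib)
qed

lemma itersum_lessThan:
  assumes "\<And>n. n \<ge> r + int N \<Longrightarrow> vprod V n a b = 0" "c \<in> carrier V"
  shows "itersum a b c p q r =
    (\<Sum>j<N. scale V (of_int p gchoose j) (vprod V (p + q - int j) (vprod V (r + int j) a b) c))"
  unfolding itersum_def using assms by (intro Sum_any_lessThan) simp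

lemma V1_from:
  assumes "a \<in> carrier V" "b \<in> carrier V"
  obtains N :: nat where "\<And>n. n \<ge> r + int N \<Longrightarrow> vprod V n a b = 0"
proof -
  obtain n0 where "\<forall>n\<ge>n0. vprod V n a b = 0"
    using V1[OF assms] by blast
  moreover have "n \<ge> n0" if "n \<ge> r + int (nat (n0 - r))" for n
    using that by linarith
  ultimately have "vprod V n a b = 0" if "n \<ge> r + int (nat (n0 - r))" for n
    using that by blast
  then show ?thesis
    using that by blast
qed

lemma itersum_succ:
  assumes "a \<in> carrier V" "b \<in> carrier V" "c \<in> carrier V"
  shows "itersum a b c p q (r + 1) = itersum a b c (p + 1) q r - itersum a b c p (q + 1) r"
proof -
  obtain N where N: "\<And>n. n \<ge> r + int N \<Longrightarrow> vprod V n a b = 0"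
    using V1_from[OF assms(1,2)] by metis
  let ?f = "\<lambda>j. vprod V (p + q + 1 - int j) (vprod V (r + int j) a b) c"
  let ?c = "\<lambda>p j. of_int p gchoose j :: 'k"
  have 1: "itersum a b c p q (r + 1) = (\<Sum>j<N. scale V (?c p j) (?f (Suc j)))"
    by (subst itersum_lessThan[where N = N]) (auto intro!: N assms simp: algebra_simps)
  have 2: "itersum a b c (p + 1) q r = (\<Sum>j<Suc N. scale V (?c (p + 1) j) (?f j))"
    by (subst itersum_lessThan[where N = "Suc N"]) (auto intro!: N assms simp: algebra_simps)
  have 3: "itersum a b c p (q + 1) r = (\<Sum>j<Suc N. scale V (?c p j) (?f j))"
    by (subst itersum_lessThan[where N = "Suc N"]) (auto intro!: N assms simp: algebra_simps)
  have c: "?c (p + 1) (Suc j) = ?c p j + ?c p (Suc j)" for j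
    using gbinomial_Suc_Suc[of "of_int p :: 'k" j] by simp
  show ?thesis
    unfolding 1 2 3 sum.lessThan_Suc_shift c sc.scale_left_distrib
    by (simp add: sum.distrib)
qed

definition jacobi :: "'k \<Rightarrow> 'v \<Rightarrow> 'v \<Rightarrow> 'v \<Rightarrow> int \<Rightarrow> int \<Rightarrow> int \<Rightarrow> 'v" where
  "jacobi s a b c p q r = commsum s a b c p q r - itersum a b c p q r"

lemma jacobi_succ:
  assumes "a \<in> carrier V" "b \<in> carrier V" "c \<in> carrier V"
  shows "jacobi s a b c p q (r + 1) = jacobi s a b c (p + 1) q r - jacobi s a b c p (q + 1) r"
  using assms by (simp add: jacobi_def commsum_succ itersum_succ)

text \<open>
  Locality says that the side \<open>commsum\<close> of the Borcherds identity vanishes at one exponent; by the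
  recursion it then vanishes at every larger one.
\<close>

lemma mutually_local_iff:
  "mutually_local V p q M a b \<longleftrightarrow>
    (\<forall>c\<in>carrier V. \<forall>m n. commsum (koszul_sign p q) a b c m n M = 0)"
  unfolding mutually_local_def commsum_def binsum_def ordered_def by auto

lemma locality:
  assumes a: "a \<in> part V p" and b: "b \<in> part V q"
  obtains M :: nat where
    "\<And>c m n r. c \<in> carrier V \<Longrightarrow> r \<ge> int M \<Longrightarrow> commsum (koszul_sign p q) a b c m n r = 0"
proof -
  obtain M where M: "mutually_local V p q M a b"
    using V4[OF a b] by blast
  have "\<forall>m n. commsum (koszul_sign p q) a b c m n (M + int k) = 0" if "c \<in> carrier V" for c k
  proof (induction k)
    case 0
    then show ?case using M that by (simp add: mutually_local_iff)
  next
    case (Suc k)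
    have "M + int (Suc k) = M + int k + 1"
      by simp
    then show ?case
      using Suc commsum_succ[OF part_carrier[OF a] part_carrier[OF b] that] by (simp only:) simp
  qed
  moreover have "r = M + int (nat (r - M))" if "r \<ge> int (nat M)" for r
    using that by linarith
  ultimately have "commsum (koszul_sign p q) a b c m n r = 0" if "c \<in> carrier V" "r \<ge> int (nat M)" for c m n r
    using that by metis
  then show ?thesis
    using that by blast
qed

section \<open>Locality as annihilation by difference operators\<close>

lemma sdiff_zero_pow: "(sdiff ^^ n) (\<lambda>p q. 0) = (\<lambda>p q. 0)"
  by (induction n) (simp_all add: sdiff_def fun_eq_iff)

text \<open>
  The coefficients of the commutator of the fields of \<open>a\<close> and \<open>b\<close>, applied to \<open>c\<close>.
\<close>

definition bracket :: "'k \<Rightarrow> 'v \<Rightarrow> 'v \<Rightarrow> 'v \<Rightarrow> int \<Rightarrow> int \<Rightarrow> 'v" where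
  "bracket s a b c m n = ordered a b c m n - scale V s (ordered b a c n m)"

lemma sdiff_pow_bracket:
  assumes "a \<in> carrier V" "b \<in> carrier V" "c \<in> carrier V"
  shows "(sdiff ^^ M) (bracket s a b c) p q = commsum s a b c p q (int M)"
proof (induction M arbitrary: p q)
  case 0
  then show ?case by (simp add: bracket_def commsum_def binsum_0)
next
  case (Suc M)
  have "int (Suc M) = int M + 1" by simp
  then show ?case
    by (simp only: commsum_succ[OF assms] sdiff_pow_Suc Suc)
qed

lemma bracket_local:
  assumes "a \<in> part V p" and "b \<in> part V q"
  obtains M :: nat where
    "\<And>c N. c \<in> carrier V \<Longrightarrow> N \<ge> M \<Longrightarrow> (sdiff ^^ N) (bracket (koszul_sign p q) a b c) = (\<lambda>m n. 0)"
proof -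
  obtain M where M: "\<And>c m n r. c \<in> carrier V \<Longrightarrow> r \<ge> int M \<Longrightarrow>
      commsum (koszul_sign p q) a b c m n r = 0"
    using locality[OF assms] by metis
  show ?thesis
    by (rule that[of M]) (simp add: fun_eq_iff sdiff_pow_bracket M assms[THEN part_carrier])
qed

lemma bracket_carrier:
  "a \<in> carrier V \<Longrightarrow> b \<in> carrier V \<Longrightarrow> c \<in> carrier V \<Longrightarrow> bracket s a b c m n \<in> carrier V"
  by (simp add: bracket_def ordered_def)

lemma diff_wy_pow: "(diff_wy ^^ n) f p q t = (sdiff ^^ n) (\<lambda>p t. f p q t) p t"
  by (induction n arbitrary: p t) (simp_all add: diff_wy_def sdiff_def)

lemma diff_zy_pow: "(diff_zy ^^ n) f p q t = (sdiff ^^ n) (f p) q t"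
  by (induction n arbitrary: q t) (simp_all add: diff_zy_def sdiff_def)

lemma diff_wy_zy_pow_commute: "(diff_wy ^^ m) ((diff_zy ^^ n) f) = (diff_zy ^^ n) ((diff_wy ^^ m) f)"
proof -
  have 1: "diff_wy (diff_zy g) = diff_zy (diff_wy g)" for g
    by (simp add: fun_eq_iff diff_wy_def diff_zy_def)
  have 2: "diff_wy ((diff_zy ^^ n) g) = (diff_zy ^^ n) (diff_wy g)" for g
    by (induction n) (simp_all add: 1)
  show ?thesis
    by (induction m) (simp_all add: 2)
qed

text \<open>
  \<open>killed M f\<close>: the series of \<open>f\<close> is annihilated by \<open>(w-y)\<^sup>M(z-y)\<^sup>M\<close>.  For the commutator of a product
  \<open>a(w)b(z)\<close> with a field \<open>c(y)\<close> this is the form in which locality is inherited.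
\<close>

definition killed :: "nat \<Rightarrow> (int \<Rightarrow> int \<Rightarrow> int \<Rightarrow> 'v) \<Rightarrow> bool" where
  "killed M f \<longleftrightarrow> (diff_wy ^^ M) ((diff_zy ^^ M) f) = (\<lambda>p q t. 0)"

lemma sdiff_pow_diff:
  "(sdiff ^^ n) (\<lambda>p q. f p q - g p q) = (\<lambda>p q. (sdiff ^^ n) f p q - (sdiff ^^ n) g p q)"
  by (induction n) (simp_all add: fun_eq_iff sdiff_def)

lemma sdiff_pow_scale:
  "(sdiff ^^ n) (\<lambda>p q. scale V c (f p q)) = (\<lambda>p q. scale V c ((sdiff ^^ n) f p q))"
  by (induction n) (simp_all add: fun_eq_iff sdiff_def sc.scale_right_diff_distrib)

lemma sdiff_pow_sum:
  "(sdiff ^^ n) (\<lambda>p q. \<Sum>j\<in>J. f j p q) = (\<lambda>p q. \<Sum>j\<in>J. (sdiff ^^ n) (f j) p q)"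
  by (induction n) (simp_all add: fun_eq_iff sdiff_def sum_subtractf)

lemma sdiff_pow_shift:
  "(sdiff ^^ n) (\<lambda>p q. f (p + k) q) = (\<lambda>p q. (sdiff ^^ n) f (p + k) q)"
  by (induction n) (simp_all add: fun_eq_iff sdiff_def algebra_simps)

lemma sdiff_pow_prod:
  assumes "a \<in> carrier V" "\<And>p q. f p q \<in> carrier V"
  shows "(sdiff ^^ n) (\<lambda>p q. vprod V m a (f p q)) = (\<lambda>p q. vprod V m a ((sdiff ^^ n) f p q))
    \<and> (\<forall>p q. (sdiff ^^ n) f p q \<in> carrier V)"
  by (induction n) (simp_all add: fun_eq_iff sdiff_def assms prod_diff_right)

lemma diff_zy_pow_zero: "(diff_zy ^^ n) (\<lambda>p q t. 0) = (\<lambda>p q t. 0)"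
  and diff_wy_pow_zero: "(diff_wy ^^ n) (\<lambda>p q t. 0) = (\<lambda>p q t. 0)"
  by (simp_all add: fun_eq_iff diff_zy_pow diff_wy_pow sdiff_zero_pow)

lemma diff_zy_pow_diff: "(diff_zy ^^ n) (\<lambda>p q t. f p q t - g p q t) =
    (\<lambda>p q t. (diff_zy ^^ n) f p q t - (diff_zy ^^ n) g p q t)"
  and diff_wy_pow_diff: "(diff_wy ^^ n) (\<lambda>p q t. f p q t - g p q t) =
    (\<lambda>p q t. (diff_wy ^^ n) f p q t - (diff_wy ^^ n) g p q t)"
  by (simp_all add: fun_eq_iff diff_zy_pow diff_wy_pow sdiff_pow_diff)

lemma killed_diff:
  assumes "killed M f" "killed M g"
  shows "killed M (\<lambda>p q t. f p q t - g p q t)"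
  using assms by (simp add: killed_def diff_zy_pow_diff diff_wy_pow_diff)

lemma killed_scale:
  assumes "killed M f"
  shows "killed M (\<lambda>p q t. scale V c (f p q t))"
proof -
  have 1: "(diff_zy ^^ M) (\<lambda>p q t. scale V c (g p q t)) = (\<lambda>p q t. scale V c ((diff_zy ^^ M) g p q t))"
    and 2: "(diff_wy ^^ M) (\<lambda>p q t. scale V c (g p q t)) = (\<lambda>p q t. scale V c ((diff_wy ^^ M) g p q t))"
    for g by (simp_all only: fun_eq_iff diff_zy_pow diff_wy_pow sdiff_pow_scale) simp_all
  have "(diff_wy ^^ M) ((diff_zy ^^ M) f) = (\<lambda>p q t. 0)"
    using assms by (simp only: killed_def)
  then show ?thesis
    by (simp only: killed_def 1 2 sc.scale_zero_right)
qed

lemma killed_swap: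
  assumes "killed M f"
  shows "killed M (\<lambda>p q t. f q p t)"
proof -
  have 1: "(diff_zy ^^ M) (\<lambda>p q t. g q p t) = (\<lambda>p q t. (diff_wy ^^ M) g q p t)"
    and 2: "(diff_wy ^^ M) (\<lambda>p q t. g q p t) = (\<lambda>p q t. (diff_zy ^^ M) g q p t)" for g
    by (simp_all add: fun_eq_iff diff_zy_pow diff_wy_pow)
  have "(diff_wy ^^ M) ((diff_zy ^^ M) (\<lambda>p q t. f q p t)) =
      (\<lambda>p q t. (diff_wy ^^ M) ((diff_zy ^^ M) f) q p t)"
    by (subst 1, subst 2) (rule diff_wy_zy_pow_commute[symmetric, THEN arg_cong])
  then show ?thesis
    using assms by (simp only: killed_def)
qed

lemma killed_if_zy: "(diff_zy ^^ M) f = (\<lambda>p q t. 0) \<Longrightarrow> killed M f"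
  by (simp add: killed_def diff_wy_pow_zero)

lemma killed_if_wy: "(diff_wy ^^ M) f = (\<lambda>p q t. 0) \<Longrightarrow> killed M f"
  by (simp add: killed_def diff_wy_zy_pow_commute diff_zy_pow_zero)

section \<open>Dong's lemma\<close>

lemma binsum_shift_left: "binsum r (\<lambda>p q. f (p + 1) q) p q = binsum r f (p + 1) q"
  and binsum_shift_right: "binsum r (\<lambda>p q. f p (q + 1)) p q = binsum r f p (q + 1)"
  by (simp_all add: binsum_def algebra_simps)

lemma vanishing_shift_left: "vanishing f \<Longrightarrow> vanishing (\<lambda>p q. f (p + 1) q)"
  and vanishing_shift_right: "vanishing f \<Longrightarrow> vanishing (\<lambda>p q. f p (q + 1))"
  by (auto simp: vanishing_def) (meson le_add_same_cancel1 order_trans zero_le_one)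

lemma vanishing_diff:
  assumes "vanishing f" "vanishing g"
  shows "vanishing (\<lambda>p q. f p q - g p q)"
proof -
  obtain P where P: "\<And>p q. q \<ge> P \<Longrightarrow> f p q = 0"
    using assms(1) by (auto simp: vanishing_def)
  obtain Q where Q: "\<And>p q. q \<ge> Q \<Longrightarrow> g p q = 0"
    using assms(2) by (auto simp: vanishing_def)
  show ?thesis
    by (rule vanishingI[of "max P Q"]) (simp add: P Q)
qed

lemma binsum_diff_zy:
  assumes "\<And>t. vanishing (\<lambda>p q. f p q t)"
  shows "diff_zy (\<lambda>p q t. binsum r (\<lambda>p q. f p q t) p q) =
      (\<lambda>p q t. binsum r (\<lambda>p q. diff_zy f p q t) p q)"
    and "vanishing (\<lambda>p q. diff_zy f p q t)"
  using assms vanishing_shift_right[OF assms] binsum_shift_right[of r "\<lambda>p q. f p q _"]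
  by (simp_all add: fun_eq_iff diff_zy_def binsum_diff vanishing_diff)

lemma binsum_diff_wy:
  assumes "\<And>t. vanishing (\<lambda>p q. f p q t)"
  shows "diff_wy (\<lambda>p q t. binsum r (\<lambda>p q. f p q t) p q) =
      (\<lambda>p q t. binsum r (\<lambda>p q. diff_wy f p q t) p q)"
    and "vanishing (\<lambda>p q. diff_wy f p q t)"
  using assms vanishing_shift_left[OF assms] binsum_shift_left[of r "\<lambda>p q. f p q _"]
  by (simp_all add: fun_eq_iff diff_wy_def binsum_diff vanishing_diff)

text \<open>
  Multiplication by \<open>(w-z)\<^sup>r\<close>, in a fixed expansion, commutes with multiplication by polynomials.
\<close>

lemma killed_binsum:
  assumes "killed M f" "\<And>t. vanishing (\<lambda>p q. f p q t)"
  shows "killed M (\<lambda>p q t. binsum r (\<lambda>p q. f p q t) p q)"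
proof -
  have zy: "(diff_zy ^^ n) (\<lambda>p q t. binsum r (\<lambda>p q. g p q t) p q) =
        (\<lambda>p q t. binsum r (\<lambda>p q. (diff_zy ^^ n) g p q t) p q) \<and>
      (\<forall>t. vanishing (\<lambda>p q. (diff_zy ^^ n) g p q t))"
    if "\<And>t. vanishing (\<lambda>p q. g p q t)" for g n
    using that by (induction n) (simp_all add: binsum_diff_zy)
  have wy: "(diff_wy ^^ n) (\<lambda>p q t. binsum r (\<lambda>p q. g p q t) p q) =
        (\<lambda>p q t. binsum r (\<lambda>p q. (diff_wy ^^ n) g p q t) p q) \<and>
      (\<forall>t. vanishing (\<lambda>p q. (diff_wy ^^ n) g p q t))"
    if "\<And>t. vanishing (\<lambda>p q. g p q t)" for g n
    using that by (induction n) (simp_all add: binsum_diff_wy)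
  have "(diff_wy ^^ M) ((diff_zy ^^ M) (\<lambda>p q t. binsum r (\<lambda>p q. f p q t) p q)) =
      (\<lambda>p q t. binsum r (\<lambda>p q. (diff_wy ^^ M) ((diff_zy ^^ M) f) p q t) p q)"
    using zy[of f M] wy[of "(diff_zy ^^ M) f" M] assms(2) by simp
  then show ?thesis
    using assms(1) by (simp add: killed_def)
qed

text \<open>
  The commutator with \<open>c(y)\<close> is a derivation: it is the sum of \<open>a(w)[b(z),c(y)]\<close>, which
  \<open>(z-y)\<^sup>M\<close> annihilates, and \<open>[a(w),c(y)]b(z)\<close>, which \<open>(w-y)\<^sup>M\<close> annihilates.
\<close>

lemma ordered_killed:
  assumes "a \<in> part V pa" "b \<in> part V pb" "c \<in> part V pc"
  obtains M0 :: nat where "\<And>x M. x \<in> carrier V \<Longrightarrow> M \<ge> M0 \<Longrightarrow>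
     killed M (\<lambda>p q t. ordered a b (vprod V t c x) p q -
       scale V (koszul_sign pa pc * koszul_sign pb pc) (vprod V t c (ordered a b x p q)))"
proof -
  let ?sa = "koszul_sign pa pc :: 'k" and ?sb = "koszul_sign pb pc :: 'k"
  have C [simp]: "a \<in> carrier V" "b \<in> carrier V" "c \<in> carrier V"
    using assms part_carrier by auto
  obtain M1 where M1: "\<And>x N. x \<in> carrier V \<Longrightarrow> N \<ge> M1 \<Longrightarrow> (sdiff ^^ N) (bracket ?sa a c x) = (\<lambda>m n. 0)"
    by (rule bracket_local[OF assms(1,3)]) blast
  obtain M2 where M2: "\<And>x N. x \<in> carrier V \<Longrightarrow> N \<ge> M2 \<Longrightarrow> (sdiff ^^ N) (bracket ?sb b c x) = (\<lambda>m n. 0)"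
    by (rule bracket_local[OF assms(2,3)]) blast
  show ?thesis
  proof (rule that[of "max M1 M2"])
    fix x M assume [simp]: "x \<in> carrier V" and M: "max M1 M2 \<le> M"
    have 1: "killed M (\<lambda>p q t. vprod V p a (bracket ?sb b c x q t))"
    proof (rule killed_if_zy, intro ext)
      fix p q t
      show "(diff_zy ^^ M) (\<lambda>p q t. vprod V p a (bracket ?sb b c x q t)) p q t = 0"
        using M sdiff_pow_prod[of a "bracket ?sb b c x" M p]
        by (simp add: diff_zy_pow bracket_carrier M2)
    qed
    have 2: "killed M (\<lambda>p q t. scale V (- ?sb) (bracket ?sa a c (vprod V q b x) p t))"
    proof (rule killed_if_wy, intro ext)
      fix p q t
      show "(diff_wy ^^ M) (\<lambda>p q t. scale V (- ?sb) (bracket ?sa a c (vprod V q b x) p t)) p q t = 0"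
        using M by (simp only: diff_wy_pow sdiff_pow_scale) (simp add: M1)
    qed
    have "(\<lambda>p q t. ordered a b (vprod V t c x) p q - scale V (?sa * ?sb) (vprod V t c (ordered a b x p q))) =
      (\<lambda>p q t. vprod V p a (bracket ?sb b c x q t) - scale V (- ?sb) (bracket ?sa a c (vprod V q b x) p t))"
      by (simp add: fun_eq_iff bracket_def ordered_def prod_diff_right prod_scale_right
          sc.scale_right_diff_distrib mult.commute)
    then show "killed M (\<lambda>p q t. ordered a b (vprod V t c x) p q -
       scale V (?sa * ?sb) (vprod V t c (ordered a b x p q)))"
      using killed_diff[OF 1 2] by simp
  qed
qed

lemma binsum_ordered_killed:
  assumes "a \<in> part V pa" "b \<in> part V pb" "c \<in> part V pc"
  obtains M0 :: nat where "\<And>x M. x \<in> carrier V \<Longrightarrow> M \<ge> M0 \<Longrightarrow>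
     killed M (\<lambda>p q t. binsum r (ordered a b (vprod V t c x)) p q -
       scale V (koszul_sign pa pc * koszul_sign pb pc) (vprod V t c (binsum r (ordered a b x) p q)))"
proof -
  let ?s = "koszul_sign pa pc * koszul_sign pb pc :: 'k"
  have C [simp]: "a \<in> carrier V" "b \<in> carrier V" "c \<in> carrier V"
    using assms part_carrier by auto
  obtain M0 where M0: "\<And>x M. x \<in> carrier V \<Longrightarrow> M \<ge> M0 \<Longrightarrow>
     killed M (\<lambda>p q t. ordered a b (vprod V t c x) p q - scale V ?s (vprod V t c (ordered a b x p q)))"
    by (rule ordered_killed[OF assms]) blast
  show ?thesis
  proof (rule that[of M0])
    fix x M assume [simp]: "x \<in> carrier V" and M: "M0 \<le> M"
    have v1: "vanishing (ordered a b (vprod V t c x))" for t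
      by (simp add: ordered_vanishing)
    have v2: "vanishing (\<lambda>p q. vprod V t c (ordered a b x p q))" for t
      using ordered_vanishing[of a b x] by (auto simp: vanishing_def) (metis C(3) prod_zero_right)
    have v3: "vanishing (\<lambda>p q. scale V ?s (vprod V t c (ordered a b x p q)))" for t
      using v2[of t] by (auto simp: vanishing_def)
    have eq: "binsum r (\<lambda>p q. ordered a b (vprod V t c x) p q -
          scale V ?s (vprod V t c (ordered a b x p q))) p q =
        binsum r (ordered a b (vprod V t c x)) p q - scale V ?s (vprod V t c (binsum r (ordered a b x) p q))"
      for p q t
      by (simp add: binsum_diff v1 v3 scale_binsum[OF v2] prod_binsum ordered_vanishing ordered_carrier)
    show "killed M (\<lambda>p q t. binsum r (ordered a b (vprod V t c x)) p q -
       scale V ?s (vprod V t c (binsum r (ordered a b x) p q)))"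
      using killed_binsum[OF M0[OF _ M, of x], of r] vanishing_diff[OF v1 v3] by (simp add: eq)
  qed
qed

text \<open>
  The products \<open>a\<^sub>(\<^sub>r\<^sub>+\<^sub>j\<^sub>)b\<close> are finitely many elements of the algebra, so each is local with
  \<open>c\<close>; the index \<open>p\<close> only enters the coefficients, so a power of \<open>z - y\<close> suffices.
\<close>

lemma itersum_killed:
  assumes "a \<in> part V pa" "b \<in> part V pb" "c \<in> part V pc"
  obtains M0 :: nat where "\<And>x M. x \<in> carrier V \<Longrightarrow> M \<ge> M0 \<Longrightarrow>
     killed M (\<lambda>p q t. itersum a b (vprod V t c x) p q r -
       scale V (koszul_sign pa pc * koszul_sign pb pc) (vprod V t c (itersum a b x p q r)))"
proof -
  let ?s = "koszul_sign pa pc * koszul_sign pb pc :: 'k"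
  have C [simp]: "a \<in> carrier V" "b \<in> carrier V" "c \<in> carrier V"
    using assms part_carrier by auto
  obtain N where N: "\<And>n. n \<ge> r + int N \<Longrightarrow> vprod V n a b = 0"
    using V1_from[OF C(1,2)] by metis
  let ?e = "\<lambda>j::nat. vprod V (r + int j) a b"
  have e: "?e j \<in> part V (pa \<noteq> pb)" for j
    using assms prod_even by blast
  have "\<exists>M1. \<forall>x N. x \<in> carrier V \<longrightarrow> N \<ge> M1 \<longrightarrow> (sdiff ^^ N) (bracket ?s (?e j) c x) = (\<lambda>m n. 0)" for j
  proof -
    obtain M1 where "\<And>x N. x \<in> carrier V \<Longrightarrow> N \<ge> M1 \<Longrightarrow>
        (sdiff ^^ N) (bracket (koszul_sign (pa \<noteq> pb) pc) (?e j) c x) = (\<lambda>m n. 0)"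
      by (rule bracket_local[OF e[of j] assms(3)]) blast
    then show ?thesis
      unfolding koszul_xor by blast
  qed
  then obtain M1 where M1: "\<And>j x N. x \<in> carrier V \<Longrightarrow> N \<ge> M1 j \<Longrightarrow>
      (sdiff ^^ N) (bracket ?s (?e j) c x) = (\<lambda>m n. 0)"
    by metis
  show ?thesis
  proof (rule that[of "\<Sum>j<N. M1 j"])
    fix x M assume [simp]: "x \<in> carrier V" and M: "(\<Sum>j<N. M1 j) \<le> M"
    have Mj: "M1 j \<le> M" if "j < N" for j
      using M member_le_sum[of j "{..<N}" M1] that by simp
    have eq: "itersum a b (vprod V t c x) p q r - scale V ?s (vprod V t c (itersum a b x p q r)) =
       (\<Sum>j<N. scale V (of_int p gchoose j) (bracket ?s (?e j) c x (q + (p - int j)) t))" for p q t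
      by (simp add: itersum_lessThan[OF N] prod_sum_right prod_scale_right bracket_def ordered_def
          sc.scale_right_diff_distrib sum_subtractf sc.scale_sum_right algebra_simps)
    have "(diff_zy ^^ M) (\<lambda>p q t. \<Sum>j<N. scale V (of_int p gchoose j)
        (bracket ?s (?e j) c x (q + (p - int j)) t)) p q t = 0" for p q t
      using Mj by (simp only: diff_zy_pow sdiff_pow_scale sdiff_pow_sum sdiff_pow_shift) (simp add: M1)
    then show "killed M (\<lambda>p q t. itersum a b (vprod V t c x) p q r -
        scale V ?s (vprod V t c (itersum a b x p q r)))"
      by (intro killed_if_zy) (simp only: eq fun_eq_iff, simp)
  qed
qed

text \<open>
  Dong's lemma for the defect of the Borcherds identity.  The bound \<open>M\<close> does not depend on \<open>x\<close>.
\<close>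

lemma jacobi_killed:
  assumes "a \<in> part V pa" "b \<in> part V pb" "c \<in> part V pc"
  obtains M :: nat where "\<And>x. x \<in> carrier V \<Longrightarrow>
     killed M (\<lambda>p q t. jacobi s a b (vprod V t c x) p q r -
       scale V (koszul_sign pa pc * koszul_sign pb pc) (vprod V t c (jacobi s a b x p q r)))"
proof -
  let ?s = "koszul_sign pa pc * koszul_sign pb pc :: 'k"
  have C [simp]: "a \<in> carrier V" "b \<in> carrier V" "c \<in> carrier V"
    using assms part_carrier by auto
  obtain M1 where M1: "\<And>x M. x \<in> carrier V \<Longrightarrow> M \<ge> M1 \<Longrightarrow>
     killed M (\<lambda>p q t. binsum r (ordered a b (vprod V t c x)) p q -
       scale V ?s (vprod V t c (binsum r (ordered a b x) p q)))"
    by (rule binsum_ordered_killed[OF assms]) blast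
  obtain M2 where M2: "\<And>x M. x \<in> carrier V \<Longrightarrow> M \<ge> M2 \<Longrightarrow>
     killed M (\<lambda>p q t. binsum r (ordered b a (vprod V t c x)) p q -
       scale V ?s (vprod V t c (binsum r (ordered b a x) p q)))"
    by (rule binsum_ordered_killed[OF assms(2,1,3), unfolded mult.commute[of "koszul_sign pb pc"]]) blast
  obtain M3 where M3: "\<And>x M. x \<in> carrier V \<Longrightarrow> M \<ge> M3 \<Longrightarrow>
     killed M (\<lambda>p q t. itersum a b (vprod V t c x) p q r -
       scale V ?s (vprod V t c (itersum a b x p q r)))"
    by (rule itersum_killed[OF assms]) blast
  show ?thesis
  proof (rule that[of "max M1 (max M2 M3)"])
    fix x assume [simp]: "x \<in> carrier V"
    let ?M = "max M1 (max M2 M3)" and ?u = "s * (- 1) powi r"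
    have B: "binsum r (ordered a' b' x) p q \<in> carrier V"
      if "a' \<in> carrier V" "b' \<in> carrier V" for a' b' p q
      using that by (simp add: binsum_carrier ordered_carrier)
    have I: "itersum a b x p q r \<in> carrier V" for p q
      unfolding itersum_def by (rule carrier_Sum_any) simp
    have eq: "jacobi s a b (vprod V t c x) p q r - scale V ?s (vprod V t c (jacobi s a b x p q r)) =
      binsum r (ordered a b (vprod V t c x)) p q - scale V ?s (vprod V t c (binsum r (ordered a b x) p q))
      - scale V ?u (binsum r (ordered b a (vprod V t c x)) q p -
          scale V ?s (vprod V t c (binsum r (ordered b a x) q p)))
      - (itersum a b (vprod V t c x) p q r - scale V ?s (vprod V t c (itersum a b x p q r)))" for p q t
      by (simp add: jacobi_def commsum_def B I prod_diff_right prod_scale_right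
          sc.scale_right_diff_distrib mult_ac)
    show "killed ?M (\<lambda>p q t. jacobi s a b (vprod V t c x) p q r -
       scale V ?s (vprod V t c (jacobi s a b x p q r)))"
      unfolding eq
      by (intro killed_diff killed_scale M1 M3 killed_swap[OF M2]) simp_all
  qed
qed

section \<open>The Borcherds identity\<close>

lemma itersum_0:
  assumes "a \<in> carrier V" "b \<in> carrier V" "c \<in> carrier V"
  shows "itersum a b c 0 q r = vprod V q (vprod V r a b) c"
proof -
  have "itersum a b c 0 q r = (\<Sum>j<Suc 0. scale V (of_int 0 gchoose j)
      (vprod V (0 + q - int j) (vprod V (r + int j) a b) c))"
    unfolding itersum_def by (intro Sum_any_lessThan) (simp add: gbinomial_0_left)
  then show ?thesis by simp
qed

lemma D_one: "va_D V (vone V) = 0"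
  by (simp add: va_D_def V2_left)

lemma D_prod_one:
  assumes "a \<in> carrier V"
  shows "va_D V (vprod V n a (vone V)) = scale V (- of_int n) (vprod V (n - 1) a (vone V))"
  using V3_right[OF assms one_carrier, of n] assms by (simp add: D_one add_eq_0_iff)

lemma D_sum:
  assumes "\<And>j. j \<in> J \<Longrightarrow> f j \<in> carrier V"
  shows "va_D V (sum f J) = (\<Sum>j\<in>J. va_D V (f j))"
  using assms by (simp add: va_D_def prod_sum_left)

lemma D_scale: "x \<in> carrier V \<Longrightarrow> va_D V (scale V c x) = scale V c (va_D V x)"
  and D_diff: "x \<in> carrier V \<Longrightarrow> y \<in> carrier V \<Longrightarrow> va_D V (x - y) = va_D V x - va_D V y"
  by (simp_all add: va_D_def prod_scale_left prod_diff_left)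

lemma D_ordered_one:
  assumes "a \<in> carrier V" "b \<in> carrier V"
  shows "va_D V (ordered a b (vone V) m n) =
    scale V (- of_int m) (ordered a b (vone V) (m - 1) n) + scale V (- of_int n) (ordered a b (vone V) m (n - 1))"
proof -
  have "va_D V (vprod V m a y) = vprod V m a (va_D V y) - scale V (of_int m) (vprod V (m - 1) a y)"
    if "y \<in> carrier V" for y
    using V3_right[OF assms(1) that, of m] by simp
  then show ?thesis
    using assms by (simp add: ordered_def D_prod_one prod_scale_right prod_neg_right)
qed

text \<open>
  Translation covariance on the vacuum: \<open>D\<close> acts on \<open>a(w)b(z)1\<close> as \<open>\<partial>\<^sub>w + \<partial>\<^sub>z\<close>, which annihilates
  \<open>(w-z)\<^sup>r\<close>; integration by parts leaves the derivatives of \<open>w\<^sup>p z\<^sup>q\<close>.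
\<close>

lemma D_binsum_one:
  assumes "a \<in> carrier V" "b \<in> carrier V"
  shows "va_D V (binsum r (ordered a b (vone V)) p q) =
    scale V (- of_int p) (binsum r (ordered a b (vone V)) (p - 1) q) +
    scale V (- of_int q) (binsum r (ordered a b (vone V)) p (q - 1))"
proof -
  let ?f = "ordered a b (vone V)"
  let ?c = "\<lambda>j. (-1) ^ j * (of_int r gchoose j) :: 'k"
  obtain N where N: "\<And>p' q'. q' \<ge> q - 1 + int N \<Longrightarrow> ?f p' q' = 0"
    using vanishing_bound[OF ordered_vanishing[OF assms one_carrier], of "q - 1"] by metis
  let ?g = "\<lambda>j. ?f (p + r - int j - 1) (q + int j)"
  have 1: "va_D V (binsum r ?f p q) = (\<Sum>j<Suc N. scale V (?c j)
     (scale V (- of_int (p + r - int j)) (?g j) + scale V (- of_int (q + int j)) (?f (p + r - int j) (q - 1 + int j))))"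
  proof -
    have q: "q + int j - 1 = q - 1 + int j" for j
      by simp
    have "binsum r ?f p q = (\<Sum>j<Suc N. scale V (?c j) (?f (p + r - int j) (q + int j)))"
      by (rule binsum_lessThan) (simp add: N)
    moreover have "?f m n \<in> carrier V" for m n
      using assms by (simp add: ordered_carrier)
    ultimately show ?thesis
      by (simp only: D_sum D_scale carrier_scale D_ordered_one[OF assms] q)
  qed
  have 2: "binsum r ?f (p - 1) q = (\<Sum>j<Suc N. scale V (?c j) (?g j))"
    by (subst binsum_lessThan[where N = "Suc N"]) (auto intro!: N sum.cong simp: algebra_simps)
  have 3: "binsum r ?f p (q - 1) = (\<Sum>j<Suc N. scale V (?c j) (?f (p + r - int j) (q - 1 + int j)))"
    by (subst binsum_lessThan[where N = "Suc N"]) (auto intro!: N)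
  have "(\<Sum>j<Suc N. scale V (of_nat j * ?c j) (?f (p + r - int j) (q - 1 + int j))) =
      (\<Sum>j<N. scale V (of_nat (Suc j) * ?c (Suc j)) (?g j))"
    unfolding sum.lessThan_Suc_shift by (simp add: algebra_simps)
  also have "\<dots> = (\<Sum>j<N. scale V (- (of_int r - of_nat j) * ?c j) (?g j))"
  proof -
    have c: "of_nat (Suc j) * (of_int r gchoose Suc j) = (of_int r - of_nat j) * (of_int r gchoose j :: 'k)" for j
      by (simp only: gbinomial_absorb_comp gbinomial_absorption)
    have "of_nat (Suc j) * ?c (Suc j) = - ((-1) ^ j * (of_nat (Suc j) * (of_int r gchoose Suc j)))" for j
      by (simp add: mult_ac)
    then have "of_nat (Suc j) * ?c (Suc j) = - (of_int r - of_nat j) * ?c j" for j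
      by (simp only: c) (simp add: algebra_simps)
    then show ?thesis
      by simp
  qed
  also have "\<dots> = (\<Sum>j<Suc N. scale V (- (of_int r - of_nat j) * ?c j) (?g j))"
    using N by simp
  finally have 4: "(\<Sum>j<Suc N. scale V (of_nat j * ?c j) (?f (p + r - int j) (q - 1 + int j))) =
    (\<Sum>j<Suc N. scale V (- (of_int r - of_nat j) * ?c j) (?g j))" .
  have "va_D V (binsum r ?f p q) =
    (\<Sum>j<Suc N. scale V (- of_int p * ?c j) (?g j)) + (\<Sum>j<Suc N. scale V (- (of_int r - of_nat j) * ?c j) (?g j))
     + (\<Sum>j<Suc N. scale V (- of_int q * ?c j) (?f (p + r - int j) (q - 1 + int j)))
     - (\<Sum>j<Suc N. scale V (of_nat j * ?c j) (?f (p + r - int j) (q - 1 + int j)))"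
    unfolding 1 sum.distrib[symmetric] sum_subtractf[symmetric]
    by (intro sum.cong refl) (simp add: algebra_simps sc.scale_left_distrib sc.scale_left_diff_distrib)
  then show ?thesis
    unfolding 2 3 4 by (simp add: sc.scale_sum_right del: sum.lessThan_Suc)
qed

text \<open>
  On the vacuum the defect is checked directly for \<open>p + q \<ge> -1\<close>, where at most one term of each sum
  survives for a suitable choice of \<open>p\<close> and \<open>q\<close>.  Translation covariance propagates it to all smaller
  \<open>p + q\<close>.
\<close>

lemma jacobi_one:
  assumes "a \<in> carrier V" "b \<in> carrier V"
    and step: "\<And>p q. jacobi s a b (vone V) p q r = jacobi s a b (vone V) 0 (p + q) r"
  shows "jacobi s a b (vone V) p q r = 0"
proof -
  let ?j = "\<lambda>n. jacobi s a b (vone V) 0 n r"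
  have regular: "ordered a' b' (vone V) m n = 0" if "a' \<in> carrier V" "b' \<in> carrier V" "n \<ge> 0" for a' b' m n
    using that by (simp add: ordered_def V2_right_nonneg)
  have nonneg: "?j n = 0" if "n \<ge> 0" for n
  proof -
    have "itersum a b (vone V) n 0 r = 0"
    proof -
      have "scale V (of_int n gchoose j) (vprod V (n + 0 - int j) (vprod V (r + int j) a b) (vone V)) = 0" for j
      proof (cases "int j \<le> n")
        case True
        then show ?thesis using assms by (simp add: V2_right_nonneg)
      next
        case False
        then have "(of_int n :: 'k) gchoose j = 0"
          using that binomial_gbinomial[of "nat n" j, where 'a = 'k] by (simp add: binomial_eq_0)
        then show ?thesis by simp
      qed
      from Sum_any_lessThan[of 0, OF this] show ?thesis
        by (simp add: itersum_def)
    qed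
    moreover have "binsum r (ordered a b (vone V)) n 0 = 0" "binsum r (ordered b a (vone V)) 0 n = 0"
      using assms that by (subst binsum_lessThan[where N = 0]; simp add: regular)+
    ultimately have "jacobi s a b (vone V) n 0 r = 0"
      by (simp add: jacobi_def commsum_def)
    then show ?thesis
      using step[of n 0] by simp
  qed
  have minus_one: "?j (-1) = 0"
  proof -
    have "binsum r (ordered a b (vone V)) 0 (-1) = vprod V r a b"
      using assms by (subst binsum_lessThan[where N = 1]) (simp_all add: ordered_def V2_right_neg V2_right_nonneg)
    moreover have "binsum r (ordered b a (vone V)) (-1) 0 = 0"
      using assms by (subst binsum_lessThan[where N = 0]) (simp_all add: regular)
    ultimately show ?thesis
      using assms by (simp add: jacobi_def commsum_def itersum_0 V2_right_neg)
  qed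
  have "?j (-1 - int k) = 0" for k
  proof (induction k)
    case 0
    then show ?case using minus_one by simp
  next
    case (Suc k)
    let ?n = "-1 - int k"
    have "va_D V (?j ?n) = scale V (- of_int ?n) (?j (?n - 1))"
    proof -
      have "jacobi s a b (vone V) 0 n r = binsum r (ordered a b (vone V)) 0 n -
          scale V (s * (- 1) powi r) (binsum r (ordered b a (vone V)) n 0) - vprod V n (vprod V r a b) (vone V)" for n
        using assms by (simp add: jacobi_def commsum_def itersum_0)
      moreover have "binsum r (ordered a' b' (vone V)) m n \<in> carrier V"
        if "a' \<in> carrier V" "b' \<in> carrier V" for a' b' m n
        using that by (simp add: binsum_carrier ordered_carrier)
      ultimately show ?thesis
        using assms by (simp add: D_diff D_scale D_binsum_one D_prod_one sc.scale_right_diff_distrib mult.commute)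
    qed
    moreover have "va_D V (?j ?n) = 0"
      using Suc by (simp add: va_D_def)
    moreover have "- of_int ?n \<noteq> (0 :: 'k)"
    proof -
      have "- of_int ?n = (of_nat (Suc k) :: 'k)"
        by simp
      then show ?thesis
        by (simp del: of_nat_Suc)
    qed
    ultimately have "?j (?n - 1) = 0"
      by (metis sc.scale_eq_0_iff)
    then show ?case
      by (simp add: algebra_simps)
  qed
  then have "?j n = 0" for n
  proof (cases "n \<ge> 0")
    case False
    then have "n = -1 - int (nat (-1 - n))"
      by simp
    with \<open>\<And>k. ?j (-1 - int k) = 0\<close> show ?thesis
      by metis
  qed (rule nonneg)
  then show ?thesis
    by (subst step) simp
qed

text \<open>
  If the series of \<open>F\<close> has only nonnegative powers of \<open>z\<close>, then setting \<open>z = 0\<close> after multiplication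
  by \<open>(w-z)\<^sup>L\<close> merely multiplies by \<open>w\<^sup>L\<close>.
\<close>

lemma sdiff_pow_edge:
  assumes "\<And>n t. t \<ge> 0 \<Longrightarrow> F n t = (0 :: 'v)"
  shows "(sdiff ^^ L) F n (-1) = F (n + int L) (-1) \<and> (\<forall>t\<ge>0. (sdiff ^^ L) F n t = 0)"
proof (induction L arbitrary: n)
  case 0
  then show ?case by (simp add: assms)
next
  case (Suc L)
  then show ?case
    by (simp only: sdiff_pow_Suc) (simp add: algebra_simps)
qed

lemma binsum_add:
  assumes "vanishing f" "vanishing g"
  shows "binsum r (\<lambda>p q. f p q + g p q) p q = binsum r f p q + binsum r g p q"
proof -
  have "vanishing (\<lambda>p q. - g p q)"
    using assms(2) by (simp add: vanishing_def)
  moreover have "binsum r (\<lambda>p q. - g p q) p q = - binsum r g p q"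
    using scale_binsum[OF assms(2), of "-1" r p q] by simp
  ultimately show ?thesis
    using binsum_diff[OF assms(1), of "\<lambda>p q. - g p q" r p q] by simp
qed

lemma jacobi_add:
  assumes "a \<in> carrier V" "b \<in> carrier V" "c \<in> carrier V" "d \<in> carrier V"
  shows "jacobi s a b (c + d) p q r = jacobi s a b c p q r + jacobi s a b d p q r"
proof -
  obtain N where N: "\<And>n. n \<ge> r + int N \<Longrightarrow> vprod V n a b = 0"
    using V1_from[OF assms(1,2)] by metis
  have "ordered x y (c + d) = (\<lambda>p q. ordered x y c p q + ordered x y d p q)"
    if "x \<in> carrier V" "y \<in> carrier V" for x y
    using that assms by (simp add: fun_eq_iff ordered_def prod_add_right)
  then show ?thesis
    using assms by (simp add: jacobi_def commsum_def binsum_add ordered_vanishing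
        itersum_lessThan[OF N] prod_add_right sc.scale_right_distrib sum.distrib)
qed

text \<open>
  A family that depends on \<open>p + q\<close> only is supported on \<open>w = z\<close>, where \<open>w - y\<close> and \<open>z - y\<close> act alike.
\<close>

lemma killed_total:
  assumes "killed L (\<lambda>p q t. F (p + q) t)"
  shows "(sdiff ^^ (L + L)) F n t = 0"
proof -
  have 1: "(diff_zy ^^ n) (\<lambda>p q t. G (p + q) t) = (\<lambda>p q t. (sdiff ^^ n) G (p + q) t)"
    and 2: "(diff_wy ^^ n) (\<lambda>p q t. G (p + q) t) = (\<lambda>p q t. (sdiff ^^ n) G (p + q) t)"
    for n and G :: "int \<Rightarrow> int \<Rightarrow> 'v"
    by (induction n) (simp_all add: fun_eq_iff diff_zy_def diff_wy_def sdiff_def algebra_simps)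
  have "(\<lambda>p q t. (sdiff ^^ L) ((sdiff ^^ L) F) (p + q) t) = (\<lambda>p q t. 0)"
    using assms unfolding killed_def 1[of L F] 2[of L "(sdiff ^^ L) F"] .
  from fun_cong[OF fun_cong[OF fun_cong[OF this]], of n 0 t] show ?thesis
    by (simp add: funpow_add)
qed

text \<open>
  Let \<open>J\<^sub>r\<close> be the defect of the identity.  It vanishes for large \<open>r\<close> by locality, and this is propagated
  downwards.  If \<open>J\<^sub>r\<^sub>+\<^sub>1 = 0\<close>, then \<open>J\<^sub>r\<close> is annihilated by \<open>w - z\<close>, so it depends on \<open>p + q\<close>
  only and is a field in one variable.  That field annihilates the vacuum, and it is local with every \<open>c\<close>
  by Dong's lemma.  Applying locality to the vacuum and setting \<open>y = 0\<close> in \<open>c(y)1\<close> shows that it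
  annihilates \<open>c\<close>, as in Goddard's uniqueness theorem.
\<close>

theorem borcherds:
  assumes a: "a \<in> part V pa" and b: "b \<in> part V pb" and c: "c \<in> carrier V"
  shows "commsum (koszul_sign pa pb) a b c p q r = itersum a b c p q r"
proof -
  let ?J = "\<lambda>c p q r. jacobi (koszul_sign pa pb) a b c p q r"
  note C [simp] = a[THEN part_carrier] b[THEN part_carrier]
  obtain M where M: "\<And>c m n r. c \<in> carrier V \<Longrightarrow> r \<ge> int M \<Longrightarrow> commsum (koszul_sign pa pb) a b c m n r = 0"
    using locality[OF a b] by blast
  obtain N where N: "\<And>n. n \<ge> int N \<Longrightarrow> vprod V n a b = 0"
    using V1_from[OF C, of 0] by auto
  have "\<forall>c\<in>carrier V. \<forall>p q. ?J c p q (int (max M N) - int k) = 0" for k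
  proof (induction k)
    case 0
    have "itersum a b c p q (int (max M N)) = 0" if "c \<in> carrier V" for c p q
      using that by (subst itersum_lessThan[where N = 0]) (simp_all add: N)
    then show ?case
      by (simp add: jacobi_def M)
  next
    case (Suc k)
    define r where "r = int (max M N) - int (Suc k)"
    have "r + 1 = int (max M N) - int k"
      by (simp add: r_def)
    then have "?J c p q (r + 1) = 0" if "c \<in> carrier V" for c p q
      using Suc that by simp
    then have move: "?J c (p + 1) q r = ?J c p (q + 1) r" if "c \<in> carrier V" for c p q
      using jacobi_succ[OF C that, of "koszul_sign pa pb" p q r] that by simp
    have J: "?J c p q r = ?J c 0 (p + q) r" if "c \<in> carrier V" for c p q
    proof (induction p arbitrary: q rule: int_induct[where k = 0])
      case (step1 i)
      then show ?case using move[OF that, of i q] step1(2)[of "q + 1"] by (simp add: algebra_simps)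
    next
      case (step2 i)
      then show ?case using move[OF that, of "i - 1" "q - 1"] step2(2)[of "q - 1"] by (simp add: algebra_simps)
    qed simp
    have vac: "?J (vone V) p q r = 0" for p q
      by (rule jacobi_one[OF C]) (rule J, simp)
    have hom: "?J c p q r = 0" if c: "c \<in> part V pc" for c pc p q
    proof -
      note Cc [simp] = c[THEN part_carrier]
      obtain L where L: "killed L (\<lambda>p q t. ?J (vprod V t c (vone V)) p q r -
         scale V (koszul_sign pa pc * koszul_sign pb pc) (vprod V t c (?J (vone V) p q r)))"
        using that by (rule jacobi_killed[OF a b c, of "koszul_sign pa pb" r]) (erule meta_allE[of _ "vone V"], simp)
      let ?F = "\<lambda>n t. ?J (vprod V t c (vone V)) 0 n r"
      have "killed L (\<lambda>p q t. ?F (p + q) t)"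
      proof -
        have "(\<lambda>p q t. ?F (p + q) t) = (\<lambda>p q t. ?J (vprod V t c (vone V)) p q r -
            scale V (koszul_sign pa pc * koszul_sign pb pc) (vprod V t c (?J (vone V) p q r)))"
        proof (intro ext)
          fix p q t
          show "?F (p + q) t = ?J (vprod V t c (vone V)) p q r -
            scale V (koszul_sign pa pc * koszul_sign pb pc) (vprod V t c (?J (vone V) p q r))"
            unfolding vac using J[of "vprod V t c (vone V)" p q] by simp
        qed
        then show ?thesis
          using L by (simp only:)
      qed
      then have zero: "(sdiff ^^ (L + L)) ?F n t = 0" for n t
        by (rule killed_total)
      have "jacobi s a b 0 p q r = 0" for s p q
        using jacobi_add[of a b 0 0 s p q r] by simp
      then have "?F n t = 0" if "t \<ge> 0" for n t
        using that by (simp add: V2_right_nonneg)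
      then have "?F (n + int (L + L)) (-1) = 0" for n
        using sdiff_pow_edge[of ?F "L + L" n] zero by simp
      from this[of "p + q - int (L + L)"] show ?thesis
        using J[of c p q] by (simp add: V2_right_neg)
    qed
    show ?case
    proof (intro ballI allI)
      fix c p q assume "c \<in> carrier V"
      then obtain y z where "c = y + z" "y \<in> part V False" "z \<in> part V True"
        by (rule carrier_parts)
      then show "?J c p q (int (max M N) - int (Suc k)) = 0"
        unfolding r_def[symmetric] by (simp add: jacobi_add part_carrier hom[of _ False] hom[of _ True])
    qed
  qed
  note low = this
  have "?J c p q r = 0"
  proof (cases "r \<le> int (max M N)")
    case True
    then show ?thesis
      using low[of "nat (int (max M N) - r)"] c by simp
  next
    case False
    then have "itersum a b c p q r = 0"
      using c by (subst itersum_lessThan[where N = 0]) (simp_all add: N)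
    with False show ?thesis
      using c by (simp add: jacobi_def M)
  qed
  then show ?thesis
    by (simp add: jacobi_def)
qed

end

section \<open>Quotients\<close>

lemma (in vector_space) projection_along:
  assumes "subspace K"
  obtains \<pi> where "Vector_Spaces.linear scale scale \<pi>" "\<And>x. \<pi> x = 0 \<longleftrightarrow> x \<in> K" "\<And>x. \<pi> (\<pi> x) = \<pi> x"
proof -
  interpret vector_space_pair scale scale by unfold_locales
  obtain B where B: "B \<subseteq> K" "independent B" "span B = K"
    using basis_exists[of K] assms by (metis span_subspace)
  define C where "C = extend_basis B"
  have C: "B \<subseteq> C" "independent C" "span C = UNIV"
    unfolding C_def using extend_basis_superset[OF B(2)] independent_extend_basis[OF B(2)]
      span_extend_basis[OF B(2)] by auto
  define \<pi> where "\<pi> = construct C (\<lambda>b. if b \<in> B then 0 else b)"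
  interpret pi: Vector_Spaces.linear scale scale \<pi>
    unfolding \<pi>_def by (rule linear_construct[OF C(2)])
  have onC: "\<pi> b = (if b \<in> B then 0 else b)" if "b \<in> C" for b
    using that unfolding \<pi>_def by (simp add: construct_basis[OF C(2)])
  have K: "\<pi> x = 0" if "x \<in> span B" for x
    by (rule pi.eq_0_on_span[OF _ that]) (use onC C(1) in auto)
  have compl: "\<pi> x = x" if "x \<in> span (C - B)" for x
    using that by (induction rule: span_induct_alt) (auto simp: pi.add pi.scale onC pi.zero)
  have "\<exists>y z. x = y + z \<and> y \<in> span B \<and> z \<in> span (C - B)" for x
  proof -
    have "x \<in> span (B \<union> (C - B))"
      using C by (simp add: Un_absorb1)
    then show ?thesis
      unfolding span_Un by auto
  qed
  then have split: "\<exists>y z. x = y + z \<and> y \<in> K \<and> \<pi> y = 0 \<and> \<pi> z = z" for x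
    using K compl B(3) by metis
  show ?thesis
  proof (rule that[of \<pi>])
    show "Vector_Spaces.linear scale scale \<pi>" by unfold_locales
    show "\<pi> x = 0 \<longleftrightarrow> x \<in> K" for x
      using split[of x] K B(3) by (metis add.right_neutral pi.add add_0)
    show "\<pi> (\<pi> x) = \<pi> x" for x
      using split[of x] by (metis pi.add add_0)
  qed
qed

text \<open>
  The quotient by an ideal is realised on a complement of the ideal, as the image of a projection \<open>\<pi>\<close>
  along it; in this way it has the same ambient vector space as the algebra itself.
\<close>

definition va_image :: "('k, 'v) va \<Rightarrow> ('v \<Rightarrow> 'v) \<Rightarrow> ('k, 'v) va" where
  "va_image V \<pi> = \<lparr>carrier = \<pi> ` carrier V, scale = scale V, part = (\<lambda>p. \<pi> ` part V p),
     vprod = (\<lambda>n a b. \<pi> (vprod V n a b)), vone = \<pi> (vone V)\<rparr>"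

lemma va_image_simps [simp]:
  "carrier (va_image V \<pi>) = \<pi> ` carrier V" "scale (va_image V \<pi>) = scale V"
  "part (va_image V \<pi>) p = \<pi> ` part V p" "vprod (va_image V \<pi>) n a b = \<pi> (vprod V n a b)"
  "vone (va_image V \<pi>) = \<pi> (vone V)"
  by (simp_all add: va_image_def)

lemma va_idealD:
  assumes "va_ideal A I"
  shows "I \<subseteq> carrier A" "module.subspace (scale A) I"
    and "\<And>n a x. a \<in> carrier A \<Longrightarrow> x \<in> I \<Longrightarrow> vprod A n a x \<in> I"
    and "\<And>n a x. a \<in> carrier A \<Longrightarrow> x \<in> I \<Longrightarrow> vprod A n x a \<in> I"
  using assms by (auto simp: va_ideal_def)

context vertex_algebra
begin

lemma va_ideal_carrier: "va_ideal V (carrier V)"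
  by (simp add: va_ideal_def carrier_subspace)

lemma va_ideal_generated:
  assumes "X \<subseteq> carrier V"
  shows "va_ideal V (va_ideal_generated V X)" "X \<subseteq> va_ideal_generated V X"
proof -
  have "va_ideal_generated V X \<subseteq> carrier V"
    unfolding va_ideal_generated_def using assms va_ideal_carrier by blast
  moreover have "sc.subspace (va_ideal_generated V X)"
    unfolding va_ideal_generated_def by (rule sc.subspace_Inter) (auto simp: va_ideal_def)
  ultimately show "va_ideal V (va_ideal_generated V X)"
    by (auto simp: va_ideal_def va_ideal_generated_def)
  show "X \<subseteq> va_ideal_generated V X"
    by (auto simp: va_ideal_generated_def)
qed

lemma va_ideal_generated_least: "va_ideal V I \<Longrightarrow> X \<subseteq> I \<Longrightarrow> va_ideal_generated V X \<subseteq> I"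
  by (auto simp: va_ideal_generated_def)

lemma part_zero [simp]: "0 \<in> part V p"
  and part_add: "x \<in> part V p \<Longrightarrow> y \<in> part V p \<Longrightarrow> x + y \<in> part V p"
  and part_diff: "x \<in> part V p \<Longrightarrow> y \<in> part V p \<Longrightarrow> x - y \<in> part V p"
  and part_scale: "x \<in> part V p \<Longrightarrow> scale V r x \<in> part V p"
  using part_subspace[of p] by (auto intro: sc.subspace_0 sc.subspace_add sc.subspace_diff sc.subspace_scale)

lemma parts_unique:
  assumes "y + z = y' + z'" "y \<in> part V False" "y' \<in> part V False" "z \<in> part V True" "z' \<in> part V True"
  shows "y = y'" "z = z'"
proof -
  have "y - y' = z' - z"
    using assms(1) by (simp add: algebra_simps)
  then have "y - y' \<in> part V False \<inter> part V True"
    using part_diff assms(2-) by (metis IntI)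
  then show "y = y'" "z = z'"
    using assms(1) by (auto simp: part_inter)
qed

text \<open>
  The elements of the ideal whose homogeneous components lie in the ideal form an ideal again, and it
  contains the even generators.  Without this the parts of the quotient could intersect.
\<close>

lemma even_ideal_graded:
  assumes "X \<subseteq> part V False" "y + z \<in> va_ideal_generated V X" "y \<in> part V False" "z \<in> part V True"
  shows "y \<in> va_ideal_generated V X"
proof -
  let ?I = "va_ideal_generated V X"
  define J where "J = {y + z | y z. y \<in> ?I \<inter> part V False \<and> z \<in> ?I \<inter> part V True}"
  have X: "X \<subseteq> carrier V"
    using assms(1) part_carrier by blast
  note I = va_ideal_generated[OF X]
  note ID = va_idealD[OF I(1)]
  have I0: "0 \<in> ?I" and Iadd: "\<And>x y. x \<in> ?I \<Longrightarrow> y \<in> ?I \<Longrightarrow> x + y \<in> ?I"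
    and Isc: "\<And>x c. x \<in> ?I \<Longrightarrow> scale V c x \<in> ?I"
    using ID(2) by (auto intro: sc.subspace_0 sc.subspace_add sc.subspace_scale)
  have JI: "y + z \<in> J" if "y \<in> ?I" "y \<in> part V False" "z \<in> ?I" "z \<in> part V True" for y z
    using that by (auto simp: J_def)
  have "va_ideal V J"
    unfolding va_ideal_def
  proof (intro conjI allI ballI)
    show "J \<subseteq> carrier V"
      by (auto simp: J_def part_carrier)
    show "sc.subspace J"
    proof (rule sc.subspaceI)
      show "0 \<in> J" using JI[of 0 0] I0 by simp
      show "x + y \<in> J" if J: "x \<in> J" "y \<in> J" for x y
      proof -
        obtain x0 x1 y0 y1 where xy: "x = x0 + x1" "y = y0 + y1" "x0 \<in> ?I" "x0 \<in> part V False"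
          "y0 \<in> ?I" "y0 \<in> part V False" "x1 \<in> ?I" "x1 \<in> part V True" "y1 \<in> ?I" "y1 \<in> part V True"
          using J unfolding J_def by blast
        have "x + y = (x0 + y0) + (x1 + y1)" by (simp add: xy)
        then show ?thesis using JI[of "x0 + y0" "x1 + y1"] xy Iadd part_add by metis
      qed
      show "scale V c x \<in> J" if J: "x \<in> J" for c x
      proof -
        obtain x0 x1 where x: "x = x0 + x1" "x0 \<in> ?I" "x0 \<in> part V False" "x1 \<in> ?I" "x1 \<in> part V True"
          using J unfolding J_def by blast
        then show ?thesis using JI Isc part_scale by (simp add: sc.scale_right_distrib)
      qed
    qed
    fix n a x assume a: "a \<in> carrier V" and "x \<in> J"
    then obtain x0 x1 where x: "x = x0 + x1" "x0 \<in> ?I" "x0 \<in> part V False" "x1 \<in> ?I" "x1 \<in> part V True"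
      by (auto simp: J_def)
    obtain a0 a1 where aa: "a = a0 + a1" "a0 \<in> part V False" "a1 \<in> part V True"
      using a by (rule carrier_parts)
    note [simp] = aa(2,3)[THEN part_carrier] x(3,5)[THEN part_carrier]
    note m = prod_even[of _ False _ False, simplified] prod_even[of _ False _ True, simplified]
      prod_even[of _ True _ False, simplified] prod_even[of _ True _ True, simplified]
    have "vprod V n a x = (vprod V n a0 x0 + vprod V n a1 x1) + (vprod V n a0 x1 + vprod V n a1 x0)"
      by (simp add: x aa prod_add_left prod_add_right)
    moreover have "vprod V n a0 x0 + vprod V n a1 x1 \<in> ?I" "vprod V n a0 x1 + vprod V n a1 x0 \<in> ?I"
      using x ID(3) Iadd by simp_all
    moreover have "vprod V n a0 x0 + vprod V n a1 x1 \<in> part V False"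
        "vprod V n a0 x1 + vprod V n a1 x0 \<in> part V True"
      using x aa m part_add by simp_all
    ultimately show "vprod V n a x \<in> J"
      using JI by simp
    have "vprod V n x a = (vprod V n x0 a0 + vprod V n x1 a1) + (vprod V n x1 a0 + vprod V n x0 a1)"
      by (simp add: x aa prod_add_left prod_add_right)
    moreover have "vprod V n x0 a0 + vprod V n x1 a1 \<in> ?I" "vprod V n x1 a0 + vprod V n x0 a1 \<in> ?I"
      using x ID(4) Iadd by simp_all
    moreover have "vprod V n x0 a0 + vprod V n x1 a1 \<in> part V False"
        "vprod V n x1 a0 + vprod V n x0 a1 \<in> part V True"
      using x aa m part_add by simp_all
    ultimately show "vprod V n x a \<in> J"
      using JI by simp
  qed
  moreover have "X \<subseteq> J"
    using JI[of _ 0] I0 I(2) assms(1) by auto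
  ultimately have "?I \<subseteq> J"
    by (rule va_ideal_generated_least)
  with assms(2) obtain y' z' where "y + z = y' + z'" "y' \<in> ?I" "y' \<in> part V False" "z' \<in> part V True"
    by (auto simp: J_def)
  with parts_unique(1) assms(3,4) show ?thesis
    by metis
qed

theorem vertex_algebra_quotient:
  assumes K: "va_ideal V K"
    and graded: "\<And>y z. y + z \<in> K \<Longrightarrow> y \<in> part V False \<Longrightarrow> z \<in> part V True \<Longrightarrow> y \<in> K"
    and lin: "Vector_Spaces.linear (scale V) (scale V) \<pi>"
    and ker: "\<And>x. \<pi> x = 0 \<longleftrightarrow> x \<in> K"
    and idem: "\<And>x. \<pi> (\<pi> x) = \<pi> x"
  shows "vertex_algebra (va_image V \<pi>)" "va_hom V (va_image V \<pi>) \<pi>"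
proof -
  interpret pi: Vector_Spaces.linear "scale V" "scale V" \<pi>
    by (rule lin)
  let ?Q = "va_image V \<pi>"
  note KD = va_idealD[OF K]
  have diffK: "\<pi> x - x \<in> K" for x
    unfolding ker[symmetric] by (simp add: pi.diff idem)
  have C [simp]: "\<pi> x \<in> carrier V" if "x \<in> carrier V" for x
    using diffK[of x] KD(1) that carrier_add[of "\<pi> x - x" x] by auto
  have eq: "\<pi> x = \<pi> y" if "x - y \<in> K" for x y
    using that unfolding ker[symmetric] by (simp add: pi.diff)
  have pr [simp]: "\<pi> (vprod V n (\<pi> x) (\<pi> y)) = \<pi> (vprod V n x y)"
    if "x \<in> carrier V" "y \<in> carrier V" for n x y
  proof (rule eq)
    have "vprod V n (\<pi> x) (\<pi> y) - vprod V n x y = vprod V n (\<pi> x - x) (\<pi> y) + vprod V n x (\<pi> y - y)"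
      using that by (simp add: prod_diff_left prod_diff_right)
    then show "vprod V n (\<pi> x) (\<pi> y) - vprod V n x y \<in> K"
      using that diffK KD(2-4) by (simp add: sc.subspace_add)
  qed
  have pr': "\<pi> (vprod V n (\<pi> x) y) = \<pi> (vprod V n x y)" "\<pi> (vprod V n x (\<pi> y)) = \<pi> (vprod V n x y)"
    if "x \<in> carrier V" "y \<in> carrier V" for n x y
    using that pr[of "\<pi> x" y n] pr[of x "\<pi> y" n] by (simp_all add: idem)
  have D: "va_D ?Q (\<pi> x) = \<pi> (va_D V x)" if "x \<in> carrier V" for x
    using that by (simp add: va_D_def)
  have Dk: "(va_D ?Q ^^ k) (\<pi> x) = \<pi> ((va_D V ^^ k) x) \<and> (va_D V ^^ k) x \<in> carrier V"
    if "x \<in> carrier V" for k x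
    using that by (induction k) (simp_all add: D)
  show hom: "va_hom V ?Q \<pi>"
    by (simp add: va_hom_def pi.add pi.scale)
  show "vertex_algebra ?Q"
  proof
    show "module.subspace (scale ?Q) (carrier ?Q)" "module.subspace (scale ?Q) (part ?Q p)" for p
      using pi.subspace_image carrier_subspace part_subspace by simp_all
    show "carrier ?Q = {x + y |x y. x \<in> part ?Q False \<and> y \<in> part ?Q True}"
    proof (intro set_eqI iffI)
      fix u assume "u \<in> carrier ?Q"
      then obtain x where x: "u = \<pi> x" "x \<in> carrier V" by auto
      from x(2) obtain y z where "x = y + z" "y \<in> part V False" "z \<in> part V True"
        by (rule carrier_parts)
      then show "u \<in> {x + y |x y. x \<in> part ?Q False \<and> y \<in> part ?Q True}"
        unfolding x(1) by (auto simp: pi.add)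
    next
      fix u assume "u \<in> {x + y |x y. x \<in> part ?Q False \<and> y \<in> part ?Q True}"
      then obtain y z where "u = \<pi> (y + z)" "y \<in> part V False" "z \<in> part V True"
        by (auto simp: pi.add)
      then show "u \<in> carrier ?Q"
        by (auto simp: part_carrier)
    qed
    show "part ?Q False \<inter> part ?Q True = {0}"
    proof -
      have "\<pi> y = 0" if "y \<in> part V False" "z \<in> part V True" "\<pi> y = \<pi> z" for y z
      proof -
        have "- z \<in> part V True"
          using part_scale[OF that(2), of "-1"] by simp
        moreover have "y + - z \<in> K"
          using that(3) unfolding ker[symmetric] by (simp add: pi.diff)
        ultimately show ?thesis
          using graded[of y "- z"] that(1) by (simp add: ker)
      qed
      moreover have "0 \<in> \<pi> ` part V p" for p
        using part_zero[of p] pi.zero by (metis image_eqI)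
      ultimately show ?thesis by auto
    qed
    show "vone ?Q \<in> part ?Q False"
      using one_even by simp
    show "vprod ?Q n a b \<in> part ?Q (p \<noteq> q)" if "a \<in> part ?Q p" "b \<in> part ?Q q" for a b p q n
      using that prod_even by (auto simp: part_carrier simp del: not_iff)
    show "\<exists>n0. \<forall>n\<ge>n0. vprod ?Q n a b = 0" if ab: "a \<in> carrier ?Q" "b \<in> carrier ?Q" for a b
    proof -
      obtain x y where "a = \<pi> x" "b = \<pi> y" "x \<in> carrier V" "y \<in> carrier V"
        using ab unfolding va_image_simps by blast
      with V1[of x y] show ?thesis
        by (auto simp: pi.zero) (metis pi.zero)
    qed
    show "vprod ?Q n a (vone ?Q) = scale ?Q (1 / fact (nat (- n - 1))) ((va_D ?Q ^^ nat (- n - 1)) a)"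
      if "a \<in> carrier ?Q" "n < 0" for a n
      using that by (auto simp: Dk V2_right_neg pi.scale)
    show "vprod ?Q n (va_D ?Q a) b = scale ?Q (- of_int n) (vprod ?Q (n - 1) a b)"
      if "a \<in> carrier ?Q" "b \<in> carrier ?Q" for a b n
      using that by (auto simp: D V3_left pi.scale pi.neg)
    show "vprod ?Q n a (va_D ?Q b) = scale ?Q (of_int n) (vprod ?Q (n - 1) a b) + va_D ?Q (vprod ?Q n a b)"
      if "a \<in> carrier ?Q" "b \<in> carrier ?Q" for a b n
      using that by (auto simp: D V3_right pi.scale pi.add)
    show "\<exists>M. mutually_local ?Q p q M a b" if hab: "a \<in> part ?Q p" "b \<in> part ?Q q" for a b p q
    proof -
      obtain x y where ab: "a = \<pi> x" "b = \<pi> y" and xy: "x \<in> part V p" "y \<in> part V q"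
        using hab unfolding va_image_simps by blast
      note [simp] = xy[THEN part_carrier]
      obtain M where M: "mutually_local V p q M x y"
        using V4[OF xy] by blast
      have sum: "Sum_any (\<lambda>j::nat. scale V (f j) (\<pi> (vprod V (m - int j) u (vprod V (n + int j) w z)))) =
          \<pi> (Sum_any (\<lambda>j. scale V (f j) (vprod V (m - int j) u (vprod V (n + int j) w z))))"
        if u: "u \<in> carrier V" "w \<in> carrier V" "z \<in> carrier V" for u w z m n and f :: "nat \<Rightarrow> 'k"
      proof -
        obtain N where N: "\<And>k. k \<ge> n + int N \<Longrightarrow> vprod V k w z = 0"
          using V1_from[OF u(2,3)] by metis
        show ?thesis
          using u by (simp add: Sum_any_lessThan[of N] N pi.zero pi.sum pi.scale)
      qed
      have "mutually_local ?Q p q M a b"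
        unfolding mutually_local_def
      proof (intro allI ballI)
        fix m n c assume "c \<in> carrier ?Q"
        then obtain z where c: "c = \<pi> z" "z \<in> carrier V" by auto
        show "Sum_any (\<lambda>j::nat. scale ?Q ((-1) ^ j * (of_int M gchoose j))
                   (vprod ?Q (m + M - int j) a (vprod ?Q (n + int j) b c))) =
          scale ?Q (koszul_sign p q * (-1) powi M)
            (Sum_any (\<lambda>j::nat. scale ?Q ((-1) ^ j * (of_int M gchoose j))
                   (vprod ?Q (n + M - int j) b (vprod ?Q (m + int j) a c))))"
          using c arg_cong[OF M[unfolded mutually_local_def, rule_format, OF c(2)], of \<pi>]
          by (simp add: ab sum pi.scale)
      qed
      then show ?thesis by blast
    qed
  qed (auto simp: pi.add pi.scale V2_left V2_right_nonneg pi.zero idem sc.scale_right_distrib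
      sc.scale_left_distrib prod_add_left prod_add_right prod_scale_left prod_scale_right)
qed

end

section \<open>Consequences of the Borcherds identity\<close>

context vertex_algebra
begin

lemma commutator:
  assumes "a \<in> part V p" "b \<in> part V q" "c \<in> carrier V"
  shows "vprod V m a (vprod V n b c) =
    scale V (koszul_sign p q) (vprod V n b (vprod V m a c)) + itersum a b c m n 0"
  using borcherds[OF assms, of m n 0] by (simp add: commsum_def binsum_0 ordered_def algebra_simps)

lemma binsum_minus_one:
  assumes "\<And>p' q'. q' \<ge> q + int N \<Longrightarrow> f p' q' = 0"
  shows "binsum (-1) f p q = (\<Sum>j<N. f (p - 1 - int j) (q + int j))"
proof -
  have "(-1) ^ j * (of_int (-1) gchoose j) = (1 :: 'k)" for j
  proof -
    have "(-1) ^ j * (-1) ^ j = (1 :: 'k)"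
      by (simp flip: power_mult_distrib)
    then show ?thesis
      using gbinomial_minus[of "1 :: 'k" j] binomial_gbinomial[of j j, where 'a = 'k] by simp
  qed
  then show ?thesis
    by (simp add: binsum_lessThan[OF assms] algebra_simps del: of_int_minus)
qed

text \<open>
  The field of \<open>h\<^sub>(\<^sub>-\<^sub>1\<^sub>)b\<close> is the normally ordered product of the fields of \<open>h\<close> and \<open>b\<close>.
\<close>

lemma normally_ordered:
  assumes "h \<in> part V False" "b \<in> part V p" "c \<in> carrier V"
    and "\<And>k. k \<ge> n + int N \<Longrightarrow> vprod V k b c = 0"
    and "\<And>k. k \<ge> int M \<Longrightarrow> vprod V k h c = 0"
  shows "vprod V n (vprod V (-1) h b) c =
    (\<Sum>j<N. vprod V (-1 - int j) h (vprod V (n + int j) b c)) +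
    (\<Sum>j<M. vprod V (n - 1 - int j) b (vprod V (int j) h c))"
proof -
  have [simp]: "h \<in> carrier V" "b \<in> carrier V"
    using assms(1,2) part_carrier by auto
  have "vprod V n (vprod V (-1) h b) c = itersum h b c 0 n (-1)"
    using assms(3) by (simp add: itersum_0)
  also have "\<dots> = commsum (koszul_sign False p) h b c 0 n (-1)"
    using borcherds[OF assms(1-3)] by simp
  also have "\<dots> = binsum (-1) (ordered h b c) 0 n + binsum (-1) (ordered b h c) n 0"
    by (simp add: commsum_def koszul_sign_def)
  also have "binsum (-1) (ordered h b c) 0 n = (\<Sum>j<N. ordered h b c (0 - 1 - int j) (n + int j))"
    by (rule binsum_minus_one) (simp add: ordered_def assms(4))
  also have "binsum (-1) (ordered b h c) n 0 = (\<Sum>j<M. ordered b h c (n - 1 - int j) (0 + int j))"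
    by (rule binsum_minus_one) (simp add: ordered_def assms(5))
  finally show ?thesis
    by (simp add: ordered_def)
qed

text \<open>
  The Borcherds identity with third vector \<open>1\<close> and exponents \<open>p = -1\<close>, \<open>q = 0\<close>, which leave only the
  term \<open>b\<^sub>(\<^sub>r\<^sub>)a\<close> on the left-hand side.
\<close>

lemma skew:
  assumes "a \<in> part V p" "b \<in> part V q"
  shows "vprod V r b a = scale V (- (koszul_sign p q * (-1) powi r)) (itersum a b (vone V) (-1) 0 r)"
proof -
  let ?u = "koszul_sign p q * (-1) powi r :: 'k"
  note [simp] = assms[THEN part_carrier]
  have "?u * ?u = 1"
    by (simp add: koszul_sign_def power_int_minus_left)
  moreover have "binsum r (ordered a b (vone V)) (-1) 0 = 0"
    by (subst binsum_lessThan[where N = 0]) (auto simp: ordered_def V2_right_nonneg)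
  moreover have "binsum r (ordered b a (vone V)) 0 (-1) = vprod V r b a"
    by (subst binsum_lessThan[where N = 1]) (auto simp: ordered_def V2_right_nonneg V2_right_neg)
  ultimately show ?thesis
    using borcherds[OF assms one_carrier, of "-1" 0 r, symmetric]
    by (simp add: commsum_def mult.assoc[symmetric])
qed

lemma even_commutator:
  assumes "h \<in> part V False" "b \<in> part V q" "c \<in> carrier V"
    and "\<And>n. n \<ge> 0 \<Longrightarrow> vprod V n h b = (if n = 0 then scale V \<beta> b else 0)"
  shows "vprod V m h (vprod V n b c) = vprod V n b (vprod V m h c) + scale V \<beta> (vprod V (m + n) b c)"
proof -
  have "itersum h b c m n 0 = scale V \<beta> (vprod V (m + n) b c)"
    using assms by (subst itersum_lessThan[where N = 1]) (simp_all add: part_carrier prod_scale_left)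
  then show ?thesis
    using commutator[OF assms(1-3), of m n] by (simp add: koszul_sign_def)
qed

lemma heisenberg_commutator:
  assumes "h \<in> part V False" "g \<in> part V False" "c \<in> carrier V"
    and "\<And>n. n \<ge> 0 \<Longrightarrow> vprod V n h g = (if n = 1 then scale V \<beta> (vone V) else 0)"
  shows "vprod V m h (vprod V n g c) = vprod V n g (vprod V m h c) +
    (if m = - n then scale V (of_int m * \<beta>) c else 0)"
proof -
  have "itersum h g c m n 0 = (if m = - n then scale V (of_int m * \<beta>) c else 0)"
    using assms by (subst itersum_lessThan[where N = 2])
      (auto simp: part_carrier prod_scale_left numeral_2_eq_2 V2_left)
  then show ?thesis
    using commutator[OF assms(1-3), of m n] by (simp add: koszul_sign_def)
qed

end

section \<open>The Heisenberg fields inside an algebra with the lattice relations\<close>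

lemma Z_basis_induct [consumes 1, case_names zero add neg basis]:
  assumes "Z_basis P"
    and "Q 0" and add: "\<And>x y. Q x \<Longrightarrow> Q y \<Longrightarrow> Q (x + y)" and neg: "\<And>x. Q x \<Longrightarrow> Q (- x)"
    and P: "\<And>e. e \<in> P \<Longrightarrow> Q e"
  shows "Q x"
proof -
  have diff: "Q (x - y)" if "Q x" "Q y" for x y
    using add[of x "- y"] neg[of y] that by simp
  have zmul: "Q (zmul n x)" if "Q x" for n x
    using that
    by (induction n rule: int_induct[where k = 0])
      (simp_all add: zmul_zero zmul_succ zmul_pred assms(2) add diff)
  have "Q x" if "x \<in> zmod.span P"
    using that by (induction rule: zmod.span_induct_alt) (auto intro: assms zmul)
  then show ?thesis
    using assms(1) by (simp add: Z_basis_def)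
qed

lemma lattice_form_neg:
  assumes "lattice_form bil"
  shows "bil (- a) c = - bil a c" "bil c (- a) = - bil c a"
proof -
  have sym: "bil x y = bil y x" and add: "bil (x + y) z = bil x z + bil y z" for x y z
    using assms by (auto simp: lattice_form_def)
  show neg: "bil (- a) c = - bil a c"
    using add[of a "- a" c] add[of 0 0 c] by simp
  show "bil c (- a) = - bil c a"
    using neg sym by metis
qed

locale lattice_relations = vertex_algebra A
  for A :: "('k::field_char_0, 'v::ab_group_add) va" +
  fixes bil :: "'l::ab_group_add \<Rightarrow> 'l \<Rightarrow> int" and P :: "'l set" and u :: "'l \<Rightarrow> 'v"
  assumes form: "lattice_form bil"
    and basis: "Z_basis P"
    and bounded: "locality_bounded (P \<union> uminus ` P) (\<lambda>a b. - bil a b) A u"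
    and relation: "\<And>a. a \<in> P \<Longrightarrow> vprod A (bil a a - 1) (u a) (u (- a)) = vone A"
    and generated: "va_generated A (u ` (P \<union> uminus ` P))"
begin

definition gens :: "'l set" where
  "gens = P \<union> uminus ` P"

lemma bil_sym: "bil a b = bil b a"
  and bil_add: "bil (a + b) c = bil a c + bil b c"
  using form by (auto simp: lattice_form_def)

lemma bil_add_right: "bil c (a + b) = bil c a + bil c b"
  by (metis bil_sym bil_add)

lemma bil_zero [simp]: "bil 0 c = 0" "bil c 0 = 0"
  using bil_add[of 0 0 c] bil_sym[of c 0] by simp_all

lemmas bil_neg [simp] = lattice_form_neg[OF form]

lemma bil_diff_right [simp]: "bil c (a - b) = bil c a - bil c b"
  using bil_add_right[of c a "- b"] by simp

lemma neg_gens [simp]: "a \<in> gens \<Longrightarrow> - a \<in> gens"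
  and basis_gens [simp]: "a \<in> P \<Longrightarrow> a \<in> gens"
  by (auto simp: gens_def)

lemma gens_cases:
  assumes "a \<in> gens"
  obtains "a \<in> P" | e where "e \<in> P" "a = - e"
  using assms by (auto simp: gens_def)

lemma u_part: "a \<in> gens \<Longrightarrow> u a \<in> part A (odd (bil a a))"
  using bounded by (auto simp: locality_bounded_def gens_def)

lemma u_carrier [simp]: "a \<in> gens \<Longrightarrow> u a \<in> carrier A"
  by (rule part_carrier[OF u_part])

lemma u_local: "a \<in> gens \<Longrightarrow> b \<in> gens \<Longrightarrow> n \<ge> - bil a b \<Longrightarrow> vprod A n (u a) (u b) = 0"
  using bounded by (auto simp: locality_bounded_def gens_def)

definition heis :: "'l \<Rightarrow> 'v" where
  "heis a = vprod A (bil a a - 2) (u a) (u (- a))"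

text \<open>
  Skew-symmetry makes the relations symmetric under \<open>a \<mapsto> -a\<close>; together with
  \<open>heis_neg\<close> it puts all \<open>a \<in> \<plusminus>\<Pi>\<close> on the same footing.  The parity \<open>(a|a)\<close> of \<open>u\<^sub>a\<close> makes all
  signs cancel.
\<close>

lemma opposite:
  assumes "a \<in> gens"
  shows "vprod A (bil a a - 1) (u (- a)) (u a) = vprod A (bil a a - 1) (u a) (u (- a))"
    and "vprod A (bil a a - 2) (u (- a)) (u a) =
      va_D A (vprod A (bil a a - 1) (u a) (u (- a))) - vprod A (bil a a - 2) (u a) (u (- a))"
proof -
  let ?s = "koszul_sign (odd (bil a a)) (odd (bil a a)) :: 'k"
  have sk: "vprod A r (u (- a)) (u a) = scale A (- (?s * (-1) powi r)) (itersum (u a) (u (- a)) (vone A) (-1) 0 r)" for r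
    using skew[OF u_part[OF assms] u_part[OF neg_gens[OF assms]], of r] by simp
  have z: "vprod A n (u a) (u (- a)) = 0" if "n \<ge> bil a a" for n
    using that assms by (intro u_local) auto
  have s1: "?s * (-1) powi (bil a a - 1) = -1"
    and s2: "?s * (-1) powi (bil a a - 2) = 1"
    by (auto simp: koszul_sign_def power_int_minus_left)
  have "itersum (u a) (u (- a)) (vone A) (-1) 0 (bil a a - 1) = vprod A (bil a a - 1) (u a) (u (- a))"
    using assms by (subst itersum_lessThan[where N = 1]) (simp_all add: z V2_right_neg)
  then show "vprod A (bil a a - 1) (u (- a)) (u a) = vprod A (bil a a - 1) (u a) (u (- a))"
    by (simp add: sk s1)
  have "itersum (u a) (u (- a)) (vone A) (-1) 0 (bil a a - 2) =
      vprod A (bil a a - 2) (u a) (u (- a)) - va_D A (vprod A (bil a a - 1) (u a) (u (- a)))"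
    using assms by (subst itersum_lessThan[where N = 2]) (simp_all add: z V2_right_neg numeral_2_eq_2)
  then show "vprod A (bil a a - 2) (u (- a)) (u a) =
      va_D A (vprod A (bil a a - 1) (u a) (u (- a))) - vprod A (bil a a - 2) (u a) (u (- a))"
    by (simp add: sk s2)
qed

lemma inverse_relation: "a \<in> gens \<Longrightarrow> vprod A (bil a a - 1) (u a) (u (- a)) = vone A"
  by (erule gens_cases) (use relation opposite(1)[OF basis_gens] in auto)

lemma heis_even: "a \<in> gens \<Longrightarrow> heis a \<in> part A False"
  unfolding heis_def using prod_even[OF u_part u_part, of a "- a"] by simp

lemma heis_neg:
  assumes "a \<in> gens"
  shows "heis (- a) = - heis a"
  using opposite(2)[OF assms] assms by (simp add: heis_def inverse_relation D_one)

text \<open>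
  The exponents \<open>p = -(a|b)\<close> and \<open>q = (a|b) + n\<close> reach the locality bounds of \<open>u\<^sub>a\<close> and
  \<open>u\<^sub>-\<^sub>a\<close> with \<open>u\<^sub>b\<close>, so the commutator side of the Borcherds identity vanishes.  On the
  iterate side \<open>r = (a|a) - 2\<close> leaves just \<open>h\<^sub>a\<close> and the unit.
\<close>

lemma heis_u:
  assumes a: "a \<in> gens" and b: "b \<in> gens" and n: "n \<ge> 0"
  shows "vprod A n (heis a) (u b) = (if n = 0 then scale A (of_int (bil a b)) (u b) else 0)"
proof -
  let ?k = "bil a b" and ?N = "bil a a"
  have a': "- a \<in> gens" using a by simp
  have z: "vprod A m (u a) (u (- a)) = 0" if "m \<ge> ?N" for m
    using that a by (intro u_local) auto
  have "commsum (koszul_sign (odd (bil a a)) (odd (bil (- a) (- a)))) (u a) (u (- a)) (u b) (- ?k) (?k + n) (?N - 2) = 0"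
  proof -
    have "binsum (?N - 2) (ordered (u a) (u (- a)) (u b)) (- ?k) (?k + n) = 0"
      using a b n u_local[OF a' b] by (subst binsum_lessThan[where N = 0]) (simp_all add: ordered_def)
    moreover have "binsum (?N - 2) (ordered (u (- a)) (u a) (u b)) (?k + n) (- ?k) = 0"
      using a' b n u_local[OF a b] by (subst binsum_lessThan[where N = 0]) (simp_all add: ordered_def)
    ultimately show ?thesis by (simp add: commsum_def)
  qed
  moreover have "itersum (u a) (u (- a)) (u b) (- ?k) (?k + n) (?N - 2) =
      vprod A n (heis a) (u b) - scale A (of_int ?k) (vprod A (n - 1) (vone A) (u b))"
    using b inverse_relation[OF a] by (subst itersum_lessThan[where N = 2]) (simp_all add: z numeral_2_eq_2 heis_def)
  ultimately show ?thesis
    using borcherds[OF u_part[OF a] u_part[OF a'] u_carrier[OF b], of "- ?k" "?k + n" "?N - 2"] b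
    by (simp add: V2_left split: if_splits)
qed

text \<open>
  The choice of exponents in \<open>heis_u\<close> for \<open>b = a\<close> and \<open>n = -1\<close>: on the commutator side the single
  term \<open>u\<^sub>a\<^sub>(\<^sub>-\<^sub>2\<^sub>)(u\<^sub>-\<^sub>a\<^sub>(\<^sub>N\<^sub>-\<^sub>1\<^sub>)u\<^sub>a) = u\<^sub>a\<^sub>(\<^sub>-\<^sub>2\<^sub>)1\<close> survives,
  where \<open>N = (a|a)\<close>.
\<close>

lemma D_u:
  assumes a: "a \<in> gens"
  shows "va_D A (u a) = vprod A (-1) (heis a) (u a)"
proof -
  let ?N = "bil a a"
  have a': "- a \<in> gens" using a by simp
  have z: "vprod A m (u a) (u (- a)) = 0" "vprod A m (u (- a)) (u a) = 0" if "m \<ge> ?N" for m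
    using that a by (auto intro!: u_local)
  have "commsum (koszul_sign (odd (bil a a)) (odd (bil (- a) (- a)))) (u a) (u (- a)) (u a) (- ?N) (?N - 1) (?N - 2) = va_D A (u a)"
  proof -
    have "binsum (?N - 2) (ordered (u a) (u (- a)) (u a)) (- ?N) (?N - 1) = va_D A (u a)"
      using a opposite(1)[OF a] inverse_relation[OF a]
      by (subst binsum_lessThan[where N = 1]) (simp_all add: ordered_def z va_D_def)
    moreover have "binsum (?N - 2) (ordered (u (- a)) (u a) (u a)) (?N - 1) (- ?N) = 0"
      using a a' u_local[OF a a] by (subst binsum_lessThan[where N = 0]) (simp_all add: ordered_def)
    ultimately show ?thesis by (simp add: commsum_def)
  qed
  moreover have "itersum (u a) (u (- a)) (u a) (- ?N) (?N - 1) (?N - 2) =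
      vprod A (-1) (heis a) (u a) - scale A (of_int ?N) (vprod A (-2) (vone A) (u a))"
    using a inverse_relation[OF a] by (subst itersum_lessThan[where N = 2]) (simp_all add: z numeral_2_eq_2 heis_def)
  ultimately show ?thesis
    using borcherds[OF u_part[OF a] u_part[OF a'] u_carrier[OF a], of "- ?N" "?N - 1" "?N - 2"] a
    by (simp add: V2_left)
qed

text \<open>
  The additive extension of \<open>heis\<close> from the basis to the lattice.
\<close>

definition H :: "'l \<Rightarrow> 'v" where
  "H x = (\<Sum>e | zmod.representation P x e \<noteq> 0. scale A (of_int (zmod.representation P x e)) (heis e))"

lemma rep_add: "zmod.representation P (x + y) e = zmod.representation P x e + zmod.representation P y e"
  using basis by (simp add: Z_basis_def zmod.representation_add)

lemma rep_neg: "zmod.representation P (- x) e = - zmod.representation P x e"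
  using basis by (simp add: Z_basis_def zmod.representation_neg)

lemma H_superset:
  assumes "finite S" "{e. zmod.representation P x e \<noteq> 0} \<subseteq> S"
  shows "H x = (\<Sum>e\<in>S. scale A (of_int (zmod.representation P x e)) (heis e))"
  unfolding H_def using assms by (intro sum.mono_neutral_left) auto

lemma H_add: "H (x + y) = H x + H y"
proof -
  let ?S = "{e. zmod.representation P x e \<noteq> 0} \<union> {e. zmod.representation P y e \<noteq> 0}"
  have "finite ?S" by (simp add: zmod.finite_representation)
  moreover have "{e. zmod.representation P (x + y) e \<noteq> 0} \<subseteq> ?S" by (auto simp: rep_add)
  ultimately show ?thesis
    by (simp add: H_superset[of ?S] rep_add sc.scale_left_distrib sum.distrib)
qed

lemma H_zero [simp]: "H 0 = 0"
  using H_add[of 0 0] by simp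

lemma H_neg: "H (- x) = - H x"
  using H_add[of x "- x"] by (simp add: eq_neg_iff_add_eq_0 add.commute)

lemma H_basis: "e \<in> P \<Longrightarrow> H e = heis e"
  using basis by (simp add: H_def Z_basis_def zmod.representation_basis)

lemma H_heis: "a \<in> gens \<Longrightarrow> H a = heis a"
  by (erule gens_cases) (auto simp: H_basis H_neg heis_neg)

lemma H_even: "H x \<in> part A False"
  unfolding H_def
  by (intro sc.subspace_sum[OF part_subspace] part_scale heis_even) (auto dest: zmod.representation_ne_zero)

lemma H_carrier [simp]: "H x \<in> carrier A"
  by (rule part_carrier[OF H_even])

lemma H_u:
  assumes "b \<in> gens" "n \<ge> 0"
  shows "vprod A n (H x) (u b) = (if n = 0 then scale A (of_int (bil x b)) (u b) else 0)"
  using basis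
proof (induction x rule: Z_basis_induct)
  case (basis e)
  then show ?case using assms by (simp add: H_basis heis_u)
qed (use assms in \<open>auto simp: H_add H_neg prod_add_left prod_neg_left bil_add sc.scale_left_distrib\<close>)

lemma H_u_commutator:
  assumes "b \<in> gens" "c \<in> carrier A"
  shows "vprod A m (H x) (vprod A n (u b) c) =
    vprod A n (u b) (vprod A m (H x) c) + scale A (of_int (bil x b)) (vprod A (m + n) (u b) c)"
  using assms H_u by (intro even_commutator[OF H_even u_part]) auto

lemma H_heis_product:
  assumes "b \<in> gens" "n \<ge> 0"
  shows "vprod A n (H x) (heis b) = (if n = 1 then scale A (of_int (bil x b)) (vone A) else 0)"
proof -
  have "vprod A n (H x) (heis b) =
      vprod A (bil b b - 2) (u b) (vprod A n (H x) (u (- b))) +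
      scale A (of_int (bil x b)) (vprod A (n + (bil b b - 2)) (u b) (u (- b)))"
    unfolding heis_def using assms(1) by (intro H_u_commutator) auto
  moreover have "vprod A (n + (bil b b - 2)) (u b) (u (- b)) = 0" if "n \<ge> 2"
    using that assms(1) by (intro u_local) auto
  moreover have "n = 0 \<or> n = 1 \<or> n \<ge> 2"
    using assms(2) by linarith
  ultimately show ?thesis
    using assms(1) inverse_relation[OF assms(1)]
    by (auto simp: H_u prod_neg_right prod_scale_right)
qed

lemma H_H:
  assumes "n \<ge> 0"
  shows "vprod A n (H x) (H y) = (if n = 1 then scale A (of_int (bil x y)) (vone A) else 0)"
  using basis
proof (induction y rule: Z_basis_induct)
  case (basis e)
  then show ?case using assms by (simp add: H_basis H_heis_product)
qed (use assms in \<open>auto simp: H_add H_neg prod_add_right prod_neg_right bil_add_right sc.scale_left_distrib\<close>)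

definition act :: "'l \<Rightarrow> int \<Rightarrow> 'v \<Rightarrow> 'v" where
  "act h n x = vprod A n (H h) x"

lemma act_carrier [simp]: "x \<in> carrier A \<Longrightarrow> act h n x \<in> carrier A"
  by (simp add: act_def)

lemma act_heisenberg: "heisenberg_module bil (scale A) act (carrier A)"
proof -
  have "act g m (act h n x) - act h n (act g m x) = (if m = - n then scale A (of_int (m * bil g h)) x else 0)"
    if "x \<in> carrier A" for g h m n x
    using heisenberg_commutator[OF H_even[of g] H_even[of h] that H_H, of m n] by (simp add: act_def)
  then show ?thesis
    by (simp add: heisenberg_module_def act_def carrier_subspace prod_add_right prod_scale_right
        H_add prod_add_left)
qed

section \<open>Highest weight vectors\<close>

text \<open>
  Highest weight vectors of weight \<open>l\<close> with the additional condition \<open>D x = l(-1)x\<close>, which holds for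
  \<open>v\<^sub>l\<close> in the lattice vertex algebra and fixes how translation moves \<open>x\<close>.
\<close>

definition hw :: "'l \<Rightarrow> 'v \<Rightarrow> bool" where
  "hw l x \<longleftrightarrow> x \<in> carrier A \<and> (\<forall>h. \<forall>n>0. act h n x = 0) \<and>
     (\<forall>h. act h 0 x = scale A (of_int (bil h l)) x) \<and> va_D A x = act l (-1) x"

lemma hw_carrier [simp]: "hw l x \<Longrightarrow> x \<in> carrier A"
  by (simp add: hw_def)

lemma hw_one: "hw 0 (vone A)"
  by (simp add: hw_def act_def V2_right_nonneg D_one)

text \<open>
  The coefficients of the differential equation \<open>\<partial>u\<^sub>a(z)x = :h\<^sub>a(z)u\<^sub>a(z):x\<close>.  The annihilating part
  of \<open>h\<^sub>a\<close> only contributes its zero mode \<open>(a|l)\<close>.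
\<close>

lemma u_recursion:
  assumes x: "hw l x" and a: "a \<in> gens"
    and J: "\<And>q. q \<ge> n + int J \<Longrightarrow> vprod A q (u a) x = 0"
  shows "scale A (of_int (- n - bil a l)) (vprod A (n - 1) (u a) x) =
    (\<Sum>j<J. act a (-1 - int j) (vprod A (n + int j) (u a) x))"
proof -
  have hx: "vprod A k (heis a) x = 0" if "k \<ge> int 1" for k
    using x that by (simp add: hw_def act_def flip: H_heis[OF a])
  have "scale A (- of_int n) (vprod A (n - 1) (u a) x) = vprod A n (va_D A (u a)) x"
    using x a by (simp add: V3_left)
  also have "\<dots> = (\<Sum>j<J. vprod A (-1 - int j) (heis a) (vprod A (n + int j) (u a) x)) +
      (\<Sum>j<1. vprod A (n - 1 - int j) (u a) (vprod A (int j) (heis a) x))"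
    unfolding D_u[OF a] using x a J hx by (intro normally_ordered[OF heis_even u_part]) auto
  also have "(\<Sum>j<1. vprod A (n - 1 - int j) (u a) (vprod A (int j) (heis a) x)) =
      scale A (of_int (bil a l)) (vprod A (n - 1) (u a) x)"
    using x a by (simp add: hw_def act_def prod_scale_right flip: H_heis)
  finally show ?thesis
    using a by (simp add: act_def H_heis sc.scale_left_diff_distrib)
qed

text \<open>
  At the top nonvanishing coefficient the right-hand side of the recursion is empty, which determines its
  index.
\<close>

lemma u_vanish:
  assumes x: "hw l x" and a: "a \<in> gens" and n: "n \<ge> - bil a l"
  shows "vprod A n (u a) x = 0"
proof -
  obtain N :: nat where N: "\<And>n. n \<ge> - bil a l + int N \<Longrightarrow> vprod A n (u a) x = 0"
    using V1_from[OF u_carrier[OF a] hw_carrier[OF x]] by metis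
  have "\<forall>n. n \<ge> - bil a l + int (N - k) \<longrightarrow> vprod A n (u a) x = 0" for k
  proof (induction k)
    case 0
    then show ?case using N by simp
  next
    case (Suc k)
    show ?case
    proof (intro allI impI)
      fix n assume n: "- bil a l + int (N - Suc k) \<le> n"
      show "vprod A n (u a) x = 0"
      proof (cases "n \<ge> - bil a l + int (N - k)")
        case False
        have "vprod A q (u a) x = 0" if "q \<ge> n + 1 + int 0" for q
          using Suc that n by auto
        from u_recursion[OF x a, where n = "n + 1" and J = 0, OF this]
        have "scale A (of_int (- (n + 1) - bil a l)) (vprod A n (u a) x) = 0"
          by simp
        moreover have "- (n + 1) - bil a l \<noteq> 0"
          using n by linarith
        ultimately show ?thesis
          by (metis of_int_eq_0_iff sc.scale_eq_0_iff)
      qed (use Suc in simp)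
    qed
  qed
  from this[of N] n show ?thesis by simp
qed

text \<open>
  The leading coefficient of \<open>u\<^sub>a(z)x\<close> for \<open>x\<close> of weight \<open>l\<close>.
\<close>

definition raise :: "'l \<Rightarrow> 'l \<Rightarrow> 'v \<Rightarrow> 'v" where
  "raise a l x = vprod A (- bil a l - 1) (u a) x"

lemma act_u:
  assumes "b \<in> gens" "c \<in> carrier A"
  shows "act h m (vprod A n (u b) c) =
    vprod A n (u b) (act h m c) + scale A (of_int (bil h b)) (vprod A (m + n) (u b) c)"
  using H_u_commutator[OF assms, of m h n] by (simp add: act_def)

lemma act_add_left: "x \<in> carrier A \<Longrightarrow> act (g + h) n x = act g n x + act h n x"
  by (simp add: act_def H_add prod_add_left)

lemma hw_raise:
  assumes x: "hw l x" and a: "a \<in> gens"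
  shows "hw (a + l) (raise a l x)"
  unfolding hw_def
proof (intro conjI allI impI)
  let ?m = "- bil a l - 1"
  note [simp] = hw_carrier[OF x] u_carrier[OF a]
  show "raise a l x \<in> carrier A"
    by (simp add: raise_def)
  show "act h n (raise a l x) = 0" if "0 < n" for h n
    using x that a u_vanish[OF x a, of "n + ?m"] by (simp add: raise_def act_u hw_def)
  show "act h 0 (raise a l x) = scale A (of_int (bil h (a + l))) (raise a l x)" for h
    using x a by (simp add: raise_def act_u hw_def prod_scale_right bil_add_right sc.scale_left_distrib)
  have "vprod A q (u a) x = 0" if "q \<ge> ?m + int 1" for q
    using u_vanish[OF x a, of q] that by simp
  from u_recursion[OF x a, where n = ?m and J = 1, OF this]
  have top: "vprod A (?m - 1) (u a) x = act a (-1) (raise a l x)"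
    by (simp add: raise_def)
  have "va_D A (raise a l x) = vprod A ?m (u a) (va_D A x) - scale A (of_int ?m) (vprod A (?m - 1) (u a) x)"
    using V3_right[of "u a" x ?m] by (simp add: raise_def)
  also have "vprod A ?m (u a) (va_D A x) = vprod A ?m (u a) (act l (-1) x)"
    using x by (simp add: hw_def)
  also have "\<dots> = act l (-1) (raise a l x) - scale A (of_int (bil a l)) (vprod A (?m - 1) (u a) x)"
  proof -
    have "-1 + ?m = ?m - 1"
      by simp
    from act_u[OF a, of x l "-1" ?m, unfolded this] show ?thesis
      by (simp add: raise_def bil_sym[of l a])
  qed
  finally have "va_D A (raise a l x) = act l (-1) (raise a l x) + vprod A (?m - 1) (u a) x"
    by (simp add: sc.scale_left_diff_distrib)
  then show "va_D A (raise a l x) = act (a + l) (-1) (raise a l x)"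
    by (simp only: top act_add_left[OF \<open>raise a l x \<in> carrier A\<close>] add.commute)
qed

lemma u_in_span:
  assumes x: "hw l x" and a: "a \<in> gens"
    and S: "sc.subspace S" "\<And>h n y. y \<in> S \<Longrightarrow> act h n y \<in> S" "raise a l x \<in> S"
  shows "vprod A n (u a) x \<in> S"
proof -
  let ?m = "- bil a l - 1"
  have "vprod A (?m - int k) (u a) x \<in> S" for k
  proof (induction k rule: less_induct)
    case (less k)
    show ?case
    proof (cases "k = 0")
      case True
      then show ?thesis using S(3) by (simp add: raise_def)
    next
      case False
      let ?n = "?m - int k + 1"
      have 0: "vprod A q (u a) x = 0" if "q \<ge> ?n + int k" for q
        using u_vanish[OF x a, of q] that by simp
      have "scale A (of_nat k) (vprod A (?m - int k) (u a) x) =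
          (\<Sum>j<k. act a (-1 - int j) (vprod A (?n + int j) (u a) x))"
      proof -
        have "?n - 1 = ?m - int k" "- ?n - bil a l = int k"
          by auto
        then show ?thesis
          using u_recursion[OF x a, where n = ?n and J = k, OF 0] by (simp only: of_int_of_nat_eq)
      qed
      also have "\<dots> \<in> S"
      proof (intro sc.subspace_sum[OF S(1)] S(2))
        fix j assume "j \<in> {..<k}"
        then have "?n + int j = ?m - int (k - 1 - j)" "k - 1 - j < k"
          by auto
        with less show "vprod A (?n + int j) (u a) x \<in> S"
          by metis
      qed
      finally have "scale A (1 / of_nat k) (scale A (of_nat k) (vprod A (?m - int k) (u a) x)) \<in> S"
        by (rule sc.subspace_scale[OF S(1)])
      with False show ?thesis by simp
    qed
  qed
  note low = this
  show ?thesis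
  proof (cases "n \<ge> - bil a l")
    case True
    then show ?thesis using u_vanish[OF x a] sc.subspace_0[OF S(1)] by simp
  next
    case False
    then have "n = ?m - int (nat (?m - n))" by simp
    then show ?thesis using low by metis
  qed
qed

text \<open>
  At \<open>r = -(a|b)\<close> the iterate side of the Borcherds identity vanishes by locality, and \<open>p\<close>, \<open>q\<close> are
  chosen so that each of the two ordered products contributes its leading coefficient only.
\<close>

lemma raise_swap:
  assumes x: "hw l x" and a: "a \<in> gens" and b: "b \<in> gens"
  shows "raise a (b + l) (raise b l x) = raise b (a + l) (raise a l x) \<or>
    raise a (b + l) (raise b l x) = - raise b (a + l) (raise a l x)"
proof -
  let ?s = "koszul_sign (odd (bil a a)) (odd (bil b b)) :: 'k" and ?r = "- bil a b"
  let ?p = "- bil a l - 1" and ?q = "- bil b l - 1"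
  note [simp] = hw_carrier[OF x] u_carrier[OF a] u_carrier[OF b]
  have "itersum (u a) (u b) x ?p ?q ?r = 0"
    using u_local[OF a b] by (subst itersum_lessThan[where N = 0]) auto
  moreover have "binsum ?r (ordered (u a) (u b) x) ?p ?q = raise a (b + l) (raise b l x)"
    using u_vanish[OF x b] by (subst binsum_lessThan[where N = 1])
      (auto simp: ordered_def raise_def bil_add_right algebra_simps)
  moreover have "binsum ?r (ordered (u b) (u a) x) ?q ?p = raise b (a + l) (raise a l x)"
    using u_vanish[OF x a] by (subst binsum_lessThan[where N = 1])
      (auto simp: ordered_def raise_def bil_add_right bil_sym[of b a] algebra_simps)
  ultimately have "raise a (b + l) (raise b l x) = scale A (?s * (- 1) powi ?r) (raise b (a + l) (raise a l x))"
    using borcherds[OF u_part[OF a] u_part[OF b] hw_carrier[OF x], of ?p ?q ?r]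
    by (simp add: commsum_def)
  then show ?thesis
    by (auto simp: koszul_sign_def power_int_minus_left split: if_splits)
qed

text \<open>
  At \<open>r = (a|a) - 1\<close> the iterate side is the relation \<open>u\<^sub>a\<^sub>(\<^sub>r\<^sub>)u\<^sub>-\<^sub>a = 1\<close> applied to \<open>x\<close>, and
  \<open>p + q = -1\<close> picks the identity operator.  This \<open>p\<close> is beyond the bound of \<open>u_vanish\<close> for \<open>u\<^sub>a\<close>,
  and \<open>q\<close> is the leading index for \<open>u\<^sub>-\<^sub>a\<close>.
\<close>

lemma raise_cancel:
  assumes x: "hw l x" and a: "a \<in> gens"
  shows "raise a (- a + l) (raise (- a) l x) = x"
proof -
  have a': "- a \<in> gens" using a by simp
  let ?r = "bil a a - 1" and ?p = "- bil a l" and ?q = "bil a l - 1"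
  note [simp] = hw_carrier[OF x] u_carrier[OF a] u_carrier[OF a']
  have "itersum (u a) (u (- a)) x ?p ?q ?r = x"
    using u_local[OF a a'] inverse_relation[OF a]
    by (subst itersum_lessThan[where N = 1]) (auto simp: V2_left)
  moreover have "binsum ?r (ordered (u a) (u (- a)) x) ?p ?q = raise a (- a + l) (raise (- a) l x)"
    using u_vanish[OF x a'] by (subst binsum_lessThan[where N = 1])
      (auto simp: ordered_def raise_def bil_add_right algebra_simps)
  moreover have "binsum ?r (ordered (u (- a)) (u a) x) ?q ?p = 0"
    using u_vanish[OF x a] by (subst binsum_lessThan[where N = 0]) (auto simp: ordered_def)
  ultimately show ?thesis
    using borcherds[OF u_part[OF a] u_part[OF a'] hw_carrier[OF x], of ?p ?q ?r]
    by (simp add: commsum_def)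
qed

section \<open>Highest weight vectors of all weights\<close>

primrec tower :: "'l list \<Rightarrow> 'v" where
  "tower [] = vone A"
| "tower (a # ws) = raise a (sum_list ws) (tower ws)"

lemma hw_tower: "set ws \<subseteq> gens \<Longrightarrow> hw (sum_list ws) (tower ws)"
  by (induction ws) (simp_all add: hw_one hw_raise)

definition upto_sign :: "'v \<Rightarrow> 'v \<Rightarrow> bool" where
  "upto_sign x y \<longleftrightarrow> x = y \<or> x = - y"

lemma upto_sign_refl [simp]: "upto_sign x x"
  and upto_sign_trans [trans]: "upto_sign x y \<Longrightarrow> upto_sign y z \<Longrightarrow> upto_sign x z"
  by (auto simp: upto_sign_def)

lemma upto_sign_raise: "upto_sign x y \<Longrightarrow> y \<in> carrier A \<Longrightarrow> a \<in> gens \<Longrightarrow> upto_sign (raise a l x) (raise a l y)"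
  by (auto simp: upto_sign_def raise_def prod_neg_right)

lemma tower_carrier [simp]: "set ws \<subseteq> gens \<Longrightarrow> tower ws \<in> carrier A"
  using hw_tower hw_carrier by blast

lemma tower_append_cong:
  assumes "set us \<subseteq> gens" "set ws \<subseteq> gens" "set zs \<subseteq> gens" "upto_sign (tower ws) (tower zs)" "sum_list ws = sum_list zs"
  shows "upto_sign (tower (us @ ws)) (tower (us @ zs))"
  using assms by (induction us) (auto intro!: upto_sign_raise)

lemma tower_move:
  assumes "set us \<subseteq> gens" "set ws \<subseteq> gens" "b \<in> gens"
  shows "upto_sign (tower (us @ b # ws)) (tower (b # us @ ws))"
  using assms(1)
proof (induction us)
  case (Cons a us)
  have "upto_sign (tower (us @ b # ws)) (tower (b # us @ ws))"
    using Cons by simp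
  moreover have "tower (b # us @ ws) \<in> carrier A" "a \<in> gens"
    using Cons.prems assms by (auto intro!: tower_carrier simp del: tower.simps)
  moreover have "sum_list (us @ b # ws) = sum_list (b # us @ ws)"
    by (simp add: algebra_simps)
  ultimately have "upto_sign (tower ((a # us) @ b # ws)) (raise a (sum_list (b # us @ ws)) (tower (b # us @ ws)))"
    unfolding append_Cons tower.simps(2)[of a "us @ b # ws"] by (metis upto_sign_raise)
  also have "upto_sign \<dots> (tower (b # (a # us) @ ws))"
    using raise_swap[OF hw_tower[of "us @ ws"], of a b] Cons assms by (simp add: upto_sign_def)
  finally show ?case .
qed simp

lemma tower_cancel:
  assumes "set us \<subseteq> gens" "set ws \<subseteq> gens"
  shows "tower (us @ map uminus (rev us) @ ws) = tower ws"
  using assms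
proof (induction us arbitrary: ws)
  case (Cons a us)
  have "tower (us @ map uminus (rev us) @ (- a # ws)) = tower (- a # ws)"
    using Cons by (intro Cons.IH) auto
  moreover have "sum_list (us @ map uminus (rev us) @ (- a # ws)) = - a + sum_list ws"
  proof -
    have "sum_list (map uminus xs) = - sum_list xs" for xs :: "'l list"
      by (induction xs) auto
    then show ?thesis by simp
  qed
  ultimately show ?case
  proof -
    have "(a # us) @ map uminus (rev (a # us)) @ ws = a # (us @ map uminus (rev us) @ (- a # ws))"
      by simp
    moreover have "raise a (- a + sum_list ws) (tower (- a # ws)) = tower ws"
      using Cons.prems raise_cancel[OF hw_tower[of ws], of a] by simp
    ultimately show ?thesis
      using \<open>tower _ = tower (- a # ws)\<close> \<open>sum_list _ = - a + sum_list ws\<close> by (simp only: tower.simps(2))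
  qed
qed simp

text \<open>
  The coordinate of the basis vector \<open>\<plusminus>a\<close> is a functional with value \<open>1\<close> at \<open>a\<close> that is negative at no
  element of \<open>\<plusminus>\<Pi>\<close> except \<open>-a\<close>.
\<close>

lemma sum_zero_cancels:
  assumes "a \<in> gens" "set ws \<subseteq> gens" "a + sum_list ws = 0"
  shows "- a \<in> set ws"
proof (rule ccontr)
  assume no: "- a \<notin> set ws"
  obtain e where e: "e \<in> P" "a = e \<or> a = - e"
    using assms(1) by (auto elim: gens_cases)
  define f where "f x = (if a = e then 1 else -1) * zmod.representation P x e" for x
  have f_add: "f (x + y) = f x + f y" and f_neg: "f (- x) = - f x" for x y
    by (auto simp: f_def rep_add rep_neg)
  have rep: "zmod.representation P e' e = (if e = e' then 1 else 0)" if "e' \<in> P" for e'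
    using basis that by (simp add: Z_basis_def zmod.representation_basis)
  have fa: "f a = 1"
    using e rep by (auto simp: f_def rep_neg)
  have "f b \<ge> 0" if "b \<in> gens" "b \<noteq> - a" for b
    using that(1) by (rule gens_cases) (use e that(2) rep in \<open>auto simp: f_def rep_neg\<close>)
  with assms(2) no have "f (sum_list ws) \<ge> 0"
  proof (induction ws)
    case Nil
    show ?case using f_add[of 0 0] by simp
  next
    case (Cons b ws)
    then show ?case by (simp add: f_add) (metis add_nonneg_nonneg)
  qed
  moreover have "f (a + sum_list ws) = 0"
    using assms(3) f_add[of 0 0] by simp
  ultimately show False
    by (simp add: f_add fa)
qed

lemma tower_zero:
  assumes "set ws \<subseteq> gens" "sum_list ws = 0"
  shows "upto_sign (tower ws) (vone A)"
  using assms
proof (induction ws rule: length_induct)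
  case (1 ws)
  show ?case
  proof (cases ws)
    case (Cons a zs)
    with 1 have "- a \<in> set zs"
      by (intro sum_zero_cancels) auto
    then obtain us vs where zs: "zs = us @ - a # vs"
      by (auto dest: split_list)
    have G: "a \<in> gens" "set us \<subseteq> gens" "set vs \<subseteq> gens"
      using 1 Cons zs by auto
    have "upto_sign (tower ws) (tower ([a] @ - a # us @ vs))"
      using tower_append_cong[of "[a]" zs "- a # us @ vs"] tower_move[of us vs "- a"] G
      by (simp add: Cons zs algebra_simps)
    also have "tower ([a] @ - a # us @ vs) = tower (us @ vs)"
      using tower_cancel[of "[a]" "us @ vs"] G by simp
    also have "upto_sign (tower (us @ vs)) (vone A)"
      using 1 G by (simp add: Cons zs)
    finally show ?thesis .
  qed simp
qed

text \<open>
  Insert \<open>zs\<close> and its reversed negative in front of \<open>ws\<close>: the two cancel, while the negative followed by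
  \<open>ws\<close> has sum zero and can be replaced by the empty word.
\<close>

lemma tower_unique:
  assumes "set ws \<subseteq> gens" "set zs \<subseteq> gens" "sum_list ws = sum_list zs"
  shows "upto_sign (tower ws) (tower zs)"
proof -
  let ?n = "map uminus (rev zs)"
  have neg: "set ?n \<subseteq> gens" "sum_list ?n = - sum_list zs"
  proof -
    show "set ?n \<subseteq> gens" using assms(2) by auto
    show "sum_list ?n = - sum_list zs" by (induction zs) auto
  qed
  have "upto_sign (tower (zs @ ?n @ ws)) (tower (zs @ []))"
  proof (rule tower_append_cong[OF assms(2)])
    show G: "set (?n @ ws) \<subseteq> gens"
      using neg(1) assms(1) by simp
    show sum: "sum_list (?n @ ws) = sum_list []"
      using neg(2) assms(3) by simp
    show "upto_sign (tower (?n @ ws)) (tower [])"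
      using tower_zero[OF G] sum by simp
  qed simp
  then show ?thesis
    using tower_cancel[OF assms(2,1)] by simp
qed

lemma lattice_list: "\<exists>ws. set ws \<subseteq> gens \<and> sum_list ws = l"
  using basis
proof (induction l rule: Z_basis_induct)
  case zero
  then show ?case by (intro exI[of _ "[]"]) simp
next
  case (add x y)
  then obtain ws zs where "set ws \<subseteq> gens" "sum_list ws = x" "set zs \<subseteq> gens" "sum_list zs = y" by blast
  then show ?case by (intro exI[of _ "ws @ zs"]) simp
next
  case (neg x)
  then obtain ws where "set ws \<subseteq> gens" "sum_list ws = x" by blast
  moreover have "sum_list (map uminus ws) = - sum_list ws" for ws :: "'l list"
    by (induction ws) auto
  ultimately show ?case by (intro exI[of _ "map uminus ws"]) auto
next
  case (basis e)
  then show ?case by (intro exI[of _ "[e]"]) simp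
qed

definition weight_vector :: "'l \<Rightarrow> 'v" where
  "weight_vector l = tower (SOME ws. set ws \<subseteq> gens \<and> sum_list ws = l)"

lemma weight_vector_tower:
  obtains ws where "set ws \<subseteq> gens" "sum_list ws = l" "weight_vector l = tower ws"
  using someI_ex[OF lattice_list[of l]] that unfolding weight_vector_def by blast

lemma hw_weight_vector: "hw l (weight_vector l)"
  using hw_tower weight_vector_tower by metis

lemma tower_weight_vector: "set ws \<subseteq> gens \<Longrightarrow> upto_sign (tower ws) (weight_vector (sum_list ws))"
  using tower_unique weight_vector_tower by metis

section \<open>The algebra is spanned by the Heisenberg modules of these vectors\<close>

definition monomials :: "'v set" where
  "monomials = {foldr (\<lambda>(h, n). act h n) ws (weight_vector l) | ws l. True}"

lemma foldr_act_carrier: "x \<in> carrier A \<Longrightarrow> foldr (\<lambda>(h, n). act h n) ws x \<in> carrier A"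
  by (induction ws) auto

lemma subspace_preimage:
  assumes "sc.subspace S" "a \<in> carrier A"
  shows "sc.subspace {y \<in> carrier A. vprod A n a y \<in> S}"
  using assms
  by (auto intro!: sc.subspaceI simp: prod_add_right prod_scale_right sc.subspace_0 sc.subspace_add sc.subspace_scale)

lemma span_monomials_closed:
  assumes "a \<in> carrier A"
    and "\<And>ws l. vprod A n a (foldr (\<lambda>(h, n). act h n) ws (weight_vector l)) \<in> sc.span monomials"
    and "y \<in> sc.span monomials"
  shows "vprod A n a y \<in> sc.span monomials"
proof -
  have "sc.span monomials \<subseteq> {y \<in> carrier A. vprod A n a y \<in> sc.span monomials}"
    using assms(2) by (intro sc.span_minimal subspace_preimage assms(1) sc.subspace_span)
      (auto simp: monomials_def hw_carrier[OF hw_weight_vector] foldr_act_carrier)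
  with assms(3) show ?thesis by blast
qed

lemma monomial_in_span: "foldr (\<lambda>(h, n). act h n) ws (weight_vector l) \<in> sc.span monomials"
  by (rule sc.span_base) (auto simp: monomials_def)

lemma span_act: "y \<in> sc.span monomials \<Longrightarrow> act h n y \<in> sc.span monomials"
  unfolding act_def
proof (rule span_monomials_closed)
  show "vprod A n (H h) (foldr (\<lambda>(h, n). act h n) ws (weight_vector l)) \<in> sc.span monomials" for ws l
    using monomial_in_span[of "(h, n) # ws" l] by (simp add: act_def)
qed auto

lemma tower_in_span:
  assumes "set ws \<subseteq> gens"
  shows "tower ws \<in> sc.span monomials"
  using tower_weight_vector[OF assms] monomial_in_span[of "[]" "sum_list ws"]
  by (auto simp: upto_sign_def sc.span_neg)

lemma span_u:
  assumes b: "b \<in> gens" and y: "y \<in> sc.span monomials"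
  shows "vprod A n (u b) y \<in> sc.span monomials"
proof (rule span_monomials_closed[OF u_carrier[OF b] _ y])
  fix ws l
  have "vprod A n (u b) (foldr (\<lambda>(h, n). act h n) ws (weight_vector l)) \<in> sc.span monomials" for n
  proof (induction ws arbitrary: n)
    case Nil
    obtain zs where zs: "set zs \<subseteq> gens" "sum_list zs = l" "weight_vector l = tower zs"
      by (rule weight_vector_tower)
    have "raise b l (weight_vector l) \<in> sc.span monomials"
      using tower_in_span[of "b # zs"] zs b by simp
    then show ?case
      using u_in_span[OF hw_weight_vector b sc.subspace_span span_act] by simp
  next
    case (Cons w ws)
    obtain h m where w: "w = (h, m)" by (cases w)
    let ?y = "foldr (\<lambda>(h, n). act h n) ws (weight_vector l)"
    have "?y \<in> carrier A"
      by (simp add: foldr_act_carrier hw_carrier[OF hw_weight_vector])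
    then have "vprod A n (u b) (act h m ?y) =
        act h m (vprod A n (u b) ?y) - scale A (of_int (bil h b)) (vprod A (m + n) (u b) ?y)"
      using act_u[OF b] by simp
    then show ?case
      using Cons by (simp add: w span_act sc.span_diff sc.span_scale)
  qed
  then show "vprod A n (u b) (foldr (\<lambda>(h, n). act h n) ws (weight_vector l)) \<in> sc.span monomials" .
qed

lemma binsum_subspace:
  assumes "sc.subspace S" "\<And>p q. f p q \<in> S"
  shows "binsum r f p q \<in> S"
  unfolding binsum_def Sum_any.expand_set
  by (intro sc.subspace_sum[OF assms(1)] sc.subspace_scale[OF assms(1)] assms(2))

text \<open>
  Homogeneous elements are treated separately, since the Borcherds identity is available for these only.
\<close>

definition preserving :: "bool \<Rightarrow> 'v set" where
  "preserving p = {y \<in> part A p. \<forall>n. \<forall>s\<in>sc.span monomials. vprod A n y s \<in> sc.span monomials}"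

lemma span_monomials_carrier: "sc.span monomials \<subseteq> carrier A"
  by (intro sc.span_minimal carrier_subspace)
    (auto simp: monomials_def hw_carrier[OF hw_weight_vector] foldr_act_carrier)

lemma preserving_prod:
  assumes "y \<in> preserving p" "z \<in> preserving q"
  shows "vprod A m y z \<in> preserving (p \<noteq> q)"
proof -
  have yz: "y \<in> part A p" "z \<in> part A q"
    using assms by (auto simp: preserving_def)
  have "vprod A n (vprod A m y z) s \<in> sc.span monomials" if s: "s \<in> sc.span monomials" for n s
  proof -
    have "s \<in> carrier A"
      using s span_monomials_carrier by blast
    then have "vprod A n (vprod A m y z) s = commsum (koszul_sign p q) y z s 0 n m"
      using borcherds[OF yz, of s 0 n m] yz by (simp add: itersum_0 part_carrier)
    also have "\<dots> \<in> sc.span monomials"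
      unfolding commsum_def using assms s
      by (intro sc.span_diff sc.span_scale binsum_subspace sc.subspace_span)
        (auto simp: ordered_def preserving_def)
    finally show ?thesis .
  qed
  then show ?thesis
    using prod_even[OF yz] by (auto simp: preserving_def)
qed

lemma preserving_subspace: "sc.subspace (preserving p)"
proof (rule sc.subspaceI)
  have C: "s \<in> carrier A" if "s \<in> sc.span monomials" for s
    using that span_monomials_carrier by blast
  show "0 \<in> preserving p"
    by (auto simp: preserving_def sc.span_zero C)
  show "x + y \<in> preserving p" if "x \<in> preserving p" "y \<in> preserving p" for x y
    using that by (auto simp: preserving_def part_add prod_add_left part_carrier C sc.span_add)
  show "scale A c x \<in> preserving p" if "x \<in> preserving p" for c x
    using that by (auto simp: preserving_def part_scale prod_scale_left part_carrier C sc.span_scale)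
qed

text \<open>
  The sums of homogeneous elements whose modes preserve the span form a subalgebra, by the iterate formula.
  It contains the generators, so it is everything; applying the modes to the vacuum finishes the proof.
\<close>

theorem span_monomials: "sc.span monomials = carrier A"
proof
  define T where "T = {y + z | y z. y \<in> preserving False \<and> z \<in> preserving True}"
  have TI: "y + z \<in> T" if "y \<in> preserving False" "z \<in> preserving True" for y z
    using that by (auto simp: T_def)
  have pres_C: "y \<in> carrier A" if "y \<in> preserving p" for y p
    using that by (auto simp: preserving_def part_carrier)
  note add = sc.subspace_add[OF preserving_subspace]
  have zero: "0 \<in> preserving p" for p
    by (rule sc.subspace_0[OF preserving_subspace])
  have "T = carrier A"
  proof -
    have "T \<subseteq> carrier A"
      by (auto simp: T_def pres_C)
    moreover have "sc.subspace T"
      unfolding T_def by (intro sc.subspace_sums preserving_subspace)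
    moreover have "preserving p \<subseteq> T" for p
      using TI[of _ 0] TI[of 0] zero by (cases p) auto
    moreover have "u ` (P \<union> uminus ` P) \<subseteq> T"
    proof -
      have "u b \<in> preserving (odd (bil b b))" if "b \<in> gens" for b
        using that by (simp add: preserving_def u_part span_u)
      then show ?thesis
        using \<open>\<And>p. preserving p \<subseteq> T\<close> unfolding gens_def[symmetric] by blast
    qed
    moreover have "vone A \<in> T"
    proof -
      have "s \<in> carrier A" if "s \<in> sc.span monomials" for s
        using that span_monomials_carrier by blast
      then have "vone A \<in> preserving False"
        using one_even by (simp add: preserving_def V2_left sc.span_zero)
      then show ?thesis
        using \<open>\<And>p. preserving p \<subseteq> T\<close> by blast
    qed
    moreover have "\<forall>n. \<forall>x\<in>T. \<forall>y\<in>T. vprod A n x y \<in> T"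
    proof (intro allI ballI)
      fix n x y assume x: "x \<in> T" and y: "y \<in> T"
      obtain x0 x1 where x: "x = x0 + x1" "x0 \<in> preserving False" "x1 \<in> preserving True"
        using x by (auto simp: T_def)
      obtain y0 y1 where y: "y = y0 + y1" "y0 \<in> preserving False" "y1 \<in> preserving True"
        using y by (auto simp: T_def)
      have "vprod A n x y = (vprod A n x0 y0 + vprod A n x1 y1) + (vprod A n x0 y1 + vprod A n x1 y0)"
        using x y by (simp add: pres_C prod_add_left prod_add_right)
      moreover have "vprod A n x0 y0 + vprod A n x1 y1 \<in> preserving False"
          "vprod A n x0 y1 + vprod A n x1 y0 \<in> preserving True"
        using preserving_prod[OF x(2) y(2), of n] preserving_prod[OF x(3) y(3), of n]
          preserving_prod[OF x(2) y(3), of n] preserving_prod[OF x(3) y(2), of n] add by simp_all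
      ultimately show "vprod A n x y \<in> T"
        using TI by simp
    qed
    ultimately show ?thesis
      using generated unfolding va_generated_def by blast
  qed
  show "carrier A \<subseteq> sc.span monomials"
  proof
    fix x assume "x \<in> carrier A"
    then obtain y z where x: "x = y + z" "y \<in> preserving False" "z \<in> preserving True"
      using \<open>T = carrier A\<close>[symmetric] unfolding T_def by blast
    have "vone A \<in> sc.span monomials"
      using tower_in_span[of "[]"] by simp
    then have "vprod A (-1) y (vone A) \<in> sc.span monomials" "vprod A (-1) z (vone A) \<in> sc.span monomials"
      using x by (auto simp: preserving_def)
    then show "x \<in> sc.span monomials"
      using x by (simp add: V2_right_neg pres_C sc.span_add)
  qed
qed (rule span_monomials_carrier)

end

section \<open>Verma relations hold for every highest weight vector\<close>

context vector_space
begin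

lemma span_Union_Sum_any:
  assumes N: "\<And>l. subspace (N l)" and x: "x \<in> span (\<Union>l. N l)"
  shows "\<exists>y. finite {l. y l \<noteq> 0} \<and> (\<forall>l. y l \<in> N l) \<and> x = Sum_any y"
  using x
proof (induction rule: span_induct_alt)
  case base
  show ?case
    by (rule exI[of _ "\<lambda>l. 0"]) (auto intro: subspace_0 N)
next
  case (step c x z)
  obtain l0 where l0: "x \<in> N l0"
    using step by auto
  obtain y where y: "finite {l. y l \<noteq> 0}" "\<And>l. y l \<in> N l" "z = Sum_any y"
    using step by auto
  let ?d = "\<lambda>l. if l = l0 then scale c x else 0"
  have fin: "finite {l. ?d l \<noteq> 0}"
    by (rule finite_subset[of _ "{l0}"]) auto
  show ?case
  proof (intro exI[of _ "\<lambda>l. ?d l + y l"] conjI allI)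
    show "finite {l. ?d l + y l \<noteq> 0}"
      by (rule finite_subset[OF _ finite_UnI[OF fin y(1)]]) auto
    show "?d l + y l \<in> N l" for l
      using l0 by (intro subspace_add[OF N] y(2)) (auto intro: subspace_scale N subspace_0)
    show "scale c x + z = (Sum_any (\<lambda>l. ?d l + y l))"
      using Sum_any.distrib[OF fin y(1)] y(3) by simp
  qed
qed

end

context vertex_algebra
begin

lemma eval_words_superset:
  assumes "finite S" "Poly_Mapping.keys w \<subseteq> S"
  shows "eval_words (scale V) act v w =
    (\<Sum>ws\<in>S. scale V (Poly_Mapping.lookup w ws) (foldr (\<lambda>(h, n). act h n) ws v))"
  unfolding eval_words_def using assms by (intro sum.mono_neutral_left) (auto simp: in_keys_iff)

lemma eval_words_lin:
  "eval_words (scale V) act v (wscale c w + w') = scale V c (eval_words (scale V) act v w) + eval_words (scale V) act v w'"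
proof -
  let ?S = "Poly_Mapping.keys w \<union> Poly_Mapping.keys w' \<union> Poly_Mapping.keys (wscale c w + w')"
  have fin: "finite ?S" by simp
  have sub: "Poly_Mapping.keys w \<subseteq> ?S" "Poly_Mapping.keys w' \<subseteq> ?S"
      "Poly_Mapping.keys (wscale c w + w') \<subseteq> ?S"
    by blast+
  show ?thesis
    unfolding sub[THEN eval_words_superset[OF fin]]
    by (simp add: lookup_add lookup_wscale sc.scale_left_distrib sum.distrib sc.scale_sum_right)
qed

lemma eval_words_zero [simp]: "eval_words (scale V) act v 0 = 0"
  by (simp add: eval_words_def)

lemma eval_words_scale: "eval_words (scale V) act v (wscale c w) = scale V c (eval_words (scale V) act v w)"
  using eval_words_lin[of act v c w 0] by simp

lemma eval_words_add: "eval_words (scale V) act v (w + w') = eval_words (scale V) act v w + eval_words (scale V) act v w'"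
  using eval_words_lin[of act v 1 w w'] by (simp add: words.scale_one)

lemma eval_words_diff: "eval_words (scale V) act v (w - w') = eval_words (scale V) act v w - eval_words (scale V) act v w'"
  using eval_words_add[of act v "w - w'" w'] by simp

lemma eval_words_word: "eval_words (scale V) act v (word ws) = foldr (\<lambda>(h, n). act h n) ws v"
  by (simp add: eval_words_def)

lemma range_eval_words_subspace: "sc.subspace (range (eval_words (scale V) act v))"
proof (rule sc.subspaceI)
  show "0 \<in> range (eval_words (scale V) act v)"
    by (metis eval_words_zero rangeI)
  show "x + y \<in> range (eval_words (scale V) act v)"
    if "x \<in> range (eval_words (scale V) act v)" "y \<in> range (eval_words (scale V) act v)" for x y
    using that by (auto simp flip: eval_words_add)
  show "scale V c x \<in> range (eval_words (scale V) act v)" if "x \<in> range (eval_words (scale V) act v)" for c x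
    using that by (auto simp flip: eval_words_scale)
qed

theorem verma_relations_annihilate:
  assumes M: "heisenberg_module bil (scale V) act M" and v: "v \<in> M"
    and pos: "\<And>h n. n > 0 \<Longrightarrow> act h n v = 0"
    and weight: "\<And>h. act h 0 v = scale V (of_int (bil h a)) v"
    and w: "w \<in> verma_relations bil a"
  shows "eval_words (scale V) act v w = 0"
proof -
  let ?E = "\<lambda>ws x. foldr (\<lambda>(h, n). act h n) ws x"
  have sub: "sc.subspace M"
    and cl: "\<And>h n x. x \<in> M \<Longrightarrow> act h n x \<in> M"
    and add: "\<And>h n x y. x \<in> M \<Longrightarrow> y \<in> M \<Longrightarrow> act h n (x + y) = act h n x + act h n y"
    and sc: "\<And>h n r x. x \<in> M \<Longrightarrow> act h n (scale V r x) = scale V r (act h n x)"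
    and left: "\<And>g h n x. x \<in> M \<Longrightarrow> act (g + h) n x = act g n x + act h n x"
    and comm: "\<And>g h m n x. x \<in> M \<Longrightarrow> act g m (act h n x) - act h n (act g m x) =
        (if m = -n then scale V (of_int (m * bil g h)) x else 0)"
    using M unfolding heisenberg_module_def by blast+
  have E: "?E ws x \<in> M" if "x \<in> M" for ws x
    using that by (induction ws) (auto intro: cl)
  have E_add: "?E ws (x + y) = ?E ws x + ?E ws y" if "x \<in> M" "y \<in> M" for ws x y
    using that by (induction ws) (auto simp: add E)
  have E_sc: "?E ws (scale V r x) = scale V r (?E ws x)" if "x \<in> M" for ws r x
    using that by (induction ws) (auto simp: sc E)
  have E0: "?E ws 0 = 0" for ws
    using E_sc[of 0 ws 0] sc.subspace_0[OF sub] by simp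
  have comm': "act g m (act h n x) = act h n (act g m x) +
      scale V (if m = -n then of_int (m * bil g h) else 0) x" if "x \<in> M" for g h m n x
    using comm[OF that, of g m h n] by (simp add: algebra_simps split: if_splits)
  show ?thesis
    using w unfolding verma_relations_def
  proof (induction rule: words.span_induct_alt)
    case (step c x y)
    have "eval_words (scale V) act v x = 0"
      using step(1)
    proof (elim UnE)
      assume "x \<in> {word (us @ (g + h, n) # ws) - word (us @ (g, n) # ws) - word (us @ (h, n) # ws) | us g h n ws. True}"
      then obtain us g h n ws where x: "x = word (us @ (g + h, n) # ws) - word (us @ (g, n) # ws) - word (us @ (h, n) # ws)"
        by blast
      show ?thesis
        using v by (simp add: x eval_words_diff eval_words_word E left E_add cl)
    next
      assume "x \<in> {word (us @ (g, m) # (h, n) # ws) - word (us @ (h, n) # (g, m) # ws)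
         - wscale (if m = -n then of_int (m * bil g h) else 0) (word (us @ ws)) | us g m h n ws. True}"
      then obtain us g m h n ws where x: "x = word (us @ (g, m) # (h, n) # ws) - word (us @ (h, n) # (g, m) # ws)
         - wscale (if m = -n then of_int (m * bil g h) else 0) (word (us @ ws))"
        by blast
      have "?E us (act g m (act h n (?E ws v))) = ?E us (act h n (act g m (?E ws v))) +
          scale V (if m = -n then of_int (m * bil g h) else 0) (?E us (?E ws v))"
      proof -
        let ?y = "?E ws v"
        have y: "?y \<in> M" by (rule E[OF v])
        have "?E us (act g m (act h n ?y)) =
            ?E us (act h n (act g m ?y) + scale V (if m = -n then of_int (m * bil g h) else 0) ?y)"
          by (rule arg_cong[OF comm'[OF y]])
        also have "\<dots> = ?E us (act h n (act g m ?y)) +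
            ?E us (scale V (if m = -n then of_int (m * bil g h) else 0) ?y)"
          by (intro E_add cl y sc.subspace_scale[OF sub])
        finally show ?thesis
          by (simp only: E_sc[OF y])
      qed
      then show ?thesis
        by (simp only: x eval_words_diff eval_words_word eval_words_scale foldr_append) simp
    next
      assume "x \<in> {word (us @ [(h, n)]) | us h n. n > 0}"
      then show ?thesis
        by (auto simp: eval_words_word pos E0)
    next
      assume "x \<in> {word (us @ [(h, 0)]) - wscale (of_int (bil h a)) (word us) | us h. True}"
      then show ?thesis
        using v by (auto simp: eval_words_diff eval_words_word eval_words_scale weight E_sc)
    qed
    with step show ?case
      by (simp add: eval_words_lin)
  qed simp
qed

end

section \<open>Comparison with the lattice vertex algebra\<close>

lemma cocycle_neg:
  assumes "lattice_cocycle bil \<epsilon>" "\<epsilon> a a = 1"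
  shows "\<epsilon> a (- a) = 1"
proof -
  have "\<epsilon> a (0 + 0) = \<epsilon> a 0 * \<epsilon> a 0" "\<epsilon> a 0 \<in> {1, -1}" "\<epsilon> a (a + - a) = \<epsilon> a a * \<epsilon> a (- a)"
    using assms(1) unfolding lattice_cocycle_def by blast+
  then show ?thesis
    using assms(2) by auto
qed

locale lattice_comparison = lattice_relations A bil P u
  for A :: "('k::field_char_0, 'v::ab_group_add) va" and bil :: "'l::ab_group_add \<Rightarrow> 'l \<Rightarrow> int"
    and P u +
  fixes \<epsilon> :: "'l \<Rightarrow> 'l \<Rightarrow> 'k" and V :: "('k, 'w::ab_group_add) va" and actV v \<pi>
  assumes cocycle: "lattice_cocycle bil \<epsilon>"
    and cocycle_basis: "\<And>a. a \<in> P \<Longrightarrow> \<epsilon> a a = 1"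
    and latticeVA: "lattice_vertex_algebra bil \<epsilon> actV v V"
    and hom: "va_hom A V \<pi>"
    and hom_u: "\<And>b. b \<in> P \<union> uminus ` P \<Longrightarrow> \<pi> (u b) = v b"
begin

sublocale B: vertex_algebra V
  using latticeVA by (simp add: lattice_vertex_algebra_def)

lemma hom_carrier [simp]: "x \<in> carrier A \<Longrightarrow> \<pi> x \<in> carrier V"
  and hom_add: "x \<in> carrier A \<Longrightarrow> y \<in> carrier A \<Longrightarrow> \<pi> (x + y) = \<pi> x + \<pi> y"
  and hom_scale: "x \<in> carrier A \<Longrightarrow> \<pi> (scale A r x) = scale V r (\<pi> x)"
  and hom_one: "\<pi> (vone A) = vone V"
  and hom_prod: "x \<in> carrier A \<Longrightarrow> y \<in> carrier A \<Longrightarrow> \<pi> (vprod A n x y) = vprod V n (\<pi> x) (\<pi> y)"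
  using hom by (auto simp: va_hom_def)

lemma hom_zero [simp]: "\<pi> 0 = 0"
  using hom_add[of 0 0] by simp

lemma hom_neg: "x \<in> carrier A \<Longrightarrow> \<pi> (- x) = - \<pi> x"
  using hom_scale[of x "-1"] by simp

lemma hom_sum: "(\<And>j. j \<in> J \<Longrightarrow> f j \<in> carrier A) \<Longrightarrow> \<pi> (sum f J) = (\<Sum>j\<in>J. \<pi> (f j))"
  by (induction J rule: infinite_finite_induct) (auto simp: hom_add carrier_sum)

lemma V_one: "vone V = v 0"
  and V_act: "x \<in> carrier V \<Longrightarrow> vprod V n (actV h (-1) (v 0)) x = actV h n x"
  and V_top: "vprod V (- bil a b - int k - 1) (v a) (v b) =
        scale V (\<epsilon> a b * (1 / fact k)) (((\<lambda>x. va_D V x - actV b (-1) x) ^^ k) (v (a + b)))"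
  using latticeVA by (auto simp: lattice_vertex_algebra_def)

lemma V_actadd: "x \<in> carrier V \<Longrightarrow> actV (g + h) n x = actV g n x + actV h n x"
  using latticeVA by (auto simp: lattice_vertex_algebra_def heisenberg_module_def)

lemma V_actneg: "x \<in> carrier V \<Longrightarrow> actV (- h) n x = - actV h n x"
  using V_actadd[of x h "- h" n] V_actadd[of x 0 0 n] by (simp add: add_eq_0_iff)

lemma v_zero_carrier [simp]: "v 0 \<in> carrier V"
  using B.one_carrier by (simp add: V_one)

text \<open>
  The case \<open>k = 1\<close> of the product formula in the lattice vertex algebra gives
  \<open>\<epsilon>(e,-e)(D + e(-1))v\<^sub>0 = e(-1)v\<^sub>0\<close> for \<open>e \<in> \<Pi>\<close>.
\<close>

lemma hom_H: "\<pi> (H h) = actV h (-1) (v 0)"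
  using basis
proof (induction h rule: Z_basis_induct)
  case zero
  then show ?case using V_actadd[of "v 0" 0 0 "-1"] by simp
next
  case (basis e)
  have "\<pi> (heis e) = vprod V (- bil e (- e) - int 1 - 1) (v e) (v (- e))"
    using basis by (simp add: heis_def hom_prod hom_u)
  also have "\<dots> = va_D V (v 0) - actV (- e) (-1) (v 0)"
    unfolding V_top using basis by (simp add: cocycle_neg[OF cocycle cocycle_basis])
  also have "\<dots> = actV e (-1) (v 0)"
    using B.D_one by (simp add: V_one V_actneg)
  finally show ?case
    using basis by (simp add: H_basis)
qed (simp_all add: H_add H_neg hom_add hom_neg V_actadd V_actneg)

lemma hom_act: "x \<in> carrier A \<Longrightarrow> \<pi> (act h n x) = actV h n (\<pi> x)"
  by (simp add: act_def hom_prod hom_H V_act)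

lemma hom_foldr_act:
  "x \<in> carrier A \<Longrightarrow> \<pi> (foldr (\<lambda>(h, n). act h n) ws x) = foldr (\<lambda>(h, n). actV h n) ws (\<pi> x)"
  by (induction ws) (auto simp: hom_act foldr_act_carrier)

text \<open>
  The leading coefficient of \<open>v\<^sub>a(z)v\<^sub>l\<close> is \<open>\<epsilon>(a,l)v\<^sub>a\<^sub>+\<^sub>l\<close>, so each letter costs at most a
  sign.
\<close>

lemma hom_tower:
  assumes "set ws \<subseteq> gens"
  shows "\<exists>c\<in>{1, -1}. \<pi> (tower ws) = scale V c (v (sum_list ws))"
  using assms
proof (induction ws)
  case Nil
  then show ?case by (auto simp: hom_one V_one)
next
  case (Cons a ws)
  let ?l = "sum_list ws"
  have "set ws \<subseteq> gens"
    using Cons.prems by simp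
  from Cons.IH[OF this] obtain c where c: "c \<in> {1, -1}" "\<pi> (tower ws) = scale V c (v ?l)"
    by blast
  have ws: "tower ws \<in> carrier A" "a \<in> gens"
    using Cons.prems by auto
  have "v ?l = scale V c (\<pi> (tower ws))"
    using c by auto
  then have vl: "v ?l \<in> carrier V"
    using ws by simp
  have va: "\<pi> (u a) = v a" "v a \<in> carrier V"
    using ws hom_u[of a] hom_carrier[of "u a"] by (auto simp flip: gens_def)
  have "\<pi> (tower (a # ws)) = vprod V (- bil a ?l - int 0 - 1) (v a) (scale V c (v ?l))"
    using ws by (simp add: raise_def hom_prod va c)
  also have "\<dots> = scale V (c * \<epsilon> a ?l) (v (a + ?l))"
    using va vl V_top[of a ?l 0] by (simp add: B.prod_scale_right)
  finally have "\<pi> (tower (a # ws)) = scale V (c * \<epsilon> a ?l) (v (sum_list (a # ws)))"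
    by simp
  moreover have "\<epsilon> a ?l \<in> {1, -1}"
    using cocycle unfolding lattice_cocycle_def by blast
  ultimately show ?case
    using c(1) by fastforce
qed

lemma hom_weight_vector: "\<exists>c. c \<noteq> 0 \<and> \<pi> (weight_vector l) = scale V c (v l)"
proof -
  obtain ws where ws: "set ws \<subseteq> gens" "sum_list ws = l" "weight_vector l = tower ws"
    by (rule weight_vector_tower)
  obtain c where c: "c \<in> {1, -1}" "\<pi> (tower ws) = scale V c (v (sum_list ws))"
    using hom_tower[OF ws(1)] by blast
  have "c \<noteq> 0"
    using c(1) by auto
  with ws c(2) show ?thesis
    by auto
qed

definition coeff :: "'l \<Rightarrow> 'k" where
  "coeff l = (SOME c. c \<noteq> 0 \<and> \<pi> (weight_vector l) = scale V c (v l))"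

lemma coeff: "coeff l \<noteq> 0" "\<pi> (weight_vector l) = scale V (coeff l) (v l)"
  using someI_ex[OF hom_weight_vector[of l]] by (auto simp: coeff_def)

lemma v_carrier [simp]: "v l \<in> carrier V"
proof -
  have "v l = scale V (1 / coeff l) (\<pi> (weight_vector l))"
    using coeff by simp
  then show ?thesis
    using hw_carrier[OF hw_weight_vector] by simp
qed

lemma foldr_actV_scale:
  "x \<in> carrier V \<Longrightarrow> foldr (\<lambda>(h, n). actV h n) ws (scale V c x) = scale V c (foldr (\<lambda>(h, n). actV h n) ws x)
    \<and> foldr (\<lambda>(h, n). actV h n) ws x \<in> carrier V"
  using latticeVA by (induction ws) (auto simp: lattice_vertex_algebra_def heisenberg_module_def)

lemma hom_eval:
  "\<pi> (eval_words (scale A) act (weight_vector l) w) = scale V (coeff l) (eval_words (scale V) actV (v l) w)"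
proof -
  have [simp]: "weight_vector l \<in> carrier A"
    by (rule hw_carrier[OF hw_weight_vector])
  show ?thesis
    by (simp add: eval_words_def hom_sum hom_scale hom_foldr_act foldr_act_carrier coeff(2)
        foldr_actV_scale B.sc.scale_sum_right mult.commute)
qed

lemma eval_carrier: "eval_words (scale A) act (weight_vector l) w \<in> carrier A"
  by (simp add: eval_words_def carrier_sum foldr_act_carrier hw_carrier[OF hw_weight_vector])

theorem hom_surj: "\<pi> ` carrier A = carrier V"
proof
  obtain M where M: "\<And>a. verma_module bil (scale V) actV a (v a) (M a)"
      "internal_direct_sum (scale V) M (carrier V)"
    using latticeVA by (auto simp: lattice_vertex_algebra_def)
  have "B.sc.subspace (\<pi> ` carrier A)"
  proof (rule B.sc.subspaceI)
    show "0 \<in> \<pi> ` carrier A" by (metis carrier_zero hom_zero image_eqI)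
    show "x + y \<in> \<pi> ` carrier A" if "x \<in> \<pi> ` carrier A" "y \<in> \<pi> ` carrier A" for x y
      using that by (auto simp flip: hom_add)
    show "scale V c x \<in> \<pi> ` carrier A" if "x \<in> \<pi> ` carrier A" for c x
      using that by (auto simp flip: hom_scale)
  qed
  moreover have "(\<Union>a. M a) \<subseteq> \<pi> ` carrier A"
  proof
    fix y assume "y \<in> (\<Union>a. M a)"
    then obtain l where "y \<in> M l" by blast
    then obtain w where "y = eval_words (scale V) actV (v l) w"
      using M(1)[of l] by (auto simp: verma_module_def)
    then have "y = \<pi> (scale A (1 / coeff l) (eval_words (scale A) act (weight_vector l) w))"
      using coeff(1)[of l] by (simp add: hom_scale eval_carrier hom_eval)
    then show "y \<in> \<pi> ` carrier A"
      using eval_carrier by auto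
  qed
  ultimately have "B.sc.span (\<Union>a. M a) \<subseteq> \<pi> ` carrier A"
    by (rule B.sc.span_minimal[rotated])
  then show "carrier V \<subseteq> \<pi> ` carrier A"
    using M(2) by (simp add: internal_direct_sum_def)
qed auto

text \<open>
  An element of the kernel is a finite sum of elements \<open>w\<^sub>l x\<^sub>l\<close>, with \<open>w\<^sub>l\<close> a combination of Heisenberg
  words.  Directness of the sum of the Verma modules gives \<open>w\<^sub>l v\<^sub>l = 0\<close> for each \<open>l\<close>, so \<open>w\<^sub>l\<close> is a
  consequence of the Verma relations, all of which also hold for \<open>x\<^sub>l\<close>.
\<close>

theorem hom_inj:
  assumes x: "x \<in> carrier A" "\<pi> x = 0"
  shows "x = 0"
proof -
  obtain M where M: "\<And>a. verma_module bil (scale V) actV a (v a) (M a)"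
      "internal_direct_sum (scale V) M (carrier V)"
    using latticeVA by (auto simp: lattice_vertex_algebra_def)
  let ?N = "\<lambda>l. range (eval_words (scale A) act (weight_vector l))"
  have "foldr (\<lambda>(h, n). act h n) ws (weight_vector l) \<in> ?N l" for ws l
    unfolding eval_words_word[of act, symmetric] by (rule rangeI)
  then have "monomials \<subseteq> (\<Union>l. ?N l)"
    by (auto simp: monomials_def)
  from sc.span_mono[OF this] have "x \<in> sc.span (\<Union>l. ?N l)"
    using x(1) unfolding span_monomials by (rule subsetD)
  then obtain y where y: "finite {l. y l \<noteq> 0}" "\<And>l. y l \<in> ?N l" "x = Sum_any y"
    using sc.span_Union_Sum_any[of ?N x, OF range_eval_words_subspace] by blast
  have yC: "y l \<in> carrier A" for l
    using y(2)[of l] eval_carrier by auto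
  have "\<exists>w. y l = eval_words (scale A) act (weight_vector l) w" for l
    using y(2)[of l] by auto
  then obtain w where w: "\<And>l. y l = eval_words (scale A) act (weight_vector l) (w l)"
    by metis
  let ?S = "{l. y l \<noteq> 0}"
  have "sum (\<lambda>l. \<pi> (y l)) ?S = 0"
    using x(2) yC by (simp add: y(3) Sum_any.expand_set hom_sum)
  moreover have "\<pi> (y l) \<in> M l" for l
  proof -
    have "eval_words (scale V) actV (v l) (w l) \<in> M l" "B.sc.subspace (M l)"
      using M(1)[of l] by (auto simp: verma_module_def heisenberg_module_def)
    then show ?thesis
      by (simp add: w hom_eval B.sc.subspace_scale)
  qed
  moreover have "\<forall>a\<in>S. z a = 0" if "finite S" "\<forall>a\<in>S. z a \<in> M a" "sum z S = 0" for S z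
    using M(2) that by (simp add: internal_direct_sum_def)
  note independent = this[OF y(1), of "\<lambda>l. \<pi> (y l)"]
  ultimately have "\<forall>l\<in>?S. \<pi> (y l) = 0"
    by (intro independent ballI)
  moreover have "y l = 0" if "\<pi> (y l) = 0" for l
  proof -
    have "eval_words (scale V) actV (v l) (w l) = 0"
      using that coeff(1)[of l] by (simp add: w hom_eval)
    then have "w l \<in> verma_relations bil l"
      using M(1)[of l] by (simp add: verma_module_def)
    then show ?thesis
      unfolding w using hw_weight_vector[of l]
      by (intro verma_relations_annihilate[OF act_heisenberg]) (auto simp: hw_def)
  qed
  ultimately have "?S = {}"
    by blast
  then show ?thesis
    by (simp add: y(3) Sum_any.expand_set)
qed

end

lemma va_generated_image:
  assumes F: "vertex_algebra F" and gen: "va_generated F X"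
    and lin: "Vector_Spaces.linear (scale F) (scale F) \<pi>" and hom: "va_hom F (va_image F \<pi>) \<pi>"
  shows "va_generated (va_image F \<pi>) (\<pi> ` X)"
  unfolding va_generated_def
proof (intro conjI allI impI)
  interpret vertex_algebra F by (rule F)
  interpret pi: Vector_Spaces.linear "scale F" "scale F" \<pi> by (rule lin)
  have X: "X \<subseteq> carrier F"
    using gen by (simp add: va_generated_def)
  then show "\<pi> ` X \<subseteq> carrier (va_image F \<pi>)"
    by auto
  fix S assume S: "S \<subseteq> carrier (va_image F \<pi>) \<and> module.subspace (scale (va_image F \<pi>)) S \<and>
      \<pi> ` X \<subseteq> S \<and> vone (va_image F \<pi>) \<in> S \<and>
      (\<forall>n. \<forall>x\<in>S. \<forall>y\<in>S. vprod (va_image F \<pi>) n x y \<in> S)"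
  let ?T = "{x \<in> carrier F. \<pi> x \<in> S}"
  have sub: "sc.subspace S"
    using S by simp
  have "sc.subspace ?T"
    by (rule sc.subspaceI)
      (auto simp: pi.zero pi.add pi.scale sc.subspace_0[OF sub] sc.subspace_add[OF sub] sc.subspace_scale[OF sub])
  moreover have "vprod F n x y \<in> ?T" if "x \<in> ?T" "y \<in> ?T" for n x y
  proof -
    have "\<pi> (vprod F n x y) = vprod (va_image F \<pi>) n (\<pi> x) (\<pi> y)"
      using hom that unfolding va_hom_def by blast
    then show ?thesis
      using S that by auto
  qed
  moreover have "X \<subseteq> ?T" "vone F \<in> ?T"
    using S X by auto
  ultimately have closed: "?T \<subseteq> carrier F \<and> sc.subspace ?T \<and> X \<subseteq> ?T \<and> vone F \<in> ?T \<and>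
      (\<forall>n. \<forall>x\<in>?T. \<forall>y\<in>?T. vprod F n x y \<in> ?T)"
    by blast
  have "\<forall>T. T \<subseteq> carrier F \<and> sc.subspace T \<and> X \<subseteq> T \<and> vone F \<in> T \<and>
      (\<forall>n. \<forall>x\<in>T. \<forall>y\<in>T. vprod F n x y \<in> T) \<longrightarrow> T = carrier F"
    using gen unfolding va_generated_def by (rule conjunct2)
  from this[THEN spec, THEN mp, OF closed] have "?T = carrier F" .
  then show "S = carrier (va_image F \<pi>)"
    using S by auto
qed

lemma va_hom_kernel_ideal:
  assumes A: "vertex_algebra A" and B: "vertex_algebra B" and f: "va_hom A B f"
  shows "va_ideal A {x \<in> carrier A. f x = 0}"
proof -
  interpret A: vertex_algebra A by (rule A)
  interpret B: vertex_algebra B by (rule B)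
  have f0: "f 0 = 0"
    using f A.carrier_zero unfolding va_hom_def by (metis add_cancel_right_right)
  show ?thesis
    unfolding va_ideal_def using f f0
    by (auto simp: va_hom_def intro!: A.sc.subspaceI)
qed

theorem mainTheorem6:
  fixes bil :: "'l::ab_group_add \<Rightarrow> 'l \<Rightarrow> int"
    and P :: "'l set"
    and \<epsilon> :: "'l \<Rightarrow> 'l \<Rightarrow> 'k::field_char_0"
    and V :: "('k, 'v::ab_group_add) va"
    and act :: "'l \<Rightarrow> int \<Rightarrow> 'v \<Rightarrow> 'v"
    and v :: "'l \<Rightarrow> 'v"
    and F :: "('k, 'f::ab_group_add) va"
    and i :: "'l \<Rightarrow> 'f"
  assumes "lattice_form bil"
    and "Z_basis P"
    and "lattice_cocycle bil \<epsilon>"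
    and "\<forall>a\<in>P. \<epsilon> a a = 1"
    and "lattice_vertex_algebra bil \<epsilon> act v V"
    and "free_vertex_algebra TYPE('v) (P \<union> uminus ` P) (\<lambda>a b. - bil a b) F i"
  shows "va_presented F i (P \<union> uminus ` P) V v
           {(vprod F (bil a a - 1) (i a) (i (- a)), vone F) | a. a \<in> P}"
proof -
  let ?B = "P \<union> uminus ` P"
  let ?X = "{r - s | r s. (r, s) \<in> {(vprod F (bil a a - 1) (i a) (i (- a)), vone F) | a. a \<in> P}}"
  let ?K = "va_ideal_generated F ?X"
  interpret F: vertex_algebra F
    using assms(6) by (simp add: free_vertex_algebra_def)
  interpret V: vertex_algebra V
    using assms(5) by (simp add: lattice_vertex_algebra_def)
  note bil_neg = lattice_form_neg[OF assms(1)]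
  have gen: "va_generated F (i ` ?B)" and bound: "locality_bounded ?B (\<lambda>a b. - bil a b) F i"
    using assms(6) by (simp_all add: free_vertex_algebra_def)
  have i_part: "i a \<in> part F (odd (bil a a))" if "a \<in> ?B" for a
    using bound that by (auto simp: locality_bounded_def)
  obtain M where M: "\<And>a. verma_module bil (scale V) act a (v a) (M a)"
      "\<And>p. part V p = V.sc.span (\<Union>a\<in>{a. odd (bil a a) = p}. M a)"
    using assms(5) by (auto simp: lattice_vertex_algebra_def)
  have "v a \<in> part V (odd (bil a a))" for a
    unfolding M(2) using M(1)[of a] by (auto simp: verma_module_def intro!: V.sc.span_base)
  moreover have "\<forall>a b n. n \<ge> - bil a b \<longrightarrow> vprod V n (v a) (v b) = 0"
    using assms(5) unfolding lattice_vertex_algebra_def by (elim conjE)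
  ultimately have "locality_bounded ?B (\<lambda>a b. - bil a b) V v"
    by (simp add: locality_bounded_def)
  with V.vertex_algebra_axioms have boundV: "vertex_algebra V \<and> locality_bounded ?B (\<lambda>a b. - bil a b) V v"
    by (rule conjI)
  obtain f where f: "va_hom F V f" "\<And>b. b \<in> ?B \<Longrightarrow> f (i b) = v b"
    using assms(6)[unfolded free_vertex_algebra_def, THEN conjunct2, THEN conjunct2, THEN conjunct2,
        THEN spec, of V, THEN spec, of v, THEN mp, OF boundV]
    by blast
  have X: "?X \<subseteq> part F False"
  proof -
    have "vprod F (bil a a - 1) (i a) (i (- a)) \<in> part F False" if "a \<in> P" for a
      using F.prod_even[OF i_part i_part, of a "- a"] that by (simp add: bil_neg)
    then show ?thesis
      using F.one_even by (auto intro!: F.part_diff)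
  qed
  then have XC: "?X \<subseteq> carrier F"
    using F.part_carrier by blast
  note K = F.va_ideal_generated[OF XC]
  obtain \<pi> where \<pi>: "Vector_Spaces.linear (scale F) (scale F) \<pi>" "\<And>x. \<pi> x = 0 \<longleftrightarrow> x \<in> ?K" "\<And>x. \<pi> (\<pi> x) = \<pi> x"
    using F.sc.projection_along[OF va_idealD(2)[OF K(1)]] by blast
  interpret pi: Vector_Spaces.linear "scale F" "scale F" \<pi>
    by (rule \<pi>(1))
  let ?Q = "va_image F \<pi>"
  have Q: "vertex_algebra ?Q" "va_hom F ?Q \<pi>"
    using F.even_ideal_graded[OF X]
    by (blast intro: F.vertex_algebra_quotient[OF K(1) _ \<pi>])+
  interpret Q: vertex_algebra ?Q
    by (rule Q(1))
  have pi_prod: "\<pi> (vprod F n x y) = vprod ?Q n (\<pi> x) (\<pi> y)"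
    if "x \<in> carrier F" "y \<in> carrier F" for n x y
    using Q(2) that unfolding va_hom_def by blast
  have i_carrier: "i a \<in> carrier F" if "a \<in> ?B" for a
    using i_part[OF that] by (rule F.part_carrier)
  interpret lattice_relations ?Q bil P "\<lambda>a. \<pi> (i a)"
  proof
    show "lattice_form bil" "Z_basis P" by fact+
    show "locality_bounded ?B (\<lambda>a b. - bil a b) ?Q (\<lambda>a. \<pi> (i a))"
      unfolding locality_bounded_def
    proof (intro conjI ballI allI impI)
      show "\<pi> (i a) \<in> part ?Q (odd (- bil a a))" if "a \<in> ?B" for a
        using i_part[OF that] by simp
      show "vprod ?Q n (\<pi> (i a)) (\<pi> (i b)) = 0" if "a \<in> ?B" "b \<in> ?B" "- bil a b \<le> n" for a b n
        using bound that unfolding pi_prod[OF i_carrier[OF that(1)] i_carrier[OF that(2)], symmetric]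
        by (simp add: locality_bounded_def pi.zero)
    qed
    show "vprod ?Q (bil a a - 1) (\<pi> (i a)) (\<pi> (i (- a))) = vone ?Q" if "a \<in> P" for a
    proof -
      have "vprod F (bil a a - 1) (i a) (i (- a)) - vone F \<in> ?K"
        using K(2) that by blast
      then have "\<pi> (vprod F (bil a a - 1) (i a) (i (- a))) = \<pi> (vone F)"
        unfolding \<pi>(2)[symmetric] by (simp add: pi.diff)
      then show ?thesis
        using that i_carrier by (simp add: pi_prod del: va_image_simps(4))
    qed
    show "va_generated ?Q ((\<lambda>a. \<pi> (i a)) ` ?B)"
      using va_generated_image[OF F.vertex_algebra_axioms gen \<pi>(1) Q(2)] by (simp add: image_image)
  qed
  have ker: "va_ideal F {x \<in> carrier F. f x = 0}"
    by (rule va_hom_kernel_ideal[OF F.vertex_algebra_axioms V.vertex_algebra_axioms f(1)])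
  have f_diff: "f (x - y) = f x - f y" if "x \<in> carrier F" "y \<in> carrier F" for x y
  proof -
    have "f (x - y + y) = f (x - y) + f y"
      using f(1) that F.carrier_diff unfolding va_hom_def by blast
    then show ?thesis by simp
  qed
  have "?X \<subseteq> {x \<in> carrier F. f x = 0}"
  proof -
    have "f (vprod F (bil a a - 1) (i a) (i (- a))) = f (vone F)" if "a \<in> P" for a
    proof -
      have "f (vprod F (bil a a - 1) (i a) (i (- a))) = vprod V (bil a a - 1) (f (i a)) (f (i (- a)))"
        using f(1) i_carrier that unfolding va_hom_def by blast
      also have "\<dots> = vprod V (- bil a (- a) - int 0 - 1) (v a) (v (- a))"
        using f(2) that by (simp add: bil_neg)
      also have "\<dots> = scale V (\<epsilon> a (- a) * (1 / fact 0))
          (((\<lambda>x. va_D V x - act (- a) (-1) x) ^^ 0) (v (a + - a)))"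
        using assms(5) unfolding lattice_vertex_algebra_def by blast
      also have "\<dots> = f (vone F)"
        using that f(1) assms(4,5) cocycle_neg[OF assms(3), of a]
        by (simp add: va_hom_def lattice_vertex_algebra_def)
      finally show ?thesis .
    qed
    then show ?thesis
      using XC i_carrier by (auto simp: f_diff)
  qed
  then have K_ker: "?K \<subseteq> {x \<in> carrier F. f x = 0}"
    by (rule F.va_ideal_generated_least[OF ker])
  have pi_carrier: "\<pi> x \<in> carrier F" and f_pi: "f (\<pi> x) = f x" if "x \<in> carrier F" for x
  proof -
    have "\<pi> x - x \<in> ?K"
      unfolding \<pi>(2)[symmetric] by (simp add: pi.diff \<pi>(3))
    then have d: "\<pi> x - x \<in> carrier F" "f (\<pi> x - x) = 0"
      using K_ker by auto
    then show "\<pi> x \<in> carrier F"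
      using F.carrier_add[OF d(1) that] by simp
    with d(2) that show "f (\<pi> x) = f x"
      by (simp add: f_diff)
  qed
  have homQ: "va_hom ?Q V f"
    using f(1) pi_carrier unfolding va_hom_def by (auto simp: f_pi)
  interpret lattice_comparison ?Q bil P "\<lambda>a. \<pi> (i a)" \<epsilon> V act v f
    using assms homQ f(2) i_carrier by unfold_locales (auto simp: f_pi)
  show ?thesis
    unfolding va_presented_def
  proof (intro exI[of _ f] conjI ballI)
    show "va_hom F V f" by (rule f(1))
    show "f (i b) = v b" if "b \<in> ?B" for b
      using that by (rule f(2))
    have "f ` carrier F = f ` carrier ?Q"
      by (auto simp: f_pi image_image)
    then show "f ` carrier F = carrier V"
      using hom_surj by simp
    show "{x \<in> carrier F. f x = 0} = ?K"
    proof
      show "{x \<in> carrier F. f x = 0} \<subseteq> ?K"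
      proof
        fix x assume x: "x \<in> {x \<in> carrier F. f x = 0}"
        then have "\<pi> x = 0"
          by (intro hom_inj) (simp_all add: f_pi)
        then show "x \<in> ?K"
          by (simp only: \<pi>(2))
      qed
    qed (rule K_ker)
  qed
qed

end
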